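(* Let $\mathcal X$ be a Polish space, $\Omega=D([0,1],\mathcal X)$, and let $C:\Omega\to[0,\infty]$ be lower semicontinuous. For each integer $k\ge1$ let $(R^{k,x})_{x\in\mathcal X}$ be a measurable kernel of probability measures on $\Omega$ with $R^{k,x}(\{X_0=x\})=1$ for every $x$. Assume that for each $x\in\mathcal X$ the sequence $(R^{k,x})_{k\ge1}$ satisfies the large deviation principle in $\Omega$ with scale $k$ and the coercive rate function $C^x=C+\iota_{\{X_0=x\}}:\Omega\to[0,\infty]$. Let $\mu_0,\mu_1\in\mathrm P(\mathcal X)$. For $k\ge1$ and $\nu\in\mathrm P(\mathcal X)$ consider the problems $$(\mathrm S^k(\nu))\qquad \tfrac1k H(P|R^{k,\mu_0})\to\min;\quad P\in\mathrm P(\Omega):\ P_0=\mu_0,\ P_1=\nu,$$ $$(\mathrm{MK}_{\mathrm{dyn}})\qquad \int_\Omega C\,dP\to\min;\quad P\in\mathrm P(\Omega):\ P_0=\mu_0,\ P_1=\mu_1.$$ Then there exists a sequence $(\mu_1^k)_{k\ge1}$ in $\mathrm P(\mathcal X)$ such that $\lim_{k\to\infty}\mu_1^k=\mu_1$ and $$\lim_{k\to\infty}\inf(\mathrm S^k(\mu_1^k))=\inf(\mathrm{MK}_{\mathrm{dyn}})\in[0,\infty].$$ Moreover, let $(\mu_1^k)_{k\ge1}$ be any such sequence and suppose in addition that $\inf(\mathrm{MK}_{\mathrm{dyn}})<\infty$. Then for each large enough $k$, $(\mathrm S^k(\mu_1^k))$ admits a unique solution $\widehat P^k\in\mathrm P(\Omega)$,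 and any limit point of the sequence $(\widehat P^k)$ in $\mathrm P(\Omega)$ is a solution to $(\mathrm{MK}_{\mathrm{dyn}})$. In particular, if $(\mathrm{MK}_{\mathrm{dyn}})$ admits a unique solution $\widehat P\in\mathrm P(\Omega)$, then $\lim_{k\to\infty}\widehat P^k=\widehat P$ in $\mathrm P(\Omega)$.
   Context: $\Omega=D([0,1],\mathcal X)$ is the set of càdlàg $\mathcal X$-valued paths on $[0,1]$ with the Skorokhod metric, which makes it Polish; $X_t(\omega)=\omega_t$ is the canonical process. For a topological space $E$, $\mathrm P(E)$ is the set of Borel probability measures on $E$ with the narrow topology (weakest topology making $\mu\mapsto\int f\,d\mu$ continuous for all bounded continuous $f$). For $P\in\mathrm P(\Omega)$, $P_t:=(X_t)_\#P\in\mathrm P(\mathcal X)$. $R^{k,\mu_0}(\cdot):=\int_{\mathcal X}R^{k,x}(\cdot)\,\mu_0(dx)\in\mathrm P(\Omega)$. $\iota_A$ is the indicator with value $0$ on $A$ and $+\infty$ off $A$. Relative entropy: $H(P|R)=\int\log(dP/dR)\,dP\in[0,\infty]$ if $P\ll R$, and $\infty$ otherwise. A function $f:E\to(-\infty,\infty]$ on a Hausdorff space is coercive if all its sublevel sets $\{f\le a\}$, $a\in\mathbb R$, are compact. A sequence $(\gamma_k)_{k\ge1}$ of Borel probability measures on a Polish space $E$ satisfies the large deviation principle with scale $k$ and rate function $I:E\to[0,\infty]$ (lower semicontinuous) if for each Borel $A\subset E$, $-\inf_{\mathrm{int} A}I\le\liminf_k\frac1k\log\gamma_k(A)\le\limsup_k\frac1k\log\gamma_k(A)\le-\inf_{\mathrm{cl}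 A}I$. The infimum over the empty set is $+\infty$; $\inf$ of a problem denotes its minimal value. *)

theory Defs
  imports "HOL-Probability.Probability"
begin

section \<open>Cadlag paths and the Skorokhod metric\<close>

text \<open>
  A path on \<open>[0,1]\<close> is a function on the reals that takes the value \<^const>\<open>undefined\<close>
  outside \<open>[0,1]\<close>, so that equality of paths is equality on \<open>[0,1]\<close>.
\<close>

definition cadlag_on_unit :: "(real \<Rightarrow> 'a::topological_space) \<Rightarrow> bool" where
  "cadlag_on_unit f \<longleftrightarrow>
     (\<forall>t\<in>{0..<1}. (f \<longlongrightarrow> f t) (at_right t)) \<and>
     (\<forall>t\<in>{0<..1}. \<exists>l. (f \<longlongrightarrow> l) (at_left t))"

typedef (overloaded) ('a::topological_space) cadlag =
  "{f :: real \<Rightarrow> 'a. f \<in> extensional {0..1} \<and> cadlag_on_unit f}"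
  morphisms cpath Abs_cadlag
proof
  have "((\<lambda>t\<in>{0..1::real}. c) \<longlongrightarrow> c) (at_right t)" if "t \<in> {0..<1}" for t and c :: 'a
    by (rule tendsto_eventually, rule eventually_at_rightI[of t 1]) (use that in auto)
  moreover have "((\<lambda>t\<in>{0..1::real}. c) \<longlongrightarrow> c) (at_left t)" if "t \<in> {0<..1}" for t and c :: 'a
    by (rule tendsto_eventually, rule eventually_at_leftI[of 0 t]) (use that in auto)
  ultimately have "cadlag_on_unit (\<lambda>t\<in>{0..1}. undefined :: 'a)"
    unfolding cadlag_on_unit_def by fastforce
  then show "(\<lambda>t\<in>{0..1}. undefined) \<in> {f :: real \<Rightarrow> 'a. f \<in> extensional {0..1} \<and> cadlag_on_unit f}"
    by simp
qed

definition time_change :: "(real \<Rightarrow> real) \<Rightarrow> bool" where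
  "time_change lam \<longleftrightarrow> strict_mono_on {0..1} lam \<and> lam ` {0..1} = {0..1}"

text \<open>
  The Skorokhod metric is used in Billingsley's form: the distance of two paths is the infimum
  of all \<open>e\<close> that admit a time change whose logarithmic slopes are at most \<open>e\<close> in modulus
  and which brings the paths within uniform distance \<open>e\<close>. It induces the same topology as the
  variant that bounds \<open>\<bar>lam t - t\<bar>\<close> instead of the slopes, and it is complete if the metric
  of the state space is.
\<close>

definition skorokhod_close ::
    "(real \<Rightarrow> 'a::metric_space) \<Rightarrow> (real \<Rightarrow> 'a) \<Rightarrow> real \<Rightarrow> bool" where
  "skorokhod_close f g e \<longleftrightarrow> (\<exists>lam. time_change lam \<and>
     (\<forall>s\<in>{0..1}. \<forall>t\<in>{0..1}. s < t \<longrightarrow> \<bar>ln ((lam t - lam s) / (t - s))\<bar> \<le> e) \<and>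
     (\<forall>t\<in>{0..1}. dist (f t) (g (lam t)) \<le> e))"

lemma time_change_01:
  assumes "time_change lam"
  shows "lam 0 = 0" "lam 1 = 1"
proof -
  have m: "\<And>s t. s \<in> {0..1} \<Longrightarrow> t \<in> {0..1} \<Longrightarrow> s \<le> t \<Longrightarrow> lam s \<le> lam t"
    using assms unfolding time_change_def
    by (metis order_le_less strict_mono_onD order_refl)
  have im: "lam ` {0..1} = {0..1}" using assms by (simp add: time_change_def)
  have "0 \<in> lam ` {0..1}" "1 \<in> lam ` {0..1}" by (simp_all add: im)
  then obtain u v where uv: "u \<in> {0..1}" "lam u = 0" "v \<in> {0..1}" "lam v = 1"
    by (metis imageE)
  have "lam 0 \<in> {0..1}" "lam 1 \<in> {0..1}" using im by force+
  then show "lam 0 = 0" "lam 1 = 1"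
    using m[of 0 u] m[of v 1] uv by auto
qed

lemma time_change_in: "time_change lam \<Longrightarrow> t \<in> {0..1} \<Longrightarrow> lam t \<in> {0..1}"
  unfolding time_change_def by blast

lemma time_change_less:
  "time_change lam \<Longrightarrow> s \<in> {0..1} \<Longrightarrow> t \<in> {0..1} \<Longrightarrow> s < t \<Longrightarrow> lam s < lam t"
  unfolding time_change_def by (meson strict_mono_onD)

lemma skorokhod_close_nonneg: "skorokhod_close f g e \<Longrightarrow> 0 \<le> e"
  unfolding skorokhod_close_def by (metis atLeastAtMost_iff order_refl zero_le_dist order_trans zero_le_one)

lemma skorokhod_close_mono:
  assumes "skorokhod_close f g d" "d \<le> e"
  shows "skorokhod_close f g e"
proof -
  obtain lam where lam: "time_change lam"
    "\<And>s t. s \<in> {0..1} \<Longrightarrow> t \<in> {0..1} \<Longrightarrow> s < t \<Longrightarrow> \<bar>ln ((lam t - lam s) / (t - s))\<bar> \<le> d"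
    "\<And>t. t \<in> {0..1} \<Longrightarrow> dist (f t) (g (lam t)) \<le> d"
    using assms(1) unfolding skorokhod_close_def by blast
  show ?thesis unfolding skorokhod_close_def
    by (rule exI[of _ lam], intro conjI ballI impI lam(1) order_trans[OF lam(2) assms(2)]
        order_trans[OF lam(3) assms(2)])
qed

lemma skorokhod_close_id:
  assumes "0 \<le> e" "\<And>t. t \<in> {0..1} \<Longrightarrow> dist (f t) (g t) \<le> e"
  shows "skorokhod_close f g e"
  unfolding skorokhod_close_def time_change_def
  by (rule exI[of _ "\<lambda>t. t"]) (use assms in \<open>auto simp: strict_mono_on_def\<close>)

lemma skorokhod_close_sym:
  assumes "skorokhod_close f g e"
  shows "skorokhod_close g f e"
proof -
  obtain lam where lam: "time_change lam"
    "\<And>s t. s \<in> {0..1} \<Longrightarrow> t \<in> {0..1} \<Longrightarrow> s < t \<Longrightarrow> \<bar>ln ((lam t - lam s) / (t - s))\<bar> \<le> e"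
    "\<And>t. t \<in> {0..1} \<Longrightarrow> dist (f t) (g (lam t)) \<le> e"
    using assms unfolding skorokhod_close_def by blast
  define h where "h = inv_into {0..1} lam"
  have inj: "inj_on lam {0..1}"
    using lam(1) by (simp add: time_change_def strict_mono_on_imp_inj_on)
  have im: "lam ` {0..1} = {0..1}" using lam(1) by (simp add: time_change_def)
  have h1: "lam (h t) = t" "h t \<in> {0..1}" if "t \<in> {0..1}" for t
    using that im unfolding h_def by (simp_all add: f_inv_into_f inv_into_into del: atLeastAtMost_iff)
  have mono: "h s < h t" if "s \<in> {0..1}" "t \<in> {0..1}" "s < t" for s t
  proof (rule ccontr)
    assume "\<not> h s < h t"
    then have "h t = h s \<or> h t < h s" by auto
    then have "lam (h t) \<le> lam (h s)"
      using time_change_less[OF lam(1)] h1 that by (metis less_imp_le order_refl)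
    then show False using h1 that by simp
  qed
  have "time_change h" unfolding time_change_def
  proof
    show "strict_mono_on {0..1} h" using mono by (simp add: strict_mono_on_def)
    show "h ` {0..1} = {0..1}" unfolding h_def using inj im
      by (metis inv_into_image_cancel order_refl)
  qed
  moreover have "\<bar>ln ((h t - h s) / (t - s))\<bar> \<le> e" if st: "s \<in> {0..1}" "t \<in> {0..1}" "s < t" for s t
  proof -
    have "\<bar>ln ((t - s) / (h t - h s))\<bar> \<le> e"
      using lam(2)[of "h s" "h t"] h1 mono st by simp
    moreover have "ln ((t - s) / (h t - h s)) = - ln ((h t - h s) / (t - s))"
      using mono[OF st] st by (simp add: ln_div)
    ultimately show ?thesis by simp
  qed
  moreover have "dist (g t) (f (h t)) \<le> e" if "t \<in> {0..1}" for t
    using lam(3)[of "h t"] h1[OF that] by (simp add: dist_commute)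
  ultimately show ?thesis unfolding skorokhod_close_def by blast
qed

lemma skorokhod_close_trans:
  assumes "skorokhod_close f g d" "skorokhod_close g h e"
  shows "skorokhod_close f h (d + e)"
proof -
  obtain lam where lam: "time_change lam"
    "\<And>s t. s \<in> {0..1} \<Longrightarrow> t \<in> {0..1} \<Longrightarrow> s < t \<Longrightarrow> \<bar>ln ((lam t - lam s) / (t - s))\<bar> \<le> d"
    "\<And>t. t \<in> {0..1} \<Longrightarrow> dist (f t) (g (lam t)) \<le> d"
    using assms(1) unfolding skorokhod_close_def by blast
  obtain mu where mu: "time_change mu"
    "\<And>s t. s \<in> {0..1} \<Longrightarrow> t \<in> {0..1} \<Longrightarrow> s < t \<Longrightarrow> \<bar>ln ((mu t - mu s) / (t - s))\<bar> \<le> e"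
    "\<And>t. t \<in> {0..1} \<Longrightarrow> dist (g t) (h (mu t)) \<le> e"
    using assms(2) unfolding skorokhod_close_def by blast
  let ?n = "mu \<circ> lam"
  have "strict_mono_on {0..1} ?n"
    unfolding strict_mono_on_def
    using time_change_less[OF lam(1)] time_change_less[OF mu(1)] time_change_in[OF lam(1)]
    by (metis comp_apply)
  moreover have "?n ` {0..1} = {0..1}"
    using lam(1) mu(1) unfolding time_change_def image_comp[symmetric] by simp
  ultimately have "time_change ?n" by (simp add: time_change_def)
  moreover have "\<bar>ln ((?n t - ?n s) / (t - s))\<bar> \<le> d + e"
    if st: "s \<in> {0..1}" "t \<in> {0..1}" "s < t" for s t
  proof -
    have l: "lam s < lam t" "lam s \<in> {0..1}" "lam t \<in> {0..1}"
      using st time_change_less[OF lam(1)] time_change_in[OF lam(1)] by auto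
    have m: "mu (lam s) < mu (lam t)"
      using l time_change_less[OF mu(1)] by auto
    have "ln ((?n t - ?n s) / (t - s))
        = ln ((mu (lam t) - mu (lam s)) / (lam t - lam s)) + ln ((lam t - lam s) / (t - s))"
      using l(1) m st by (simp add: ln_div)
    then show ?thesis using lam(2)[OF st] mu(2)[OF l(2,3,1)] by linarith
  qed
  moreover have "dist (f t) (h (?n t)) \<le> d + e" if "t \<in> {0..1}" for t
    using lam(3)[OF that] mu(3)[OF time_change_in[OF lam(1) that]]
      dist_triangle[of "f t" "h (?n t)" "g (lam t)"] by simp
  ultimately show ?thesis unfolding skorokhod_close_def by blast
qed

lemma cadlag_bounded:
  fixes f :: "real \<Rightarrow> 'a::metric_space"
  assumes "cadlag_on_unit f"
  shows "bounded (f ` {0..1})"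
proof -
  have R: "\<exists>b>t. bounded (f ` ({t<..<b} \<inter> {0..1}))" if t: "t \<in> {0..1}" for t
  proof (cases "t < 1")
    case True
    with t have "t \<in> {0..<1}" by simp
    then have "eventually (\<lambda>s. dist (f s) (f t) < 1) (at_right t)"
      using assms t unfolding cadlag_on_unit_def
      by (intro tendstoD) auto
    then obtain b where "b > t" "\<And>s. s > t \<Longrightarrow> s < b \<Longrightarrow> dist (f s) (f t) < 1"
      unfolding eventually_at_right_field by blast
    moreover from this have "bounded (f ` ({t<..<b} \<inter> {0..1}))"
      by (intro bounded_subset[OF bounded_ball[of "f t" 1]]) (auto simp: dist_commute)
    ultimately show ?thesis by blast
  next
    case False
    with t have "{t<..<t+1} \<inter> {0..1} = {}" by auto
    then show ?thesis by (intro exI[of _ "t+1"]) (simp del: greaterThanLessThan_iff)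
  qed
  have L: "\<exists>a<t. bounded (f ` ({a<..<t} \<inter> {0..1}))" if t: "t \<in> {0..1}" for t
  proof (cases "t > 0")
    case True
    with t have "t \<in> {0<..1}" by simp
    then obtain l where "(f \<longlongrightarrow> l) (at_left t)"
      using assms t unfolding cadlag_on_unit_def by blast
    then have "eventually (\<lambda>s. dist (f s) l < 1) (at_left t)"
      by (intro tendstoD) auto
    then obtain a where "a < t" "\<And>s. s > a \<Longrightarrow> s < t \<Longrightarrow> dist (f s) l < 1"
      unfolding eventually_at_left_field by blast
    moreover from this have "bounded (f ` ({a<..<t} \<inter> {0..1}))"
      by (intro bounded_subset[OF bounded_ball[of l 1]]) (auto simp: dist_commute)
    ultimately show ?thesis by blast
  next
    case False
    with t have "{t-1<..<t} \<inter> {0..1} = {}" by auto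
    then show ?thesis by (intro exI[of _ "t-1"]) (simp del: greaterThanLessThan_iff)
  qed
  have "\<exists>T. open T \<and> t \<in> T \<and> bounded (f ` (T \<inter> {0..1}))" if t: "t \<in> {0..1}" for t
  proof -
    obtain a b where ab: "a < t" "t < b" "bounded (f ` ({a<..<t} \<inter> {0..1}))"
      "bounded (f ` ({t<..<b} \<inter> {0..1}))"
      using L[OF t] R[OF t] by blast
    have "{a<..<b} \<inter> {0..1} \<subseteq> ({a<..<t} \<inter> {0..1}) \<union> ({t<..<b} \<inter> {0..1}) \<union> {t}"
      by auto
    then have "f ` ({a<..<b} \<inter> {0..1}) \<subseteq>
        f ` ({a<..<t} \<inter> {0..1}) \<union> f ` ({t<..<b} \<inter> {0..1}) \<union> {f t}"
      by blast
    then have "bounded (f ` ({a<..<b} \<inter> {0..1}))"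
      using ab(3,4) by (meson bounded_Un bounded_subset finite.emptyI finite_imp_bounded finite_insert)
    then show ?thesis using ab by (intro exI[of _ "{a<..<b}"]) auto
  qed
  then obtain T where T: "\<And>t. t \<in> {0..1} \<Longrightarrow> open (T t)" "\<And>t. t \<in> {0..1} \<Longrightarrow> t \<in> T t"
    "\<And>t. t \<in> {0..1} \<Longrightarrow> bounded (f ` (T t \<inter> {0..1}))"
    by metis
  obtain K where K: "K \<subseteq> {0..1}" "finite K" "{0..1::real} \<subseteq> (\<Union>c\<in>K. T c)"
    by (rule compactE_image[OF compact_Icc, of "{0..1}" T "0::real" 1]) (use T in auto)
  have "f ` {0..1} \<subseteq> (\<Union>c\<in>K. f ` (T c \<inter> {0..1}))" using K(3) by blast
  moreover have "bounded (\<Union>c\<in>K. f ` (T c \<inter> {0..1}))"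
    using K T(3) by (intro bounded_UN) auto
  ultimately show ?thesis by (rule bounded_subset[rotated])
qed

lemma skorokhod_close_ex:
  assumes "cadlag_on_unit f" "cadlag_on_unit g"
  shows "\<exists>e. skorokhod_close f g e"
proof -
  have "bounded (f ` {0..1} \<union> g ` {0..1})"
    using cadlag_bounded[OF assms(1)] cadlag_bounded[OF assms(2)] by simp
  then obtain e where "\<And>x y. x \<in> f ` {0..1} \<union> g ` {0..1} \<Longrightarrow> y \<in> f ` {0..1} \<union> g ` {0..1} \<Longrightarrow> dist x y \<le> e"
    unfolding bounded_two_points by blast
  then have d: "dist (f t) (g t) \<le> e" if "t \<in> {0..1}" for t using that by blast
  then have "0 \<le> e" by (meson atLeastAtMost_iff order_refl order_trans zero_le_dist zero_le_one)
  then show ?thesis using d skorokhod_close_id by blast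
qed

lemma skorokhod_close_all_imp_eq:
  assumes f: "cadlag_on_unit f" and g: "cadlag_on_unit g"
    and close: "\<And>e. e > 0 \<Longrightarrow> skorokhod_close f g e" and t: "t \<in> {0..1}"
  shows "f t = g t"
proof (cases "t < 1")
  case False
  then have [simp]: "t = 1" using t by auto
  have "dist (f 1) (g 1) \<le> e" if e: "e > 0" for e
  proof -
    have "(1::real) \<in> {0..1}" by simp
    then obtain lam where lam: "time_change lam" "dist (f 1) (g (lam 1)) \<le> e"
      using close[OF e] unfolding skorokhod_close_def by blast
    then show ?thesis using time_change_01[OF lam(1)] by simp
  qed
  then have "dist (f 1) (g 1) \<le> 0" by (meson dense_ge)
  then show ?thesis by simp
next
  case True
  have "dist (f t) (g t) \<le> 0 + eps" if eps: "eps > 0" for eps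
  proof -
    have "(f \<longlongrightarrow> f t) (at_right t)" "(g \<longlongrightarrow> g t) (at_right t)"
      using f g True t unfolding cadlag_on_unit_def by simp_all
    then have "eventually (\<lambda>s. dist (f s) (f t) < eps / 3) (at_right t)"
      "eventually (\<lambda>s. dist (g s) (g t) < eps / 3) (at_right t)"
      using eps by (auto dest!: tendstoD[where e = "eps / 3"] simp del: less_divide_eq_numeral1)
    then have "eventually (\<lambda>s. dist (f s) (f t) < eps / 3 \<and> dist (g s) (g t) < eps / 3) (at_right t)"
      by (rule eventually_conj)
    then obtain b where b: "b > t"
      "\<And>s. s > t \<Longrightarrow> s < b \<Longrightarrow> dist (f s) (f t) < eps / 3 \<and> dist (g s) (g t) < eps / 3"
      unfolding eventually_at_right_field by blast
    define s where "s = (t + min b 1) / 2"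
    have s: "t < s" "s < b" "s < 1" "0 < s" using b(1) True t by (auto simp: s_def)
    have lims: "((\<lambda>d::real. s * exp d) \<longlongrightarrow> s * exp 0) (at_right 0)"
      "((\<lambda>d::real. s * exp (-d)) \<longlongrightarrow> s * exp (-0)) (at_right 0)"
      by (intro tendsto_intros)+
    have "eventually (\<lambda>d. s * exp d < b) (at_right 0)" "eventually (\<lambda>d. s * exp (-d) > t) (at_right 0)"
      using order_tendstoD(2)[OF lims(1), of b] order_tendstoD(1)[OF lims(2), of t] s by simp_all
    moreover have "eventually (\<lambda>d::real. d > 0 \<and> d < eps / 3) (at_right 0)"
      by (rule eventually_at_rightI[of 0 "eps/3"]) (use eps in auto)
    ultimately have "eventually (\<lambda>d. s * exp d < b \<and> s * exp (-d) > t \<and> d > 0 \<and> d < eps / 3) (at_right 0)"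
      by eventually_elim auto
    then obtain d where d: "s * exp d < b" "s * exp (-d) > t" "d > 0" "d < eps / 3"
      using eventually_happens'[OF trivial_limit_at_right_real] by blast
    obtain lam where lam: "time_change lam"
      "\<And>s t. s \<in> {0..1} \<Longrightarrow> t \<in> {0..1} \<Longrightarrow> s < t \<Longrightarrow> \<bar>ln ((lam t - lam s) / (t - s))\<bar> \<le> d"
      "\<And>t. t \<in> {0..1} \<Longrightarrow> dist (f t) (g (lam t)) \<le> d"
      using close[OF d(3)] unfolding skorokhod_close_def by blast
    have pos: "0 < lam s"
      using time_change_less[OF lam(1), of 0 s] time_change_01[OF lam(1)] s by simp
    have "\<bar>ln (lam s / s)\<bar> \<le> d"
      using lam(2)[of 0 s] time_change_01[OF lam(1)] s by simp
    then have "ln (lam s / s) \<le> d" "-d \<le> ln (lam s / s)" by linarith+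
    then have "exp (ln (lam s / s)) \<le> exp d" "exp (-d) \<le> exp (ln (lam s / s))"
      by (simp_all only: exp_le_cancel_iff)
    then have "lam s / s \<le> exp d" "exp (-d) \<le> lam s / s"
      using pos s by simp_all
    then have "lam s \<le> s * exp d" "s * exp (-d) \<le> lam s"
      using s by (simp_all add: field_simps)
    then have "t < lam s" "lam s < b" using d by linarith+
    then have "dist (g (lam s)) (g t) < eps / 3" "dist (f s) (f t) < eps / 3"
      using b s by auto
    moreover have "dist (f s) (g (lam s)) \<le> d" using lam(3) s by auto
    ultimately show ?thesis
      using d dist_triangle[of "f t" "g t" "f s"] dist_triangle[of "f s" "g t" "g (lam s)"]
      by (simp add: dist_commute)
  qed
  then have "dist (f t) (g t) \<le> 0" by (rule field_le_epsilon)
  then show ?thesis by simp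
qed

instantiation cadlag :: (metric_space) metric_space
begin

definition dist_cadlag :: "'a cadlag \<Rightarrow> 'a cadlag \<Rightarrow> real" where
  "dist_cadlag x y = Inf {e. skorokhod_close (cpath x) (cpath y) e}"

definition uniformity_cadlag :: "('a cadlag \<times> 'a cadlag) filter" where
  "uniformity_cadlag = (INF e\<in>{0 <..}. principal {(x, y). dist x y < e})"

definition open_cadlag :: "'a cadlag set \<Rightarrow> bool" where
  "open_cadlag S \<longleftrightarrow> (\<forall>x\<in>S. \<forall>\<^sub>F (x', y) in uniformity. x' = x \<longrightarrow> y \<in> S)"

instance
proof
  fix x y z :: "'a cadlag"
  have cad: "cadlag_on_unit (cpath x)" "cpath x \<in> extensional {0..1}" for x :: "'a cadlag"
    using cpath[of x] by auto
  have ne: "{e. skorokhod_close (cpath x) (cpath y) e} \<noteq> {}" for x y :: "'a cadlag"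
    using skorokhod_close_ex[OF cad(1) cad(1)] by auto
  have bdd: "bdd_below {e. skorokhod_close (cpath x) (cpath y) e}" for x y :: "'a cadlag"
    by (rule bdd_belowI[of _ 0]) (use skorokhod_close_nonneg in auto)
  have ge0: "dist x y \<ge> 0" for x y :: "'a cadlag"
    unfolding dist_cadlag_def using skorokhod_close_nonneg by (intro cInf_greatest[OF ne]) auto
  have upper: "dist x y \<le> e" if "skorokhod_close (cpath x) (cpath y) e" for x y :: "'a cadlag" and e
    unfolding dist_cadlag_def by (rule cInf_lower[OF _ bdd]) (use that in auto)
  have approx: "\<exists>d. d < dist x y + e \<and> skorokhod_close (cpath x) (cpath y) d" if "e > 0" for x y :: "'a cadlag" and e
    using cInf_lessD[OF ne[of x y], of "dist x y + e"] that unfolding dist_cadlag_def by auto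
  have sym: "dist x y = dist y x" for x y :: "'a cadlag"
    unfolding dist_cadlag_def
    by (rule arg_cong[where f = Inf], rule Collect_cong) (blast intro: skorokhod_close_sym)
  show "(dist x y = 0) = (x = y)"
  proof
    assume "x = y"
    then have "dist x y \<le> 0" by (intro upper skorokhod_close_id) auto
    then show "dist x y = 0" using ge0[of x y] by simp
  next
    assume 0: "dist x y = 0"
    have close: "skorokhod_close (cpath x) (cpath y) e" if e: "e > 0" for e
    proof -
      obtain d where d: "d < e" "skorokhod_close (cpath x) (cpath y) d"
        using approx[OF e] 0 by (metis add_0)
      then show ?thesis using skorokhod_close_mono by fastforce
    qed
    have "cpath x t = cpath y t" for t
    proof (cases "t \<in> {0..1}")
      case True
      show ?thesis by (rule skorokhod_close_all_imp_eq[OF cad(1) cad(1) close True])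
    next
      case False
      then show ?thesis using cad(2) by (metis extensional_arb)
    qed
    then show "x = y" by (metis cpath_inject ext)
  qed
  show "dist x y \<le> dist x z + dist y z"
  proof (rule field_le_epsilon)
    fix e :: real assume "e > 0"
    then obtain d1 d2 where d: "d1 < dist x z + e/2" "skorokhod_close (cpath x) (cpath z) d1"
      "d2 < dist z y + e/2" "skorokhod_close (cpath z) (cpath y) d2"
      using approx[of "e/2"] by (meson half_gt_zero)
    have "dist x y \<le> d1 + d2" by (rule upper[OF skorokhod_close_trans[OF d(2,4)]])
    then show "dist x y \<le> dist x z + dist y z + e" using d sym[of z y] by simp
  qed
qed (rule uniformity_cadlag_def open_cadlag_def)+

end

lemma dist_endpoint_le:
  fixes x y :: "'a::metric_space cadlag"
  assumes "t \<in> {0, 1}"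
  shows "dist (cpath x t) (cpath y t) \<le> dist x y"
  unfolding dist_cadlag_def
proof (rule cInf_greatest)
  show "{e. skorokhod_close (cpath x) (cpath y) e} \<noteq> {}"
    using skorokhod_close_ex[of "cpath x" "cpath y"] cpath[of x] cpath[of y] by auto
next
  fix e assume "e \<in> {e. skorokhod_close (cpath x) (cpath y) e}"
  then obtain lam where lam: "time_change lam"
    "\<And>t. t \<in> {0..1} \<Longrightarrow> dist (cpath x t) (cpath y (lam t)) \<le> e"
    unfolding skorokhod_close_def by blast
  show "dist (cpath x t) (cpath y t) \<le> e"
    using lam(2)[of t] time_change_01[OF lam(1)] assms by auto
qed

lemma endpoint_measurable:
  assumes "t \<in> {0, 1}"
  shows "(\<lambda>\<omega>. cpath \<omega> t) \<in> borel_measurable (borel :: 'a::metric_space cadlag measure)"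
proof (rule borel_measurable_continuous_onI)
  show "continuous_on UNIV (\<lambda>\<omega> :: 'a cadlag. cpath \<omega> t)"
    unfolding continuous_on_iff using dist_endpoint_le[OF assms] by (meson le_less_trans)
qed

section \<open>Probability measures and the narrow topology\<close>

abbreviation Prob :: "'e::topological_space measure set" where
  "Prob \<equiv> space (prob_algebra borel)"

definition narrow :: "'e::topological_space measure topology" where
  "narrow = topology_generated_by
     {{M \<in> Prob. (\<integral>x. apply_bcontfun f x \<partial>M) \<in> U} | (f :: 'e \<Rightarrow>\<^sub>C real) U. open U}"

definition limit_point_of_seq :: "'b topology \<Rightarrow> (nat \<Rightarrow> 'b) \<Rightarrow> 'b \<Rightarrow> bool" where
  "limit_point_of_seq T s l \<longleftrightarrow> l \<in> topspace T \<and>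
     (\<forall>U. openin T U \<and> l \<in> U \<longrightarrow> (\<exists>\<^sub>F n in sequentially. s n \<in> U))"

definition marginal :: "real \<Rightarrow> 'a::metric_space cadlag measure \<Rightarrow> 'a measure" where
  "marginal t P = distr P borel (\<lambda>\<omega>. cpath \<omega> t)"

text \<open>
  The integral of \<open>log (dP/dR)\<close> is the difference of the integrals of its positive and negative
  part; the latter is always finite for probability measures. The \<open>P\<close>-null set on which the
  density is zero or infinite does not contribute.
\<close>

definition rel_entropy :: "'e measure \<Rightarrow> 'e measure \<Rightarrow> ereal" where
  "rel_entropy P R =
    (if absolutely_continuous R P
     then enn2ereal (\<integral>\<^sup>+\<omega>. ennreal (ln (enn2real (RN_deriv R P \<omega>))) \<partial>P)
        - enn2ereal (\<integral>\<^sup>+\<omega>. ennreal (- ln (enn2real (RN_deriv R P \<omega>))) \<partial>P)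
     else \<infinity>)"

section \<open>Large deviations\<close>

definition lower_semicont :: "('e::topological_space \<Rightarrow> ennreal) \<Rightarrow> bool" where
  "lower_semicont f \<longleftrightarrow> (\<forall>a. closed {x. f x \<le> a})"

definition coercive :: "('e::topological_space \<Rightarrow> ennreal) \<Rightarrow> bool" where
  "coercive f \<longleftrightarrow> (\<forall>a::real. compact {x. enn2ereal (f x) \<le> ereal a})"

definition convex_indicator :: "'e set \<Rightarrow> 'e \<Rightarrow> ennreal" where
  "convex_indicator A x = (if x \<in> A then 0 else \<infinity>)"

definition log_prob :: "'e measure \<Rightarrow> 'e set \<Rightarrow> ereal" where
  "log_prob M A = (if measure M A = 0 then -\<infinity> else ereal (ln (measure M A)))"

text \<open>
  Sequences are indexed by \<open>k \<ge> 1\<close>; the term at \<open>0\<close> of a sequence of type \<open>nat \<Rightarrow> _\<close> is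
  irrelevant throughout.
\<close>

definition LDP :: "(nat \<Rightarrow> 'e::topological_space measure) \<Rightarrow> ('e \<Rightarrow> ennreal) \<Rightarrow> bool" where
  "LDP \<gamma> I \<longleftrightarrow> (\<forall>k\<ge>1. \<gamma> k \<in> Prob) \<and> lower_semicont I \<and>
     (\<forall>A\<in>sets borel.
        - (INF x\<in>interior A. enn2ereal (I x)) \<le> liminf (\<lambda>k. ereal (1 / real k) * log_prob (\<gamma> k) A) \<and>
        liminf (\<lambda>k. ereal (1 / real k) * log_prob (\<gamma> k) A)
          \<le> limsup (\<lambda>k. ereal (1 / real k) * log_prob (\<gamma> k) A) \<and>
        limsup (\<lambda>k. ereal (1 / real k) * log_prob (\<gamma> k) A) \<le> - (INF x\<in>closure A. enn2ereal (I x)))"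

section \<open>The Schroedinger and Monge-Kantorovich problems\<close>

definition couplings_dyn :: "'a::metric_space measure \<Rightarrow> 'a measure \<Rightarrow> 'a cadlag measure set" where
  "couplings_dyn \<mu> \<nu> = {P \<in> Prob. marginal 0 P = \<mu> \<and> marginal 1 P = \<nu>}"

definition S_cost :: "(nat \<Rightarrow> 'a::metric_space \<Rightarrow> 'a cadlag measure) \<Rightarrow> 'a measure \<Rightarrow> nat
    \<Rightarrow> 'a cadlag measure \<Rightarrow> ereal" where
  "S_cost R \<mu> k P = ereal (1 / real k) * rel_entropy P (\<mu> \<bind> R k)"

definition S_inf :: "(nat \<Rightarrow> 'a::metric_space \<Rightarrow> 'a cadlag measure) \<Rightarrow> 'a measure \<Rightarrow> nat
    \<Rightarrow> 'a measure \<Rightarrow> ereal" where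
  "S_inf R \<mu> k \<nu> = (INF P\<in>couplings_dyn \<mu> \<nu>. S_cost R \<mu> k P)"

definition S_solution :: "(nat \<Rightarrow> 'a::metric_space \<Rightarrow> 'a cadlag measure) \<Rightarrow> 'a measure \<Rightarrow> nat
    \<Rightarrow> 'a measure \<Rightarrow> 'a cadlag measure \<Rightarrow> bool" where
  "S_solution R \<mu> k \<nu> P \<longleftrightarrow> is_arg_min (S_cost R \<mu> k) (\<lambda>Q. Q \<in> couplings_dyn \<mu> \<nu>) P"

definition MK_cost :: "('a::metric_space cadlag \<Rightarrow> ennreal) \<Rightarrow> 'a cadlag measure \<Rightarrow> ennreal" where
  "MK_cost C P = (\<integral>\<^sup>+\<omega>. C \<omega> \<partial>P)"

definition MK_inf :: "('a::metric_space cadlag \<Rightarrow> ennreal) \<Rightarrow> 'a measure \<Rightarrow> 'a measure \<Rightarrow> ennreal" where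
  "MK_inf C \<mu> \<nu> = (INF P\<in>couplings_dyn \<mu> \<nu>. MK_cost C P)"

definition MK_solution :: "('a::metric_space cadlag \<Rightarrow> ennreal) \<Rightarrow> 'a measure \<Rightarrow> 'a measure
    \<Rightarrow> 'a cadlag measure \<Rightarrow> bool" where
  "MK_solution C \<mu> \<nu> P \<longleftrightarrow> is_arg_min (MK_cost C) (\<lambda>Q. Q \<in> couplings_dyn \<mu> \<nu>) P"

definition recovery_seq :: "(nat \<Rightarrow> 'a::metric_space \<Rightarrow> 'a cadlag measure) \<Rightarrow> ('a cadlag \<Rightarrow> ennreal)
    \<Rightarrow> 'a measure \<Rightarrow> 'a measure \<Rightarrow> (nat \<Rightarrow> 'a measure) \<Rightarrow> bool" where
  "recovery_seq R C \<mu>\<^sub>0 \<mu>\<^sub>1 \<nu> \<longleftrightarrow> (\<forall>k\<ge>1. \<nu> k \<in> Prob) \<and>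
     limitin narrow \<nu> \<mu>\<^sub>1 sequentially \<and>
     (\<lambda>k. S_inf R \<mu>\<^sub>0 k (\<nu> k)) \<longlonglongrightarrow> enn2ereal (MK_inf C \<mu>\<^sub>0 \<mu>\<^sub>1)"

end

theory Submission
  imports Defs
begin

text \<open>
  The lower bound comes from the Donsker--Varadhan inequality: with
  \<open>\<Lambda>\<^sub>k f x = (1/k) log \<integral> exp (k f) dR\<^sup>k\<^sup>,\<^sup>x\<close>, every \<open>P\<close> with \<open>P\<^sub>0 = \<mu>\<^sub>0\<close> satisfies
  \<open>\<integral> f dP \<le> (1/k) H(P|R\<^sup>k) + \<integral> \<Lambda>\<^sub>k f d\<mu>\<^sub>0\<close>, where \<open>limsup \<Lambda>\<^sub>k f x \<le> sup (f - C\<^sup>x)\<close> by the large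
  deviation upper bound. Applied to continuous \<open>f \<le> C\<close> this bounds \<open>\<integral> C dP\<close> at cluster points.
  Applied to multiples of functions decreasing to \<open>0\<close>, together with coercivity of \<open>C\<^sup>x\<close>, it shows
  that any limit functional of measures with bounded cost is continuous in the sense of Daniell,
  hence given by a measure. This replaces Prokhorov's theorem.

  For the upper bound, a nearly optimal \<open>P\<close> is approximated by the mixture over \<open>P(d\<omega>)\<close> of
  \<open>R\<^sup>k\<close> started at \<open>\<omega>\<^sub>0\<close> and conditioned to end near \<open>\<omega>\<^sub>1\<close>; the large deviation lower bound
  controls its entropy, and the conditioning is dropped where the bound is not yet effective.
\<close>

section \<open>Narrow convergence\<close>

text \<open>Two obstacles shape the argument. The end marginal cannot be kept exact: the large
  deviation lower bound speaks about open sets only, and the paths ending exactly at a given point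
  form a closed set that may have empty interior. The conditioned mixture therefore reaches
  \<open>\<mu>\<^sub>1\<close> up to a tolerance that shrinks as k grows, which is why a sequence of
  end marginals occurs. The initial marginal stays exact because each kernel starts at the
  prescribed point. The large deviation bounds and coercivity hold for each x separately, without
  uniformity in x, so no compact set is at hand that carries most of the mass of all measures. The
  bounds are integrated over \<open>\<mu>\<^sub>0\<close> by dominated convergence, and compactness
  is sought in the product space of all integrals, where limits are cluster points along filters.
  The same scheme, with measures of sets instead of integrals of continuous functions, yields the
  solutions of the Schroedinger problems: an entropy bound against a fixed reference measure makes
  setwise limits countably additive, and strict convexity gives uniqueness.\<close>

lemma cluster_of_bounded_family:
  fixes a :: "'k \<Rightarrow> 'i \<Rightarrow> real"
  assumes "F \<noteq> bot" "\<forall>\<^sub>F k in F. \<forall>i. \<bar>a k i\<bar> \<le> b i"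
  shows "\<exists>L. \<forall>I e. finite I \<longrightarrow> e > 0 \<longrightarrow> (\<exists>\<^sub>F k in F. \<forall>i\<in>I. \<bar>a k i - L i\<bar> < e)"
proof -
  \<comment> \<open>Tychonoff: the vectors of values stay in a product of intervals, so their image
    filter clusters at some \<open>L\<close>. Neighbourhoods in the product constrain finitely many
    coordinates, hence the finite \<open>I\<close>; the index set may be uncountable, so
    \<open>frequently\<close> stands in for a subsequence.\<close>
  let ?K = "PiE UNIV (\<lambda>i. {- b i..b i})"
  have "compactin (product_topology (\<lambda>i::'i. euclideanreal) UNIV) ?K"
    by (subst compactin_PiE) auto
  then have "compact ?K"
    by (simp add: euclidean_product_topology)
  moreover have "filtermap a F \<noteq> bot" using assms(1) by (simp add: filtermap_bot_iff)
  moreover have "eventually (\<lambda>x. x \<in> ?K) (filtermap a F)"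
    unfolding eventually_filtermap using assms(2)
    by (rule eventually_mono) (auto simp: abs_le_iff minus_le_iff)
  ultimately obtain L where L: "inf (nhds L) (filtermap a F) \<noteq> bot"
    unfolding compact_filter by blast
  show ?thesis
  proof (intro exI[of _ L] allI impI)
    fix I :: "'i set" and e :: real
    assume I: "finite I" and e: "e > 0"
    have "open {x :: 'i \<Rightarrow> real. \<bar>x i - L i\<bar> < e}" for i
      by (intro open_Collect_less continuous_intros continuous_on_product_coordinates)
    then have "open (\<Inter>i\<in>I. {x. \<bar>x i - L i\<bar> < e})" using I by (intro open_INT) auto
    then have "eventually (\<lambda>x. x \<in> (\<Inter>i\<in>I. {x. \<bar>x i - L i\<bar> < e})) (nhds L)"
      by (rule eventually_nhds_in_open) (use e in simp)
    then have ev: "eventually (\<lambda>x. \<forall>i\<in>I. \<bar>x i - L i\<bar> < e) (nhds L)"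
      by (rule eventually_mono) simp
    show "\<exists>\<^sub>F k in F. \<forall>i\<in>I. \<bar>a k i - L i\<bar> < e"
    proof (rule ccontr)
      assume "\<not> ?thesis"
      then have "eventually (\<lambda>x. \<not> (\<forall>i\<in>I. \<bar>x i - L i\<bar> < e)) (filtermap a F)"
        by (simp add: not_frequently eventually_filtermap)
      then have "eventually (\<lambda>_. False) (inf (nhds L) (filtermap a F))"
        unfolding eventually_inf using ev by blast
      then show False using L by (simp add: eventually_False)
    qed
  qed
qed

section \<open>Borel probability measures and bounded continuous functions\<close>

lemma ProbD:
  assumes "P \<in> Prob"
  shows "prob_space P" "sets P = sets borel" "space P = UNIV"
  using assms sets_eq_imp_space_eq[of P borel] by (auto simp: space_prob_algebra)

lemma measurable_Prob: "P \<in> Prob \<Longrightarrow> measurable P M = measurable borel M"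
  using ProbD by (intro measurable_cong_sets) auto

lemma ProbI: "prob_space P \<Longrightarrow> sets P = sets borel \<Longrightarrow> P \<in> Prob"
  by (simp add: space_prob_algebra)

lemma integrable_bounded_Prob:
  fixes f :: "'e::topological_space \<Rightarrow> real"
  assumes "P \<in> Prob" "f \<in> borel_measurable borel" "\<And>x. \<bar>f x\<bar> \<le> B"
  shows "integrable P f"
proof -
  interpret prob_space P using ProbD[OF assms(1)] by simp
  show ?thesis using assms by (intro integrable_const_bound[of _ B]) (auto simp: measurable_Prob)
qed

lemma integral_bounds_Prob:
  fixes f :: "'e::topological_space \<Rightarrow> real"
  assumes "P \<in> Prob" "f \<in> borel_measurable borel" "\<And>x. a \<le> f x" "\<And>x. f x \<le> b"
  shows "a \<le> (\<integral>x. f x \<partial>P)" "(\<integral>x. f x \<partial>P) \<le> b"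
proof -
  interpret prob_space P using ProbD[OF assms(1)] by simp
  have "\<bar>f x\<bar> \<le> \<bar>a\<bar> + \<bar>b\<bar>" for x using assms(3)[of x] assms(4)[of x] by linarith
  then have i: "integrable P f" using integrable_bounded_Prob assms by blast
  show "a \<le> (\<integral>x. f x \<partial>P)" "(\<integral>x. f x \<partial>P) \<le> b"
    using integral_ge_const[OF i] integral_le_const[OF i] assms by auto
qed

lemma bcontfun_bound:
  assumes "f \<in> bcontfun"
  obtains B where "B > 0" "\<And>x. \<bar>f x :: real\<bar> \<le> B"
  using assms unfolding bcontfun_def bounded_pos by auto

lemma bcontfunI: "continuous_on UNIV f \<Longrightarrow> (\<And>x. \<bar>f x :: real\<bar> \<le> B) \<Longrightarrow> f \<in> bcontfun"
  unfolding bcontfun_def bounded_iff by auto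

lemma bcontfun_add:
  fixes f g :: "'e::topological_space \<Rightarrow> real" assumes "f \<in> bcontfun" "g \<in> bcontfun" shows "(\<lambda>x. f x + g x) \<in> bcontfun"
  using assms by (auto simp: bcontfun_def intro: continuous_intros bounded_plus_comp)

lemma bcontfun_scale:
  fixes f :: "'e::topological_space \<Rightarrow> real" assumes "f \<in> bcontfun" shows "(\<lambda>x. c * f x) \<in> bcontfun"
proof -
  have "bounded ((\<lambda>y. c * y) ` range f)"
    using assms by (intro bounded_linear_image bounded_linear_mult_right) (simp add: bcontfun_def)
  then show ?thesis using assms by (auto simp: bcontfun_def image_image intro: continuous_intros)
qed

lemma bcontfun_diff:
  fixes f g :: "'e::topological_space \<Rightarrow> real" assumes "f \<in> bcontfun" "g \<in> bcontfun" shows "(\<lambda>x. f x - g x) \<in> bcontfun"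
  using bcontfun_add[OF assms(1) bcontfun_scale[OF assms(2), of "-1"]] by simp

lemma bcontfun_min:
  fixes f g :: "'e::topological_space \<Rightarrow> real" assumes "f \<in> bcontfun" "g \<in> bcontfun" shows "(\<lambda>x. min (f x) (g x)) \<in> bcontfun"
proof -
  obtain A B where "\<And>x. \<bar>f x\<bar> \<le> A" "\<And>x. \<bar>g x\<bar> \<le> B"
    using bcontfun_bound assms by metis
  then have "\<bar>min (f x) (g x)\<bar> \<le> max A B" for x
    by (metis max.coboundedI1 max.coboundedI2 min_def)
  then show ?thesis using assms by (intro bcontfunI) (auto simp: bcontfun_def intro: continuous_intros)
qed

lemma bcontfun_sum:
  fixes f :: "'i \<Rightarrow> 'e::topological_space \<Rightarrow> real" assumes "\<And>i. f i \<in> bcontfun" shows "(\<lambda>x. \<Sum>i\<in>I. f i x) \<in> bcontfun"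
  by (induction I rule: infinite_finite_induct) (simp_all add: const_bcontfun bcontfun_add assms)

lemma bcontfun_measurable: "f \<in> bcontfun \<Longrightarrow> f \<in> borel_measurable borel"
  by (auto simp: bcontfun_def intro: borel_measurable_continuous_onI)

lemma bcontfun_integrable:
  fixes f :: "'e::topological_space \<Rightarrow> real"
  assumes "P \<in> Prob" "f \<in> bcontfun"
  shows "integrable P f"
proof -
  obtain B where "\<And>x. \<bar>f x\<bar> \<le> B" using bcontfun_bound[OF assms(2)] by metis
  then show ?thesis by (rule integrable_bounded_Prob[OF assms(1) bcontfun_measurable[OF assms(2)]])
qed

lemma integral_bcontfun_abs_le:
  fixes f :: "'e::topological_space \<Rightarrow> real"
  assumes "P \<in> Prob" "f \<in> bcontfun" "\<And>x. \<bar>f x\<bar> \<le> B"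
  shows "\<bar>\<integral>x. f x \<partial>P\<bar> \<le> B"
proof -
  have "- B \<le> f x" "f x \<le> B" for x using assms(3)[of x] by linarith+
  from integral_bounds_Prob[OF assms(1) bcontfun_measurable[OF assms(2)] this] show ?thesis by linarith
qed

section \<open>The narrow topology through finitely many integrals\<close>

lemma topspace_narrow: "topspace (narrow :: 'e::topological_space measure topology) = Prob"
proof -
  have "Prob \<in> {{M \<in> Prob. (\<integral>x. apply_bcontfun f x \<partial>M) \<in> U} | (f :: 'e \<Rightarrow>\<^sub>C real) U. open U}"
    by (auto intro: exI[of _ UNIV])
  then show ?thesis unfolding narrow_def topology_generated_by_topspace by blast
qed

text \<open>The topology is given by a subbase only. Induction over its generation yields basic
  neighbourhoods, a finite intersection costing a union of test sets and a minimum of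
  tolerances.\<close>

lemma narrow_nbhd:
  fixes P :: "'e::topological_space measure"
  assumes "openin narrow U" "P \<in> U"
  shows "\<exists>I e. finite I \<and> I \<subseteq> bcontfun \<and> e > (0::real) \<and>
    (\<forall>Q\<in>Prob. (\<forall>f\<in>I. \<bar>(\<integral>x. f x \<partial>Q) - (\<integral>x. f x \<partial>P)\<bar> < e) \<longrightarrow> Q \<in> U)"
proof -
  have "generate_topology_on {{M \<in> Prob. (\<integral>x. apply_bcontfun f x \<partial>M) \<in> U} | (f :: 'e \<Rightarrow>\<^sub>C real) U. open U} U"
    using assms(1) unfolding narrow_def by (rule openin_topology_generated_by)
  then show ?thesis using assms(2)
  proof induction
    case (Int a b)
    then obtain I e J d where "finite I" "I \<subseteq> bcontfun" "e > (0::real)"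
      "\<forall>Q\<in>Prob. (\<forall>f\<in>I. \<bar>(\<integral>x. f x \<partial>Q) - (\<integral>x. f x \<partial>P)\<bar> < e) \<longrightarrow> Q \<in> a"
      "finite J" "J \<subseteq> bcontfun" "d > (0::real)"
      "\<forall>Q\<in>Prob. (\<forall>f\<in>J. \<bar>(\<integral>x. f x \<partial>Q) - (\<integral>x. f x \<partial>P)\<bar> < d) \<longrightarrow> Q \<in> b"
      by blast
    then show ?case by (intro exI[of _ "I \<union> J"] exI[of _ "min e d"]) auto
  next
    case (UN K)
    then show ?case by (meson Union_iff)
  next
    case (Basis s)
    then obtain f :: "'e \<Rightarrow>\<^sub>C real" and V where s: "s = {M \<in> Prob. (\<integral>x. apply_bcontfun f x \<partial>M) \<in> V}" "open V"
      by blast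
    then obtain e where "e > 0" "\<And>y. dist y (\<integral>x. apply_bcontfun f x \<partial>P) < e \<Longrightarrow> y \<in> V"
      using Basis unfolding open_dist by blast
    then show ?case unfolding s
      by (intro exI[of _ "{apply_bcontfun f}"] exI[of _ e]) (auto simp: dist_real_def apply_bcontfun)
  qed simp
qed

lemma openin_narrow_integral:
  fixes f :: "'e::topological_space \<Rightarrow> real"
  assumes "f \<in> bcontfun"
  shows "openin narrow {M \<in> Prob. \<bar>(\<integral>x. f x \<partial>M) - c\<bar> < e}"
proof -
  obtain g where g: "f = apply_bcontfun g" using assms by (rule bcontfunE)
  have "{M \<in> Prob. \<bar>(\<integral>x. f x \<partial>M) - c\<bar> < e} = {M \<in> Prob. (\<integral>x. apply_bcontfun g x \<partial>M) \<in> ball c e}"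
    by (auto simp: g dist_real_def)
  then show ?thesis unfolding narrow_def
    by (simp only:, intro topology_generated_by_Basis) (use open_ball in blast)
qed

text \<open>Membership in \<open>Prob\<close> is required eventually rather than always, since the
  term at index 0 of the sequences considered is unconstrained.\<close>

lemma limitin_narrow_iff:
  fixes P :: "nat \<Rightarrow> 'e::topological_space measure"
  assumes "\<forall>\<^sub>F k in sequentially. P k \<in> Prob" "Q \<in> Prob"
  shows "limitin narrow P Q sequentially \<longleftrightarrow>
    (\<forall>f::'e \<Rightarrow> real. f \<in> bcontfun \<longrightarrow> (\<lambda>k. \<integral>x. f x \<partial>P k) \<longlonglongrightarrow> (\<integral>x. f x \<partial>Q))"
proof safe
  fix f :: "'e \<Rightarrow> real" assume lim: "limitin narrow P Q sequentially" and f: "f \<in> bcontfun"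
  show "(\<lambda>k. \<integral>x. f x \<partial>P k) \<longlonglongrightarrow> (\<integral>x. f x \<partial>Q)"
  proof (rule tendstoI)
    fix e :: real assume "e > 0"
    then have "Q \<in> {M \<in> Prob. \<bar>(\<integral>x. f x \<partial>M) - (\<integral>x. f x \<partial>Q)\<bar> < e}" using assms(2) by simp
    then have "\<forall>\<^sub>F k in sequentially. P k \<in> {M \<in> Prob. \<bar>(\<integral>x. f x \<partial>M) - (\<integral>x. f x \<partial>Q)\<bar> < e}"
      using lim openin_narrow_integral[OF f, of "\<integral>x. f x \<partial>Q" e] unfolding limitin_def by blast
    then show "\<forall>\<^sub>F k in sequentially. dist (\<integral>x. f x \<partial>P k) (\<integral>x. f x \<partial>Q) < e"
      by (rule eventually_mono) (simp add: dist_real_def)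
  qed
next
  assume lim: "\<forall>f::'e \<Rightarrow> real. f \<in> bcontfun \<longrightarrow> (\<lambda>k. \<integral>x. f x \<partial>P k) \<longlonglongrightarrow> (\<integral>x. f x \<partial>Q)"
  show "limitin narrow P Q sequentially"
    unfolding limitin_def topspace_narrow
  proof (intro conjI allI impI assms(2))
    fix U :: "'e measure set" assume "openin narrow U \<and> Q \<in> U"
    then have "openin narrow U" "Q \<in> U" by simp_all
    from narrow_nbhd[OF this] obtain I and e :: real where I: "finite I" "I \<subseteq> bcontfun" "e > 0"
      "\<forall>M\<in>Prob. (\<forall>f\<in>I. \<bar>(\<integral>x. f x \<partial>M) - (\<integral>x. f x \<partial>Q)\<bar> < e) \<longrightarrow> M \<in> U"
      by (elim exE conjE) (rule that)
    have "\<forall>\<^sub>F k in sequentially. \<bar>(\<integral>x. f x \<partial>P k) - (\<integral>x. f x \<partial>Q)\<bar> < e" if "f \<in> I" for f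
    proof -
      have "(\<lambda>k. \<integral>x. f x \<partial>P k) \<longlonglongrightarrow> (\<integral>x. f x \<partial>Q)" using lim I(2) that by blast
      from tendstoD[OF this I(3)] show ?thesis by (simp add: dist_real_def)
    qed
    then have "\<forall>\<^sub>F k in sequentially. \<forall>f\<in>I. \<bar>(\<integral>x. f x \<partial>P k) - (\<integral>x. f x \<partial>Q)\<bar> < e"
      using I(1) by (simp add: eventually_ball_finite)
    with assms(1) show "\<forall>\<^sub>F k in sequentially. P k \<in> U"
      by eventually_elim (use I(4) in simp)
  qed
qed

section \<open>Lipschitz approximation from below\<close>

text \<open>The Moreau--Yosida regularisation: the largest \<open>m\<close>-Lipschitz minorant of \<open>min m f\<close>.\<close>

definition lip_minorant :: "('e::metric_space \<Rightarrow> ennreal) \<Rightarrow> nat \<Rightarrow> 'e \<Rightarrow> real" where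
  "lip_minorant f m x = (INF y. enn2real (min (of_nat m) (f y)) + real m * dist x y)"

context
  fixes f :: "'e::metric_space \<Rightarrow> ennreal"
begin

private abbreviation "trunc (m::nat) y \<equiv> enn2real (min (of_nat m) (f y))"

text \<open>Because of the cut-off at \<open>m\<close> the conversion by \<open>enn2real\<close> is
  faithful; applied directly to the value \<infinity> it would return 0.\<close>

private lemma trunc_bounds: "0 \<le> trunc m y" "trunc m y \<le> real m" "ennreal (trunc m y) = min (of_nat m) (f y)"
proof -
  have fin: "min (of_nat m) (f y) < \<infinity>" by (simp add: min_less_iff_disj of_nat_less_top)
  then show *: "ennreal (trunc m y) = min (of_nat m) (f y)" by simp
  show "0 \<le> trunc m y" by simp
  have "ennreal (trunc m y) \<le> ennreal (real m)" unfolding * by (simp add: ennreal_of_nat_eq_real_of_nat)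
  then show "trunc m y \<le> real m" by simp
qed

private lemma bdd: "bdd_below (range (\<lambda>y. trunc m y + real m * dist x y))"
  by (rule bdd_belowI[of _ 0]) auto

lemma lip_minorant_bounds:
  "0 \<le> lip_minorant f m x" "lip_minorant f m x \<le> real m" "ennreal (lip_minorant f m x) \<le> f x"
proof -
  show "0 \<le> lip_minorant f m x" unfolding lip_minorant_def
    by (rule cINF_greatest) auto
  have *: "lip_minorant f m x \<le> trunc m x"
    unfolding lip_minorant_def by (rule cINF_lower2[OF bdd, of x]) auto
  then show "lip_minorant f m x \<le> real m" using trunc_bounds(2)[of m x] by simp
  have "ennreal (lip_minorant f m x) \<le> ennreal (trunc m x)" using * by (rule ennreal_leI)
  then show "ennreal (lip_minorant f m x) \<le> f x" unfolding trunc_bounds by simp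
qed

lemma lip_minorant_lipschitz: "\<bar>lip_minorant f m x - lip_minorant f m y\<bar> \<le> real m * dist x y"
proof -
  have "lip_minorant f m x - real m * dist x y \<le> lip_minorant f m y" for x y
    unfolding lip_minorant_def[of f m y]
  proof (rule cINF_greatest)
    fix z
    have "lip_minorant f m x \<le> trunc m z + real m * dist x z"
      unfolding lip_minorant_def by (rule cINF_lower[OF bdd]) auto
    also have "real m * dist x z \<le> real m * dist x y + real m * dist y z"
      using dist_triangle[of x z y] by (metis distrib_left mult_left_mono of_nat_0_le_iff)
    finally show "lip_minorant f m x - real m * dist x y \<le> trunc m z + real m * dist y z" by simp
  qed auto
  from this[of x y] this[of y x] show ?thesis by (simp add: abs_le_iff dist_commute)
qed

lemma lip_minorant_mono:
  assumes "m \<le> n"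
  shows "lip_minorant f m x \<le> lip_minorant f n x"
  unfolding lip_minorant_def
proof (rule cINF_mono)
  fix y
  have "ennreal (trunc m y) \<le> ennreal (trunc n y)"
    unfolding trunc_bounds using assms by (intro min.mono) auto
  then have "trunc m y \<le> trunc n y" by simp
  moreover have "real m * dist x y \<le> real n * dist x y"
    using assms by (intro mult_right_mono) auto
  ultimately show "\<exists>z\<in>UNIV. trunc m z + real m * dist x z \<le> trunc n y + real n * dist x y"
    by (intro bexI[of _ y]) auto
qed (use bdd in auto)

lemma lip_minorant_bcontfun: "lip_minorant f m \<in> bcontfun"
proof (rule bcontfunI[of _ "real m"])
  show "continuous_on UNIV (lip_minorant f m)"
  proof (rule lipschitz_on_continuous_on[of "real m"], rule lipschitz_onI)
    show "dist (lip_minorant f m x) (lip_minorant f m y) \<le> real m * dist x y" for x y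
      using lip_minorant_lipschitz by (simp add: dist_real_def)
  qed simp
qed (simp add: lip_minorant_bounds)

lemma lip_minorant_SUP:
  assumes lsc: "lower_semicont f"
  shows "(SUP m. ennreal (lip_minorant f m x)) = f x"
proof (rule antisym)
  show "(SUP m. ennreal (lip_minorant f m x)) \<le> f x"
    using lip_minorant_bounds by (intro SUP_least)
  show "f x \<le> (SUP m. ennreal (lip_minorant f m x))"
  proof (rule dense_le)
    fix a assume a: "a < f x"
    then have "a < \<infinity>" using less_le_trans top_greatest by (metis infinity_ennreal_def)
    then obtain a' where a': "a = ennreal a'" "a' \<ge> 0" by (cases a) auto
    have "open (- {y. f y \<le> a})" using lsc by (simp add: lower_semicont_def open_Compl)
    moreover have "x \<in> - {y. f y \<le> a}" using a by auto
    ultimately obtain r where r: "r > 0" "\<And>y. dist y x < r \<Longrightarrow> \<not> f y \<le> a"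
      unfolding open_dist by blast
    \<comment> \<open>Within distance \<open>r\<close> of \<open>x\<close> the function exceeds
      \<open>a\<close>, so a cut-off at \<open>m \<ge> a'\<close> suffices; beyond that distance the
      penalty \<open>m * dist x y\<close> alone reaches \<open>a'\<close>.\<close>
    obtain m :: nat where m: "a' \<le> real m" "a' / r \<le> real m"
      by (metis max.bounded_iff real_arch_simple)
    have "a' \<le> lip_minorant f m x" unfolding lip_minorant_def
    proof (rule cINF_greatest)
      fix y
      show "a' \<le> trunc m y + real m * dist x y"
      proof (cases "dist y x < r")
        case True
        then have "ennreal a' \<le> ennreal (trunc m y)"
          unfolding trunc_bounds using r(2)[of y] m(1)
          by (auto simp: a'(1)[symmetric] dist_commute ennreal_of_nat_eq_real_of_nat)
             (simp add: a'(1) ennreal_leI)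
        then have "a' \<le> trunc m y" using trunc_bounds(1)[of m y] by (simp add: ennreal_le_iff)
        then show ?thesis by (simp add: add_increasing2)
      next
        case False
        have "a' \<le> real m * r" using m(2) r(1) by (simp add: field_simps)
        also have "\<dots> \<le> real m * dist x y" using False by (intro mult_left_mono) (auto simp: dist_commute)
        finally show ?thesis using trunc_bounds(1)[where m = m and y = y] by linarith
      qed
    qed auto
    then show "a \<le> (SUP m. ennreal (lip_minorant f m x))"
      unfolding a' by (intro SUP_upper2[of m] ennreal_leI) auto
  qed
qed

end

section \<open>Test functions that determine measures and narrow limits\<close>

lemma lower_semicont_indicator:
  assumes "open G"
  shows "lower_semicont (indicator G :: 'e::topological_space \<Rightarrow> ennreal)"
proof -
  have "{x. indicator G x \<le> (a::ennreal)} = (if a \<ge> 1 then UNIV else - G)" for a :: ennreal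
    by (auto simp: indicator_def)
  then show ?thesis using assms by (auto simp: lower_semicont_def)
qed

lemma lip_minorant_indicator_le: "lip_minorant (indicator G) m x \<le> indicator G x"
  using lip_minorant_bounds(3)[of "indicator G" m x] lip_minorant_bounds(1)[of "indicator G" m x]
  by (cases "x \<in> G") (simp_all add: ennreal_eq_0_iff)

lemma lower_semicont_measurable:
  assumes "lower_semicont (f :: 'e::topological_space \<Rightarrow> ennreal)"
  shows "f \<in> borel_measurable borel"
proof (rule borel_measurableI_le)
  show "{x \<in> space borel. f x \<le> y} \<in> sets borel" for y
    using assms by (auto simp: lower_semicont_def)
qed

text \<open>Monotone convergence along the minorants. Bounding the integral of a lower
  semicontinuous function thus needs test functions from \<open>bcontfun\<close> only, the ones that
  narrow limits control.\<close>

lemma nn_integral_le_via_lip_minorants: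
  fixes f :: "'e::metric_space \<Rightarrow> ennreal"
  assumes lsc: "lower_semicont f" and P: "P \<in> Prob"
    and le: "\<And>m. (\<integral>x. lip_minorant f m x \<partial>P) \<le> a"
  shows "(\<integral>\<^sup>+x. f x \<partial>P) \<le> ennreal a"
proof -
  have "(\<integral>\<^sup>+x. f x \<partial>P) = (\<integral>\<^sup>+x. (SUP m. ennreal (lip_minorant f m x)) \<partial>P)"
    by (simp add: lip_minorant_SUP[OF lsc])
  also have "\<dots> = (SUP m. \<integral>\<^sup>+x. ennreal (lip_minorant f m x) \<partial>P)"
    by (rule nn_integral_monotone_convergence_SUP)
       (auto simp: incseq_def le_fun_def measurable_Prob[OF P] intro!: ennreal_leI lip_minorant_mono
         bcontfun_measurable lip_minorant_bcontfun measurable_compose[OF _ measurable_ennreal])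
  also have "\<dots> \<le> ennreal a"
  proof (rule SUP_least)
    fix m
    have "(\<integral>\<^sup>+x. ennreal (lip_minorant f m x) \<partial>P) = ennreal (\<integral>x. lip_minorant f m x \<partial>P)"
      by (intro nn_integral_eq_integral bcontfun_integrable[OF P] lip_minorant_bcontfun)
         (simp add: lip_minorant_bounds)
    then show "(\<integral>\<^sup>+x. ennreal (lip_minorant f m x) \<partial>P) \<le> ennreal a" using le by (simp add: ennreal_leI)
  qed
  finally show ?thesis .
qed

text \<open>Open sets form a generating system closed under intersection, and their indicators are
  increasing limits of Lipschitz functions. The inequality on open sets is proved one way and used
  twice.\<close>

lemma Prob_eqI_bcontfun:
  fixes P Q :: "'e::metric_space measure"
  assumes P: "P \<in> Prob" and Q: "Q \<in> Prob"
    and eq: "\<And>f :: 'e \<Rightarrow> real. f \<in> bcontfun \<Longrightarrow> (\<integral>x. f x \<partial>P) = (\<integral>x. f x \<partial>Q)"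
  shows "P = Q"
proof (rule measure_eqI_generator_eq[where E = "{G. open G}" and \<Omega> = UNIV and A = "\<lambda>_. UNIV"])
  show "sets P = sigma_sets UNIV {G. open G}" "sets Q = sigma_sets UNIV {G. open G}"
    using ProbD(2)[OF P] ProbD(2)[OF Q] by (simp_all add: borel_def)
  have le: "emeasure P G \<le> emeasure Q G" if P: "P \<in> Prob" and Q: "Q \<in> Prob" and G: "open G"
    and eq: "\<And>f :: 'e \<Rightarrow> real. f \<in> bcontfun \<Longrightarrow> (\<integral>x. f x \<partial>P) = (\<integral>x. f x \<partial>Q)" for P Q :: "'e measure" and G
  proof -
    interpret Q: prob_space Q using ProbD[OF Q] by simp
    have sets: "G \<in> sets P" "G \<in> sets Q" using G ProbD(2)[OF P] ProbD(2)[OF Q] by auto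
    have "(\<integral>x. lip_minorant (indicator G) m x \<partial>P) \<le> Q.prob G" for m
    proof -
      have "(\<integral>x. lip_minorant (indicator G) m x \<partial>P) = (\<integral>x. lip_minorant (indicator G) m x \<partial>Q)"
        by (intro eq lip_minorant_bcontfun)
      also have "\<dots> \<le> (\<integral>x. indicator G x \<partial>Q)"
      proof (rule integral_mono)
        show "integrable Q (lip_minorant (indicator G) m)"
          by (intro bcontfun_integrable Q lip_minorant_bcontfun)
        show "lip_minorant (indicator G) m x \<le> indicator G x" for x
          by (rule lip_minorant_indicator_le)
      qed (use sets in \<open>auto intro!: integrable_real_indicator simp: Q.emeasure_eq_measure\<close>)
      finally show ?thesis using sets by simp
    qed
    then have "(\<integral>\<^sup>+x. indicator G x \<partial>P) \<le> ennreal (Q.prob G)"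
      by (rule nn_integral_le_via_lip_minorants[OF lower_semicont_indicator[OF G] P])
    then show ?thesis using sets by (simp add: Q.emeasure_eq_measure)
  qed
  show "emeasure P X = emeasure Q X" if "X \<in> {G. open G}" for X
    using le[OF P Q _ eq, of X] le[OF Q P _ eq[symmetric], of X] that by (intro antisym) simp_all
  show "emeasure P UNIV \<noteq> \<infinity>" for i
    using prob_space.emeasure_space_1[OF ProbD(1)[OF P]] ProbD(3)[OF P] by simp
qed (auto simp: Int_stable_def)

text \<open>Lower bounds suffice, because each test function also occurs with the opposite sign;
  Lipschitz functions suffice, because they increase to any non-negative continuous one. The
  mixtures of the recovery construction supply bounds of exactly this one-sided kind.\<close>

lemma limitin_narrowI_lipschitz:
  fixes \<nu> :: "nat \<Rightarrow> 'e::metric_space measure" and \<mu> :: "'e measure"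
  assumes \<nu>: "\<forall>\<^sub>F k in sequentially. \<nu> k \<in> Prob" and \<mu>: "\<mu> \<in> Prob"
    and low: "\<And>(h :: 'e \<Rightarrow> real) m e. (\<And>x. 0 \<le> h x) \<Longrightarrow> (\<And>x. h x \<le> real m) \<Longrightarrow>
        (\<And>x y. \<bar>h x - h y\<bar> \<le> real m * dist x y) \<Longrightarrow> h \<in> bcontfun \<Longrightarrow> e > 0 \<Longrightarrow>
        \<forall>\<^sub>F k in sequentially. (\<integral>x. h x \<partial>\<mu>) - e \<le> (\<integral>x. h x \<partial>\<nu> k)"
  shows "limitin narrow \<nu> \<mu> sequentially"
  unfolding limitin_narrow_iff[OF \<nu> \<mu>]
proof safe
  fix f :: "'e \<Rightarrow> real" assume f: "f \<in> bcontfun"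
  have pos: "\<forall>\<^sub>F k in sequentially. (\<integral>x. g x \<partial>\<mu>) - e \<le> (\<integral>x. g x \<partial>\<nu> k)"
    if g: "g \<in> bcontfun" "\<And>x. 0 \<le> g x" and e: "e > 0" for g :: "'e \<Rightarrow> real" and e
  proof -
    define f where "f x = ennreal (g x)" for x
    have "closed {x. g x \<le> a}" for a
      using g(1) by (intro closed_Collect_le) (auto simp: bcontfun_def)
    moreover have "{x. f x \<le> a} = (if a = \<infinity> then UNIV else {x. g x \<le> enn2real a})" for a
      using g(2) by (cases a) (auto simp: f_def)
    ultimately have lsc: "lower_semicont f" by (auto simp: lower_semicont_def)
    have le: "lip_minorant f m x \<le> g x" for m x
      using lip_minorant_bounds(3)[of f m x] g(2)[of x] by (simp add: f_def)
    have "\<exists>m. (\<integral>x. g x \<partial>\<mu>) - e / 2 < (\<integral>x. lip_minorant f m x \<partial>\<mu>)"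
    proof (rule ccontr)
      assume neg: "\<not> ?thesis"
      then have "(\<integral>\<^sup>+x. f x \<partial>\<mu>) \<le> ennreal ((\<integral>x. g x \<partial>\<mu>) - e / 2)"
        by (intro nn_integral_le_via_lip_minorants[OF lsc \<mu>]) (auto simp: not_less)
      moreover have "(\<integral>\<^sup>+x. f x \<partial>\<mu>) = ennreal (\<integral>x. g x \<partial>\<mu>)" unfolding f_def
        using g by (intro nn_integral_eq_integral bcontfun_integrable \<mu>) auto
      \<comment> \<open>The level \<open>m = 0\<close> shows that the right-hand side is
        non-negative, so \<open>ennreal\<close> does not cut it off and the two bounds can be
        compared as reals.\<close>
      moreover have "0 \<le> (\<integral>x. lip_minorant f 0 x \<partial>\<mu>)" by (simp add: lip_minorant_bounds)
      moreover have "(\<integral>x. lip_minorant f 0 x \<partial>\<mu>) \<le> (\<integral>x. g x \<partial>\<mu>) - e / 2"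
        using neg by (auto simp: not_less)
      ultimately show False using e by (simp add: ennreal_le_iff)
    qed
    then obtain m where m: "(\<integral>x. g x \<partial>\<mu>) - e / 2 < (\<integral>x. lip_minorant f m x \<partial>\<mu>)" ..
    have "\<forall>\<^sub>F k in sequentially. (\<integral>x. lip_minorant f m x \<partial>\<mu>) - e / 2 \<le> (\<integral>x. lip_minorant f m x \<partial>\<nu> k)"
      using lip_minorant_bounds lip_minorant_lipschitz lip_minorant_bcontfun e
      by (intro low[of _ m]) auto
    with \<nu> show ?thesis
    proof eventually_elim
      case (elim k)
      have "(\<integral>x. lip_minorant f m x \<partial>\<nu> k) \<le> (\<integral>x. g x \<partial>\<nu> k)"
        by (intro integral_mono bcontfun_integrable[OF elim(1)] lip_minorant_bcontfun g(1) le)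
      then show ?case using elim(2) m by simp
    qed
  qed
  \<comment> \<open>Shifting by \<open>B\<close> makes \<open>f\<close> and its negative
    non-negative, so the one-sided estimate \<open>pos\<close> controls the integral from both
    sides.\<close>
  obtain B where B: "B > 0" "\<And>x. \<bar>f x\<bar> \<le> B" using bcontfun_bound[OF f] by metis
  have cont: "continuous_on UNIV f" using f by (simp add: bcontfun_def)
  have pm: "(\<lambda>x. B + f x) \<in> bcontfun" "(\<lambda>x. B - f x) \<in> bcontfun"
  proof -
    have "\<bar>B + f x\<bar> \<le> 2 * B" "\<bar>B - f x\<bar> \<le> 2 * B" for x
      using B(2)[of x] by linarith+
    then show "(\<lambda>x. B + f x) \<in> bcontfun" "(\<lambda>x. B - f x) \<in> bcontfun"
      by (auto intro!: bcontfunI[of _ "2 * B"] continuous_intros cont)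
  qed
  have int: "(\<integral>x. B + f x \<partial>M) = B + (\<integral>x. f x \<partial>M)" "(\<integral>x. B - f x \<partial>M) = B - (\<integral>x. f x \<partial>M)"
    if "M \<in> Prob" for M
  proof -
    interpret prob_space M using ProbD[OF that] by simp
    show "(\<integral>x. B + f x \<partial>M) = B + (\<integral>x. f x \<partial>M)" "(\<integral>x. B - f x \<partial>M) = B - (\<integral>x. f x \<partial>M)"
      using bcontfun_integrable[OF that f] by (simp_all add: prob_space)
  qed
  show "(\<lambda>k. \<integral>x. f x \<partial>\<nu> k) \<longlonglongrightarrow> (\<integral>x. f x \<partial>\<mu>)"
  proof (rule tendstoI)
    fix e :: real assume e: "e > 0"
    have "\<forall>\<^sub>F k in sequentially. (\<integral>x. B + f x \<partial>\<mu>) - e / 2 \<le> (\<integral>x. B + f x \<partial>\<nu> k)"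
      "\<forall>\<^sub>F k in sequentially. (\<integral>x. B - f x \<partial>\<mu>) - e / 2 \<le> (\<integral>x. B - f x \<partial>\<nu> k)"
    proof -
      have "0 \<le> B + f x" "0 \<le> B - f x" for x using B(2)[of x] by linarith+
      then show "\<forall>\<^sub>F k in sequentially. (\<integral>x. B + f x \<partial>\<mu>) - e / 2 \<le> (\<integral>x. B + f x \<partial>\<nu> k)"
        "\<forall>\<^sub>F k in sequentially. (\<integral>x. B - f x \<partial>\<mu>) - e / 2 \<le> (\<integral>x. B - f x \<partial>\<nu> k)"
        using e by (auto intro!: pos pm)
    qed
    with \<nu> show "\<forall>\<^sub>F k in sequentially. dist (\<integral>x. f x \<partial>\<nu> k) (\<integral>x. f x \<partial>\<mu>) < e"
      by eventually_elim (use e in \<open>simp add: int \<mu> dist_real_def abs_less_iff\<close>)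
  qed
qed

section \<open>Daniell representation\<close>

context
  fixes L :: "('e::metric_space \<Rightarrow> real) \<Rightarrow> real"
  assumes add: "\<And>f g. f \<in> bcontfun \<Longrightarrow> g \<in> bcontfun \<Longrightarrow> L (\<lambda>x. f x + g x) = L f + L g"
    and scale: "\<And>c f. f \<in> bcontfun \<Longrightarrow> L (\<lambda>x. c * f x) = c * L f"
    and pos: "\<And>f. f \<in> bcontfun \<Longrightarrow> (\<And>x. 0 \<le> f x) \<Longrightarrow> 0 \<le> L f"
    and one: "L (\<lambda>_. 1) = 1"
    and smooth: "\<And>h. (\<And>n. h n \<in> bcontfun) \<Longrightarrow> (\<And>n x. 0 \<le> h n x) \<Longrightarrow> (\<And>n x. h (Suc n) x \<le> h n x) \<Longrightarrow>
      (\<And>x. (\<lambda>n. h n x) \<longlonglongrightarrow> 0) \<Longrightarrow> (\<lambda>n::nat. L (h n)) \<longlonglongrightarrow> 0"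
begin

private lemma L_diff: "f \<in> bcontfun \<Longrightarrow> g \<in> bcontfun \<Longrightarrow> L (\<lambda>x. f x - g x) = L f - L g"
  using add[of f "\<lambda>x. - 1 * g x"] scale[of g "-1"] bcontfun_scale[of g "-1"] by simp

private lemma L_zero: "L (\<lambda>_. 0) = 0"
  using scale[of "\<lambda>_. 0" 0] const_bcontfun[of "0::real"] by simp

private lemma L_sum: "(\<And>i. f i \<in> bcontfun) \<Longrightarrow> L (\<lambda>x. \<Sum>i\<in>I. f i x) = (\<Sum>i\<in>I. L (f i))"
  by (induction I rule: infinite_finite_induct) (simp_all add: L_zero add bcontfun_sum)

private lemma L_mono: "f \<in> bcontfun \<Longrightarrow> g \<in> bcontfun \<Longrightarrow> (\<And>x. f x \<le> g x) \<Longrightarrow> L f \<le> L g"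
  using pos[OF bcontfun_diff[of g f]] L_diff[of g f] by simp

private definition "below G = {f \<in> bcontfun. \<forall>x::'e. 0 \<le> f x \<and> f x \<le> (indicator G x :: real)}"

text \<open>\<open>lam\<close> is the content on open sets and \<open>outer\<close> its outer
  measure, as in the Riesz-Markov construction. There compact supports yield countable
  subadditivity; here the continuity hypothesis \<open>smooth\<close> takes their place.\<close>

private definition "lam G = (SUP f\<in>below G. ennreal (L f))"

private definition "outer A = (INF G\<in>{G. open G \<and> A \<subseteq> G}. lam G)"

private lemma below_zero: "(\<lambda>_. 0) \<in> below G"
  by (simp add: below_def const_bcontfun)

private lemma below_L: "f \<in> below G \<Longrightarrow> 0 \<le> L f" "f \<in> below G \<Longrightarrow> L f \<le> 1"
proof -
  assume f: "f \<in> below G"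
  then show "0 \<le> L f" by (intro pos) (auto simp: below_def)
  have "f x \<le> 1" for x using f by (auto simp: below_def indicator_def intro: order_trans split: if_splits)
  then show "L f \<le> 1" using f one by (subst one[symmetric], intro L_mono) (auto simp: below_def const_bcontfun)
qed

private lemma lam_upper: "f \<in> below G \<Longrightarrow> ennreal (L f) \<le> lam G"
  unfolding lam_def by (rule SUP_upper)

private lemma lam_le_1: "lam G \<le> 1"
  unfolding lam_def using below_L(2) by (intro SUP_least) (simp add: ennreal_le_1)

private lemma lam_empty: "lam {} = 0"
proof -
  have "below {} = {\<lambda>_. 0}" using below_zero by (auto simp: below_def fun_eq_iff intro: antisym)
  then show ?thesis by (simp add: lam_def L_zero)
qed

private lemma lam_mono: "G \<subseteq> H \<Longrightarrow> lam G \<le> lam H"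
  unfolding lam_def
proof (rule SUP_subset_mono)
  assume "G \<subseteq> H"
  then have "indicator G x \<le> (indicator H x :: real)" for x by (auto simp: indicator_def)
  then show "below G \<subseteq> below H" unfolding below_def by (blast intro: order_trans)
qed simp

private lemma lip_minorant_below:
  assumes "open G" shows "lip_minorant (indicator G) m \<in> below G"
  by (simp add: below_def lip_minorant_bcontfun lip_minorant_bounds lip_minorant_indicator_le)

text \<open>This is where \<open>smooth\<close> enters. A function below the union is cut by sums
  \<open>S n\<close> of minorants of the single sets. These increase to at least 1 on the union, so
  the remainder \<open>h n\<close> decreases to 0 pointwise and its value under \<open>L\<close>
  vanishes in the limit.\<close>

private lemma lam_countably_subadditive:
  assumes G: "\<And>i::nat. open (G i)"
  shows "lam (\<Union>i. G i) \<le> (\<Sum>i. lam (G i))"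
  unfolding lam_def[of "\<Union>i. G i"]
proof (rule SUP_least)
  fix f assume "f \<in> below (\<Union>i. G i)"
  then have f: "f \<in> bcontfun" "\<And>x. 0 \<le> f x" "\<And>x. f x \<le> indicator (\<Union>i. G i) x"
    by (auto simp: below_def)
  define \<phi> where "\<phi> i n = lip_minorant (indicator (G i)) n" for i n
  have \<phi>: "\<phi> i n \<in> bcontfun" "0 \<le> \<phi> i n x" "\<phi> i n \<in> below (G i)" for i n x
    unfolding \<phi>_def using G by (simp_all add: lip_minorant_bcontfun lip_minorant_bounds lip_minorant_below)
  have \<phi>_mono: "\<phi> i n x \<le> \<phi> i (Suc n) x" for i n x
    unfolding \<phi>_def by (rule lip_minorant_mono) simp
  \<comment> \<open>One index \<open>n\<close> both counts the sets and fixes the Lipschitz level,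
    so \<open>S\<close> increases and still reaches every set.\<close>
  define S where "S n x = (\<Sum>i<n. \<phi> i n x)" for n x
  have S: "S n \<in> bcontfun" "0 \<le> S n x" "S n x \<le> S (Suc n) x" for n x
  proof -
    show "S n \<in> bcontfun" unfolding S_def by (intro bcontfun_sum \<phi>)
    show "0 \<le> S n x" unfolding S_def by (intro sum_nonneg \<phi>)
    have "S n x \<le> (\<Sum>i<n. \<phi> i (Suc n) x)" unfolding S_def by (intro sum_mono \<phi>_mono)
    also have "\<dots> \<le> S (Suc n) x" unfolding S_def using \<phi> by simp
    finally show "S n x \<le> S (Suc n) x" .
  qed
  define h where "h n x = f x - min (f x) (S n x)" for n x
  have psi: "(\<lambda>x. min (f x) (S n x)) \<in> bcontfun" for n by (intro bcontfun_min f S)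
  have lim: "(\<lambda>n. L (h n)) \<longlonglongrightarrow> 0"
  proof (rule smooth)
    show "h n \<in> bcontfun" for n unfolding h_def by (intro bcontfun_diff f psi)
    show "0 \<le> h n x" for n x unfolding h_def by simp
    show "h (Suc n) x \<le> h n x" for n x unfolding h_def using S(3)[of n x] by simp
    show "(\<lambda>n. h n x) \<longlonglongrightarrow> 0" for x
    proof (cases "x \<in> (\<Union>i. G i)")
      case False
      then have "f x = 0" using f(2)[of x] f(3)[of x] by simp
      then show ?thesis using S(2) by (simp add: h_def)
    next
      case True
      then obtain i where i: "x \<in> G i" by blast
      have "(\<lambda>n. ennreal (\<phi> i n x)) \<longlonglongrightarrow> (SUP n. ennreal (\<phi> i n x))"
        by (rule LIMSEQ_SUP) (auto simp: incseq_Suc_iff \<phi>_mono intro: ennreal_leI)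
      then have "(\<lambda>n. ennreal (\<phi> i n x)) \<longlonglongrightarrow> ennreal 1"
        using i unfolding \<phi>_def lip_minorant_SUP[OF lower_semicont_indicator[OF G]] by simp
      then have "(\<lambda>n. \<phi> i n x) \<longlonglongrightarrow> 1"
        using \<phi>(2) by (subst (asm) tendsto_ennreal_iff) auto
      then have "(\<lambda>n. f x - min (f x) (\<phi> i n x)) \<longlonglongrightarrow> f x - min (f x) 1"
        by (intro tendsto_intros)
      moreover have "f x \<le> 1" using f(3)[of x] indicator_le_1[of "\<Union>i. G i" x] by (rule order_trans)
      ultimately have "(\<lambda>n. f x - min (f x) (\<phi> i n x)) \<longlonglongrightarrow> 0" by simp
      then show ?thesis
      proof (rule tendsto_sandwich[OF _ _ tendsto_const, rotated 2])
        show "\<forall>\<^sub>F n in sequentially. 0 \<le> h n x" by (simp add: h_def)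
        show "\<forall>\<^sub>F n in sequentially. h n x \<le> f x - min (f x) (\<phi> i n x)"
          using eventually_gt_at_top[of i]
        proof eventually_elim
          case (elim n)
          have "\<phi> i n x \<le> S n x" unfolding S_def
            using elim \<phi> by (intro member_le_sum) auto
          then show ?case unfolding h_def by simp
        qed
      qed
    qed
  qed
  have "ennreal (L f) \<le> ennreal (L (h n)) + (\<Sum>i. lam (G i))" for n
  proof -
    have "L f = L (h n) + L (\<lambda>x. min (f x) (S n x))"
      unfolding h_def using L_diff[OF f(1) psi, of n] by simp
    also have "\<dots> \<le> L (h n) + L (S n)" by (intro add_left_mono L_mono psi S) auto
    also have "L (S n) = (\<Sum>i<n. L (\<phi> i n))" unfolding S_def by (intro L_sum \<phi>)
    finally have "ennreal (L f) \<le> ennreal (L (h n) + (\<Sum>i<n. L (\<phi> i n)))" by (rule ennreal_leI)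
    also have "\<dots> = ennreal (L (h n)) + (\<Sum>i<n. ennreal (L (\<phi> i n)))"
    proof (subst ennreal_plus)
      show "0 \<le> L (h n)" unfolding h_def by (intro pos bcontfun_diff f psi) simp
      show "0 \<le> (\<Sum>i<n. L (\<phi> i n))" by (intro sum_nonneg below_L(1)[OF \<phi>(3)])
    qed (simp add: sum_ennreal below_L(1)[OF \<phi>(3)])
    also have "(\<Sum>i<n. ennreal (L (\<phi> i n))) \<le> (\<Sum>i<n. lam (G i))"
      by (intro sum_mono lam_upper \<phi>)
    also have "(\<Sum>i<n. lam (G i)) \<le> (\<Sum>i. lam (G i))"
      by (intro sum_le_suminf) auto
    finally show ?thesis by (simp add: add_left_mono)
  qed
  moreover have "(\<lambda>n. ennreal (L (h n)) + (\<Sum>i. lam (G i))) \<longlonglongrightarrow> ennreal 0 + (\<Sum>i. lam (G i))"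
    by (intro tendsto_intros tendsto_ennrealI lim)
  ultimately show "ennreal (L f) \<le> (\<Sum>i. lam (G i))"
    using LIMSEQ_le_const by fastforce
qed

section \<open>Caratheodory extension\<close>

private lemma outer_mono: "A \<subseteq> B \<Longrightarrow> outer A \<le> outer B"
  unfolding outer_def by (rule INF_superset_mono) auto

private lemma outer_open: "open G \<Longrightarrow> outer G = lam G"
  unfolding outer_def by (rule antisym) (auto intro: INF_lower INF_greatest lam_mono)

private lemma outer_le_1: "outer A \<le> 1"
  using outer_mono[of A UNIV] outer_open[of UNIV] lam_le_1[of UNIV] by simp

private lemma outer_countably_subadditive: "outer (\<Union>i. A i) \<le> (\<Sum>i::nat. outer (A i))"
proof (rule ennreal_le_epsilon)
  fix e :: real assume e: "0 < e"
  have "\<exists>G. open G \<and> A i \<subseteq> G \<and> lam G < outer (A i) + ennreal (e * (1/2) ^ Suc i)" for i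
  proof -
    have "outer (A i) < \<infinity>" using outer_le_1[of "A i"] by (auto intro: le_less_trans)
    then have "outer (A i) < outer (A i) + ennreal (e * (1/2) ^ Suc i)"
      using ennreal_add_left_cancel_less[of "outer (A i)" 0 "ennreal (e * (1/2) ^ Suc i)"] e by simp
    then show ?thesis unfolding outer_def[of "A i"] by (subst (asm) INF_less_iff) auto
  qed
  then obtain G where G: "\<And>i. open (G i)" "\<And>i. A i \<subseteq> G i"
    "\<And>i. lam (G i) < outer (A i) + ennreal (e * (1/2) ^ Suc i)" by metis
  have "outer (\<Union>i. A i) \<le> lam (\<Union>i. G i)"
    unfolding outer_def using G by (intro INF_lower) auto
  also have "\<dots> \<le> (\<Sum>i. lam (G i))" by (rule lam_countably_subadditive) (rule G)
  also have "\<dots> \<le> (\<Sum>i. outer (A i) + ennreal (e * (1/2) ^ Suc i))"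
    using G(3) by (intro suminf_le) (auto intro: less_imp_le)
  also have "\<dots> = (\<Sum>i. outer (A i)) + (\<Sum>i. ennreal (e * (1/2) ^ Suc i))"
    by (simp add: suminf_add)
  also have "(\<Sum>i. ennreal (e * (1/2) ^ Suc i)) = ennreal e"
  proof (rule suminf_ennreal_eq)
    show "(\<lambda>i. e * (1/2) ^ Suc i) sums e" using sums_mult[OF power_half_series, of e] by simp
  qed (use e in simp)
  finally show "outer (\<Union>i. A i) \<le> (\<Sum>i. outer (A i)) + ennreal e" .
qed

private lemma outer_measure_space: "outer_measure_space (Pow UNIV) outer"
  unfolding outer_measure_space_def positive_def increasing_def countably_subadditive_def
  using outer_mono outer_countably_subadditive outer_open[of "{}"] lam_empty by auto

text \<open>Caratheodory's inequality for the open set \<open>G\<close>, tested on an open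
  \<open>U\<close>. Competitors on \<open>U \<inter> G\<close> and around \<open>U - G\<close> have
  to be added without exceeding 1 on \<open>U\<close>; confining the second one to where the first
  is below \<open>d\<close> limits the excess to \<open>d\<close>.\<close>

private lemma outer_split_open:
  assumes G: "open G" and U: "open U"
  shows "lam (U \<inter> G) + outer (U - G) \<le> lam U"
proof -
  have "(SUP f\<in>below (U \<inter> G). ennreal (L f) + outer (U - G)) \<le> lam U"
  proof (rule SUP_least)
    fix f assume "f \<in> below (U \<inter> G)"
    then have f: "f \<in> bcontfun" "\<And>x. 0 \<le> f x" "\<And>x. f x \<le> indicator (U \<inter> G) x" "0 \<le> L f"
      using below_L by (auto simp: below_def)
    have f0: "x \<notin> U \<Longrightarrow> f x = 0" "x \<notin> G \<Longrightarrow> f x = 0" "f x \<le> 1" for x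
      using f(2)[of x] f(3)[of x] order_trans[OF f(3)[of x] indicator_le_1] by auto
    show "ennreal (L f) + outer (U - G) \<le> lam U"
    proof (rule ennreal_le_epsilon)
      fix d :: real assume d: "d > 0"
      \<comment> \<open>Open, and a superset of \<open>U - G\<close>, because \<open>f\<close>
        vanishes off \<open>G\<close> and \<open>d\<close> is positive.\<close>
      define V where "V = U \<inter> {x. f x < d}"
      have "open V" unfolding V_def using f(1) U
        by (intro open_Int open_Collect_less continuous_intros) (auto simp: bcontfun_def)
      then have "outer (U - G) \<le> lam V"
        unfolding outer_def V_def using f0 d by (intro INF_lower) auto
      then have "ennreal (L f) + outer (U - G) \<le> ennreal (L f) + lam V" by (rule add_left_mono)
      also have "\<dots> = (SUP g\<in>below V. ennreal (L f) + ennreal (L g))"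
        unfolding lam_def using below_zero by (subst ennreal_SUP_add_right) auto
      also have "\<dots> \<le> lam U + ennreal d"
      proof (rule SUP_least)
        fix g assume g: "g \<in> below V"
        then have g': "g \<in> bcontfun" "0 \<le> L g" using below_L by (auto simp: below_def)
        \<comment> \<open>The sum is at most \<open>1 + d\<close> on \<open>V\<close>, where
          \<open>f < d\<close>, and at most 1 off \<open>V\<close>, where \<open>g\<close> vanishes;
          division by \<open>1 + d\<close> makes it a competitor for \<open>U\<close>.\<close>
        define k where "k x = 1 / (1 + d) * (f x + g x)" for x
        have kb: "0 \<le> k x" "k x \<le> indicator U x" for x
        proof -
          have gx: "0 \<le> g x" "g x \<le> indicator V x" using g by (auto simp: below_def)
          show "0 \<le> k x" using gx f(2) d by (simp add: k_def)
          have "f x + g x \<le> (1 + d) * indicator U x"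
          proof (cases "x \<in> V")
            case True
            then show ?thesis using gx(2) f0(3)[of x] by (auto simp: V_def)
          next
            case False
            then show ?thesis using gx f0[of x] d by (cases "x \<in> U") auto
          qed
          then show "k x \<le> indicator U x" using d by (simp add: k_def field_simps)
        qed
        have "k \<in> bcontfun" unfolding k_def by (intro bcontfun_scale bcontfun_add f g')
        then have k: "k \<in> below U" using kb by (simp add: below_def)
        have "L k = 1 / (1 + d) * (L f + L g)"
          unfolding k_def using f(1) g'(1) by (subst scale) (auto intro: bcontfun_add simp: add)
        then have "L f + L g = L k + d * L k" using d by (simp add: field_simps)
        also have "d * L k \<le> d" using below_L(2)[OF k] d by simp
        finally have "ennreal (L f + L g) \<le> ennreal (L k + d)" by (simp add: ennreal_leI)
        also have "\<dots> = ennreal (L k) + ennreal d" using below_L(1)[OF k] d by simp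
        also have "\<dots> \<le> lam U + ennreal d" using lam_upper[OF k] by (rule add_right_mono)
        finally show "ennreal (L f) + ennreal (L g) \<le> lam U + ennreal d"
          using f(4) g'(2) by (simp add: ennreal_plus)
      qed
      finally show "ennreal (L f) + outer (U - G) \<le> lam U + ennreal d" .
    qed
  qed
  then show ?thesis
    unfolding lam_def[of "U \<inter> G"] using below_zero by (subst ennreal_SUP_add_left[symmetric]) auto
qed

text \<open>Caratheodory's measurable sets form a sigma-algebra, so only open sets need to be
  tested, and by the definition of \<open>outer\<close> only against open test sets.\<close>

private lemma borel_in_lambda_system: "sets borel \<subseteq> lambda_system UNIV (Pow UNIV) outer"
proof -
  interpret sigma_algebra UNIV "Pow UNIV :: 'e set set" by (rule sigma_algebra_Pow)
  have "sigma_algebra UNIV (lambda_system UNIV (Pow UNIV) outer)"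
    using caratheodory_lemma[OF outer_measure_space] by (simp add: measure_space_def)
  then interpret ls: sigma_algebra UNIV "lambda_system UNIV (Pow UNIV) outer" .
  have "G \<in> lambda_system UNIV (Pow UNIV) outer" if G: "open G" for G
  proof -
    have "outer (G \<inter> A) + outer ((UNIV - G) \<inter> A) = outer A" for A
    proof (rule antisym)
      show "outer (G \<inter> A) + outer ((UNIV - G) \<inter> A) \<le> outer A"
        unfolding outer_def[of A]
      proof (rule INF_greatest)
        fix U assume "U \<in> {U. open U \<and> A \<subseteq> U}"
        then have U: "open U" "A \<subseteq> U" by auto
        have "outer (G \<inter> A) \<le> outer (U \<inter> G)" "outer ((UNIV - G) \<inter> A) \<le> outer (U - G)"
          using U by (auto intro: outer_mono)
        then have "outer (G \<inter> A) + outer ((UNIV - G) \<inter> A) \<le> lam (U \<inter> G) + outer (U - G)"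
          using outer_open[of "U \<inter> G"] G U(1) by (simp add: add_mono open_Int)
        also have "\<dots> \<le> lam U" by (rule outer_split_open[OF G U(1)])
        finally show "outer (G \<inter> A) + outer ((UNIV - G) \<inter> A) \<le> lam U" .
      qed
      have "subadditive (Pow UNIV) outer"
        using outer_measure_space countably_subadditive_subadditive unfolding outer_measure_space_def by blast
      then have "outer ((G \<inter> A) \<union> ((UNIV - G) \<inter> A)) \<le> outer (G \<inter> A) + outer ((UNIV - G) \<inter> A)"
        by (rule subadditiveD) auto
      moreover have "(G \<inter> A) \<union> ((UNIV - G) \<inter> A) = A" by blast
      ultimately show "outer A \<le> outer (G \<inter> A) + outer ((UNIV - G) \<inter> A)" by simp
    qed
    then show ?thesis by (simp add: lambda_system_def)
  qed
  then have "sigma_sets UNIV {G. open G} \<subseteq> lambda_system UNIV (Pow UNIV) outer"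
    by (intro ls.sigma_sets_subset) auto
  then show ?thesis by (simp add: borel_def)
qed

section \<open>The representing measure\<close>

private definition "rep = measure_of UNIV (sets borel) outer"

private lemma emeasure_rep: "A \<in> sets borel \<Longrightarrow> emeasure rep A = outer A"
  and sets_rep: "sets rep = sets borel" and space_rep: "space rep = UNIV"
proof -
  interpret sigma_algebra UNIV "Pow UNIV :: 'e set set" by (rule sigma_algebra_Pow)
  have "countably_additive (lambda_system UNIV (Pow UNIV) outer) outer"
    using caratheodory_lemma[OF outer_measure_space] by (simp add: measure_space_def)
  then have ca: "countably_additive (sets borel) outer"
    using borel_in_lambda_system unfolding countably_additive_def by (meson order_trans subsetD)
  have p: "positive (sets borel) outer"
    using outer_measure_space by (auto simp: outer_measure_space_def positive_def)
  show "sets rep = sets borel" and "space rep = UNIV" unfolding rep_def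
    using sets.sigma_sets_eq[of "borel :: 'e measure"] by (simp_all add: sets_measure_of)
  assume "A \<in> sets borel"
  then show "emeasure rep A = outer A" unfolding rep_def
    using emeasure_measure_of_sigma[OF _ p ca] sets.sigma_algebra_axioms[of "borel :: 'e measure"] by simp
qed

private lemma rep_Prob: "rep \<in> Prob"
proof (intro ProbI prob_spaceI)
  have "(\<lambda>_. 1) \<in> below UNIV" by (simp add: below_def const_bcontfun)
  then have "1 \<le> lam UNIV" using lam_upper[of "\<lambda>_. 1" UNIV] one by simp
  then show "emeasure rep (space rep) = 1"
    using lam_le_1[of UNIV] by (auto simp: space_rep emeasure_rep outer_open intro: antisym)
qed (rule sets_rep)

text \<open>A layer-cake argument. The slice of \<open>f\<close> between heights i/N and (i+1)/N,
  scaled by \<open>N\<close>, lies between the indicators of two consecutive superlevel sets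
  \<open>G\<close>. Hence its value under \<open>L\<close> is at most the measure of the larger set,
  and its integral at least the measure of the smaller one.\<close>

private lemma L_le_integral_unit:
  assumes f: "f \<in> bcontfun" "\<And>x. 0 \<le> f x" "\<And>x. f x \<le> 1"
  shows "L f \<le> (\<integral>x. f x \<partial>rep)"
proof (rule field_le_epsilon)
  interpret prob_space rep using ProbD[OF rep_Prob] by simp
  fix e :: real assume "e > 0"
  then obtain M :: nat where M: "1 / real (Suc M) < e" using nat_approx_posE by blast
  define N where "N = Suc M"
  have N: "real N > 0" by (simp add: N_def)
  define s where "s i x = min (f x) (real (Suc i) / N) - min (f x) (real i / N)" for i x
  have s_b: "s i \<in> bcontfun" for i
    unfolding s_def by (intro bcontfun_diff bcontfun_min f const_bcontfun)
  have tel: "(\<Sum>i<n. s i x) = min (f x) (real n / N)" for n x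
    unfolding s_def using f(2)[of x] by (induction n) auto
  have step: "real i / N \<le> real (Suc i) / N" for i using N by (simp add: field_simps)
  have s_le: "0 \<le> s i x" "N * s i x \<le> indicator {x. f x > real i / N} x"
    "indicator {x. f x > real (Suc i) / N} x \<le> N * s i x" for i x
    using step[of i] N by (auto simp: s_def min_def indicator_def field_simps)
  define G where "G i = {x. f x > real i / N}" for i
  have G_open: "open (G i)" for i unfolding G_def
    using f(1) by (intro open_Collect_less continuous_intros) (auto simp: bcontfun_def)
  have G_sets: "G i \<in> sets rep" for i using G_open by (simp add: sets_rep)
  have "N * L (s i) \<le> prob (G i)" for i
  proof -
    have "(\<lambda>x. N * s i x) \<in> below (G i)"
      using s_le[of i] s_b[of i] bcontfun_scale N by (auto simp: below_def G_def)
    from lam_upper[OF this] have "ennreal (N * L (s i)) \<le> lam (G i)" by (simp add: scale s_b)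
    also have "\<dots> = ennreal (prob (G i))"
      using G_open by (simp add: emeasure_eq_measure[symmetric] emeasure_rep outer_open)
    finally show ?thesis by (simp add: ennreal_le_iff)
  qed
  then have "(\<Sum>i<N. N * L (s i)) \<le> (\<Sum>i<N. prob (G i))" by (intro sum_mono)
  moreover have "L f = (\<Sum>i<N. L (s i))"
  proof -
    have "f = (\<lambda>x. \<Sum>i<N. s i x)" unfolding tel using f(3) N by (auto simp: fun_eq_iff)
    then have "L f = L (\<lambda>x. \<Sum>i<N. s i x)" by (rule arg_cong)
    then show ?thesis by (simp add: L_sum s_b)
  qed
  ultimately have "N * L f \<le> (\<Sum>i<N. prob (G i))" by (simp add: sum_distrib_left)
  \<comment> \<open>Slice i + 1 of the functional is matched with slice i of the integral. What
    remains is \<open>prob (G 0)\<close>, at most 1 before division by \<open>N\<close>, so the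
    error is 1/N.\<close>
  also have "\<dots> = prob (G 0) + (\<Sum>i<M. prob (G (Suc i)))"
    unfolding N_def by (rule sum.lessThan_Suc_shift)
  also have "\<dots> \<le> 1 + (\<Sum>i<M. \<integral>x. N * s i x \<partial>rep)"
  proof (intro add_mono sum_mono)
    fix i
    have "(\<integral>x. indicator (G (Suc i)) x \<partial>rep) \<le> (\<integral>x. N * s i x \<partial>rep)"
    proof (rule integral_mono)
      show "integrable rep (\<lambda>x. N * s i x)" by (intro bcontfun_integrable rep_Prob bcontfun_scale s_b)
      show "integrable rep (indicat_real (G (Suc i)))"
        using G_sets[of "Suc i"] by (intro integrable_real_indicator) (auto simp: emeasure_eq_measure)
      show "indicator (G (Suc i)) x \<le> N * s i x" for x unfolding G_def by (rule s_le)
    qed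
    then show "prob (G (Suc i)) \<le> (\<integral>x. N * s i x \<partial>rep)" using G_sets by simp
  qed simp
  also have "(\<Sum>i<M. \<integral>x. N * s i x \<partial>rep) = (\<integral>x. N * (\<Sum>i<M. s i x) \<partial>rep)"
    using s_b by (simp add: sum_distrib_left[symmetric] bcontfun_integrable[OF rep_Prob] integral_sum)
  also have "\<dots> \<le> (\<integral>x. N * f x \<partial>rep)"
    using N by (intro integral_mono bcontfun_integrable rep_Prob bcontfun_scale bcontfun_sum s_b f)
      (simp add: tel)
  finally have "N * L f \<le> 1 + N * (\<integral>x. f x \<partial>rep)" by simp
  then have "L f \<le> 1 / N + (\<integral>x. f x \<partial>rep)" using N by (simp add: field_simps)
  then show "L f \<le> (\<integral>x. f x \<partial>rep) + e" using M unfolding N_def by linarith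
qed

private lemma L_le_integral: "f \<in> bcontfun \<Longrightarrow> L f \<le> (\<integral>x. f x \<partial>rep)"
proof -
  interpret prob_space rep using ProbD[OF rep_Prob] by simp
  assume f: "f \<in> bcontfun"
  then obtain B where B: "B > 0" "\<And>x. \<bar>f x\<bar> \<le> B" using bcontfun_bound by metis
  have fB: "(\<lambda>x. f x + B) \<in> bcontfun" by (intro bcontfun_add f const_bcontfun)
  have "0 \<le> 1 / (2 * B) * (f x + B)" "1 / (2 * B) * (f x + B) \<le> 1" for x
    using B(1) B(2)[of x] by (simp_all add: field_simps)
  then have "L (\<lambda>x. 1 / (2 * B) * (f x + B)) \<le> (\<integral>x. 1 / (2 * B) * (f x + B) \<partial>rep)"
    by (intro L_le_integral_unit bcontfun_scale fB)
  moreover have "L (\<lambda>x. 1 / (2 * B) * (f x + B)) = 1 / (2 * B) * (L f + B)"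
  proof -
    have "L (\<lambda>x. B * 1) = B" using scale[of "\<lambda>_. 1" B] one const_bcontfun[of "1::real"] by simp
    then have "L (\<lambda>x. f x + B) = L f + B" using add[OF f const_bcontfun[of B]] by simp
    then show ?thesis using scale[OF fB, of "1 / (2 * B)"] by simp
  qed
  moreover have "(\<integral>x. 1 / (2 * B) * (f x + B) \<partial>rep) = 1 / (2 * B) * ((\<integral>x. f x \<partial>rep) + B)"
    using bcontfun_integrable[OF rep_Prob f] by (simp add: prob_space)
  ultimately show ?thesis using B(1) by (simp add: field_simps)
qed

lemma daniell_representation: "\<exists>P\<in>Prob. \<forall>f. f \<in> bcontfun \<longrightarrow> L f = (\<integral>x. f x \<partial>P)"
proof (intro bexI[of _ rep] rep_Prob allI impI antisym L_le_integral)
  fix f :: "'e \<Rightarrow> real" assume f: "f \<in> bcontfun"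
  \<comment> \<open>For the negative function the one-sided inequality is the reverse inequality, by
    linearity of both sides.\<close>
  have "L (\<lambda>x. - 1 * f x) \<le> (\<integral>x. - 1 * f x \<partial>rep)" by (intro L_le_integral bcontfun_scale f)
  then show "(\<integral>x. f x \<partial>rep) \<le> L f" unfolding scale[OF f] by simp
qed

end

section \<open>Relative entropy\<close>

text \<open>The entropy integrand t log t made non-negative: \<open>1 - t\<close> integrates to 0
  along a probability density, so the entropy becomes one integral of a non-negative
  function.\<close>

definition ent_fun :: "real \<Rightarrow> real" where
  "ent_fun t = t * ln t - t + 1"

lemma ent_fun_measurable [measurable]: "ent_fun \<in> borel_measurable borel"
  unfolding ent_fun_def by measurable

text \<open>Fenchel-Young inequality: the convex conjugate of \<open>ent_fun\<close> on the
  non-negative half-line is \<open>exp s - 1\<close>.\<close>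

lemma ent_fun_young:
  assumes "0 \<le> t"
  shows "s * t \<le> ent_fun t + exp s - 1"
proof (cases "t = 0")
  case False
  then have t: "t > 0" using assms by simp
  have "ln (exp s / t) \<le> exp s / t - 1" using t by (intro ln_le_minus_one) simp
  then have "s - ln t \<le> exp s / t - 1" using t by (simp add: ln_div)
  then have "t * (s - ln t) \<le> t * (exp s / t - 1)" using t by (intro mult_left_mono) auto
  then show ?thesis using t by (simp add: ent_fun_def algebra_simps)
qed (simp add: ent_fun_def)

lemma ent_fun_nonneg: "0 \<le> t \<Longrightarrow> 0 \<le> ent_fun t"
  using ent_fun_young[of t 0] by simp

lemma ent_fun_pos:
  assumes "0 \<le> t" "t \<noteq> 1"
  shows "0 < ent_fun t"
proof (cases "t = 0")
  case False
  then have t: "t > 0" using assms by simp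
  have "ln (1 / t) \<noteq> 1 / t - 1" using ln_eq_minus_one[of "1 / t"] t assms(2) by auto
  then have "ln (1 / t) < 1 / t - 1" using ln_le_minus_one[of "1 / t"] t by simp
  then have "t * (- ln t) < t * (1 / t - 1)" using t by (intro mult_strict_left_mono) (auto simp: ln_div)
  then show ?thesis using t by (simp add: ent_fun_def algebra_simps)
qed (simp add: ent_fun_def)

text \<open>The derivative of \<open>ent_fun\<close> is \<open>ln\<close>, so the last term is the
  exact remainder above the tangent at \<open>m\<close>; with \<open>ent_fun_pos\<close> this is
  strict convexity.\<close>

lemma ent_fun_above_tangent:
  assumes "0 \<le> s" "m > 0"
  shows "ent_fun s = ent_fun m + (s - m) * ln m + m * ent_fun (s / m)"
  using assms by (cases "s = 0") (auto simp: ent_fun_def ln_div field_simps)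

lemma ent_fun_midpoint:
  assumes "0 \<le> s" "0 \<le> t"
  shows "2 * ent_fun ((s + t) / 2) \<le> ent_fun s + ent_fun t"
    and "s \<noteq> t \<Longrightarrow> 2 * ent_fun ((s + t) / 2) < ent_fun s + ent_fun t"
proof -
  show strict: "2 * ent_fun ((s + t) / 2) < ent_fun s + ent_fun t" if ne: "s \<noteq> t"
  proof -
    define m where "m = (s + t) / 2"
    have m: "m > 0" "s \<noteq> m" "t \<noteq> m" using assms ne by (auto simp: m_def)
    have "0 < m * ent_fun (s / m)" "0 < m * ent_fun (t / m)"
      using m assms by (auto intro!: mult_pos_pos ent_fun_pos)
    \<comment> \<open>At the midpoint the linear terms of the two tangent expansions cancel.\<close>
    moreover have "(s - m) * ln m + (t - m) * ln m = 0"
      by (simp add: m_def distrib_right[symmetric])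
    ultimately show ?thesis
      using ent_fun_above_tangent[OF assms(1) m(1)] ent_fun_above_tangent[OF assms(2) m(1)]
      unfolding m_def[symmetric] by linarith
  qed
  show "2 * ent_fun ((s + t) / 2) \<le> ent_fun s + ent_fun t"
    using strict by (cases "s = t") auto
qed

section \<open>Densities and the variational formula\<close>

lemma absolutely_continuous_real_density:
  assumes P: "prob_space P" and R: "prob_space R" and sets: "sets P = sets R"
    and ac: "absolutely_continuous R P"
  obtains \<rho> :: "'a \<Rightarrow> real" where "\<rho> \<in> borel_measurable R" "\<And>x. 0 \<le> \<rho> x" "P = density R \<rho>"
proof -
  interpret R: prob_space R by fact
  interpret P: prob_space P by fact
  have fin: "AE x in R. RN_deriv R P x \<noteq> \<infinity>"
    by (rule R.RN_deriv_finite[OF _ ac sets]) unfold_locales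
  have "P = density R (RN_deriv R P)" using R.density_RN_deriv[OF ac sets] by simp
  also have "\<dots> = density R (\<lambda>x. ennreal (enn2real (RN_deriv R P x)))"
    using fin by (intro density_cong) (auto simp: less_top[symmetric])
  finally show thesis by (intro that[of "\<lambda>x. enn2real (RN_deriv R P x)"]) auto
qed

text \<open>The definition subtracts two integrals, whereas additivity is available for non-negative
  terms. With A and B the integrals of the positive and negative parts and D that of
  \<open>ent_fun\<close>, one gets A + 1 = D + 1 + B; since B is at most 1, it may be
  subtracted.\<close>

lemma rel_entropy_density:
  fixes \<rho> :: "'a \<Rightarrow> real"
  assumes P: "prob_space P" and R: "prob_space R"
    and \<rho>: "\<rho> \<in> borel_measurable R" "\<And>x. 0 \<le> \<rho> x" "P = density R \<rho>"
  shows "rel_entropy P R = enn2ereal (\<integral>\<^sup>+x. ennreal (ent_fun (\<rho> x)) \<partial>R)"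
proof -
  interpret R: prob_space R by fact
  interpret P: prob_space P by fact
  note \<rho>(1)[measurable]
  have ac: "absolutely_continuous R P"
    unfolding \<rho>(3) by (rule absolutely_continuousI_density) measurable
  have eq: "AE x in R. ennreal (\<rho> x) = RN_deriv R P x"
    by (rule R.RN_deriv_unique) (use \<rho> in auto)
  have int: "(\<integral>\<^sup>+x. ennreal (F (enn2real (RN_deriv R P x))) \<partial>P) = (\<integral>\<^sup>+x. ennreal (\<rho> x * F (\<rho> x)) \<partial>R)"
    if [measurable]: "F \<in> borel_measurable borel" for F :: "real \<Rightarrow> real"
  proof -
    have "(\<integral>\<^sup>+x. G x \<partial>P) = (\<integral>\<^sup>+x. ennreal (\<rho> x) * G x \<partial>R)" if "G \<in> borel_measurable R" for G
      unfolding \<rho>(3) using that by (intro nn_integral_density) measurable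
    then have "(\<integral>\<^sup>+x. ennreal (F (enn2real (RN_deriv R P x))) \<partial>P)
        = (\<integral>\<^sup>+x. ennreal (\<rho> x) * ennreal (F (enn2real (RN_deriv R P x))) \<partial>R)"
      by this measurable
    also have "\<dots> = (\<integral>\<^sup>+x. ennreal (\<rho> x * F (\<rho> x)) \<partial>R)"
    proof (rule nn_integral_cong_AE)
      show "AE x in R. ennreal (\<rho> x) * ennreal (F (enn2real (RN_deriv R P x))) = ennreal (\<rho> x * F (\<rho> x))"
        using eq
      proof eventually_elim
        case (elim x)
        then show ?case unfolding elim[symmetric] using \<rho>(2)[of x] by (simp add: ennreal_mult')
      qed
    qed
    finally show ?thesis .
  qed
  define A where "A = (\<integral>\<^sup>+x. ennreal (\<rho> x * ln (\<rho> x)) \<partial>R)"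
  define B where "B = (\<integral>\<^sup>+x. ennreal (\<rho> x * - ln (\<rho> x)) \<partial>R)"
  define D where "D = (\<integral>\<^sup>+x. ennreal (ent_fun (\<rho> x)) \<partial>R)"
  have rel: "rel_entropy P R = enn2ereal A - enn2ereal B"
    unfolding rel_entropy_def A_def B_def using ac int[of ln] int[of "\<lambda>t. - ln t"] by simp
  have mass: "(\<integral>\<^sup>+x. ennreal (\<rho> x) \<partial>R) = 1"
  proof -
    have "(\<integral>\<^sup>+x. ennreal (\<rho> x) \<partial>R) = emeasure P (space R)"
      unfolding \<rho>(3) by (subst emeasure_density) (auto intro!: nn_integral_cong)
    also have "\<dots> = 1" using P.emeasure_space_1 unfolding \<rho>(3) by simp
    finally show ?thesis .
  qed
  have "A + 1 = (\<integral>\<^sup>+x. ennreal (\<rho> x * ln (\<rho> x)) + 1 \<partial>R)"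
    unfolding A_def by (subst nn_integral_add) (auto simp: R.emeasure_space_1)
  also have "\<dots> = (\<integral>\<^sup>+x. ennreal (ent_fun (\<rho> x)) + (ennreal (\<rho> x) + ennreal (\<rho> x * - ln (\<rho> x))) \<partial>R)"
  proof (rule nn_integral_cong)
    fix x
    have e: "ent_fun (\<rho> x) + \<rho> x = \<rho> x * ln (\<rho> x) + 1" by (simp add: ent_fun_def)
    show "ennreal (\<rho> x * ln (\<rho> x)) + 1 = ennreal (ent_fun (\<rho> x)) + (ennreal (\<rho> x) + ennreal (\<rho> x * - ln (\<rho> x)))"
    proof (cases "0 \<le> \<rho> x * ln (\<rho> x)")
      case True
      then have "ennreal (\<rho> x * ln (\<rho> x)) + 1 = ennreal (ent_fun (\<rho> x) + \<rho> x)"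
        unfolding e ennreal_1[symmetric] by (rule ennreal_plus[symmetric]) simp
      then show ?thesis using True \<rho>(2) by (simp add: ent_fun_nonneg ennreal_neg)
    next
      case False
      have "ent_fun (\<rho> x) + (\<rho> x + \<rho> x * - ln (\<rho> x)) = 1" by (simp add: ent_fun_def)
      then have "ennreal 1 = ennreal (ent_fun (\<rho> x)) + (ennreal (\<rho> x) + ennreal (\<rho> x * - ln (\<rho> x)))"
        using \<rho>(2)[of x] ent_fun_nonneg[OF \<rho>(2)[of x]] False
        by (simp add: ennreal_plus[symmetric] del: ennreal_plus)
      then show ?thesis using False by (simp add: ennreal_neg)
    qed
  qed
  also have "\<dots> = D + (1 + B)"
    unfolding D_def B_def by (subst nn_integral_add, measurable)+ (simp add: mass)
  finally have "A = D + B"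
    using ennreal_add_left_cancel[of 1 A "D + B"] by (simp add: ac_simps)
  moreover have "B \<le> 1"
  proof -
    have "B \<le> (\<integral>\<^sup>+x. 1 \<partial>R)" unfolding B_def
    proof (rule nn_integral_mono)
      fix x
      have "\<rho> x * - ln (\<rho> x) \<le> 1" using ent_fun_nonneg[OF \<rho>(2)[of x]] \<rho>(2)[of x] by (simp add: ent_fun_def)
      then show "ennreal (\<rho> x * - ln (\<rho> x)) \<le> 1" by (simp add: ennreal_le_1)
    qed
    then show ?thesis by (simp add: R.emeasure_space_1)
  qed
  then obtain b where b: "B = ennreal b" "0 \<le> b" by (cases B) (auto simp: top_unique)
  ultimately show ?thesis
    unfolding rel D_def[symmetric] by (cases D) (simp_all add: b plus_ennreal.rep_eq)
qed

lemma rel_entropy_not_ac: "\<not> absolutely_continuous R P \<Longrightarrow> rel_entropy P R = \<infinity>"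
  by (simp add: rel_entropy_def)

lemma rel_entropy_nonneg:
  assumes "prob_space P" "prob_space R" "sets P = sets R"
  shows "0 \<le> rel_entropy P R"
proof (cases "absolutely_continuous R P")
  case True
  obtain \<rho> :: "'a \<Rightarrow> real" where "\<rho> \<in> borel_measurable R" "\<And>x. 0 \<le> \<rho> x" "P = density R \<rho>"
    using absolutely_continuous_real_density[OF assms True] by metis
  then show ?thesis using rel_entropy_density[OF assms(1,2)] by simp
qed (simp add: rel_entropy_not_ac)

text \<open>Donsker-Varadhan in normalised form: integrating \<open>ent_fun_young\<close>, with the
  density for t and \<open>g\<close> for s, leaves the entropy plus the integral of
  \<open>exp (g x)\<close> minus 1. Constraining that integral by 1 avoids a logarithm.\<close>

lemma integral_le_rel_entropy:
  fixes g :: "'a \<Rightarrow> real"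
  assumes P: "prob_space P" and R: "prob_space R" and sets: "sets P = sets R"
    and g: "g \<in> borel_measurable R" "\<And>x. \<bar>g x\<bar> \<le> B" and exp: "(\<integral>x. exp (g x) \<partial>R) \<le> 1"
  shows "ereal (\<integral>x. g x \<partial>P) \<le> rel_entropy P R"
proof (cases "absolutely_continuous R P")
  case True
  interpret R: prob_space R by fact
  interpret P: prob_space P by fact
  obtain \<rho> :: "'a \<Rightarrow> real" where \<rho>: "\<rho> \<in> borel_measurable R" "\<And>x. 0 \<le> \<rho> x" "P = density R \<rho>"
    using absolutely_continuous_real_density[OF P R sets True] by metis
  note \<rho>(1)[measurable] g(1)[measurable]
  have rel: "rel_entropy P R = enn2ereal (\<integral>\<^sup>+x. ennreal (ent_fun (\<rho> x)) \<partial>R)"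
    by (rule rel_entropy_density[OF P R \<rho>])
  show ?thesis
  proof (cases "(\<integral>\<^sup>+x. ennreal (ent_fun (\<rho> x)) \<partial>R) < \<infinity>")
    case True
    then have int: "integrable R (\<lambda>x. ent_fun (\<rho> x))"
      by (intro integrableI_nonneg) (auto simp: ent_fun_nonneg \<rho>(2))
    have rel': "rel_entropy P R = ereal (\<integral>x. ent_fun (\<rho> x) \<partial>R)"
      unfolding rel using int
      by (subst nn_integral_eq_integral) (auto simp: ent_fun_nonneg \<rho>(2) enn2ereal_ennreal integral_nonneg_AE)
    have int_exp: "integrable R (\<lambda>x. exp (g x))"
      using g(2) by (intro R.integrable_const_bound[of _ "exp B"]) (auto simp: abs_le_iff)
    have "integrable P g"
      using g(2) sets by (intro P.integrable_const_bound[of _ B]) (auto simp: measurable_cong_sets[OF sets refl])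
    then have int_g: "integrable R (\<lambda>x. \<rho> x * g x)" unfolding \<rho>(3)
      by (subst (asm) integrable_density) (auto simp: \<rho>(2))
    have "(\<integral>x. g x \<partial>P) = (\<integral>x. \<rho> x * g x \<partial>R)"
      unfolding \<rho>(3) by (subst integral_density) (auto simp: \<rho>(2))
    also have "\<dots> \<le> (\<integral>x. ent_fun (\<rho> x) + exp (g x) - 1 \<partial>R)"
    proof (intro integral_mono)
      show "\<rho> x * g x \<le> ent_fun (\<rho> x) + exp (g x) - 1" for x
        using ent_fun_young[OF \<rho>(2)[of x], of "g x"] by (simp add: mult.commute)
    qed (use int int_exp int_g in auto)
    also have "\<dots> = (\<integral>x. ent_fun (\<rho> x) \<partial>R) + (\<integral>x. exp (g x) \<partial>R) - 1"
      using int int_exp by (simp add: R.prob_space)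
    also have "\<dots> \<le> (\<integral>x. ent_fun (\<rho> x) \<partial>R)" using exp by simp
    finally show ?thesis unfolding rel' by simp
  next
    case False
    then show ?thesis unfolding rel by (simp add: less_top[symmetric])
  qed
qed (simp add: rel_entropy_not_ac)

text \<open>The converse of \<open>integral_le_rel_entropy\<close>; it bounds the entropy of limits
  and mixtures without their densities. The optimal test function is the logarithm of the density,
  which may be unbounded, so the density is truncated and renormalised.\<close>

lemma rel_entropy_leI:
  assumes P: "prob_space P" and R: "prob_space R" and sets: "sets P = sets R"
    and le: "\<And>(g :: 'a \<Rightarrow> real) B. g \<in> borel_measurable R \<Longrightarrow> (\<And>x. \<bar>g x\<bar> \<le> B) \<Longrightarrow>
      (\<integral>x. exp (g x) \<partial>R) \<le> 1 \<Longrightarrow> (\<integral>x. g x \<partial>P) \<le> b"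
  shows "rel_entropy P R \<le> ereal b"
proof -
  interpret R: prob_space R by fact
  interpret P: prob_space P by fact
  have b0: "0 \<le> b" using le[of "\<lambda>_. 0" 0] by (simp add: R.prob_space)
  have ac: "absolutely_continuous R P" unfolding absolutely_continuous_def
  proof
    fix A assume A: "A \<in> null_sets R"
    then have [measurable]: "A \<in> R.events" and A': "A \<in> P.events" using sets by auto
    \<comment> \<open>The indicator of a null set does not affect the exponential integral, so
      arbitrarily large multiples of it are admissible.\<close>
    have "real t * P.prob A \<le> b" for t :: nat
    proof -
      have "AE x in R. exp (real t * indicat_real A x) = 1"
        using AE_not_in[OF A] by eventually_elim simp
      then have "(\<integral>x. exp (real t * indicat_real A x) \<partial>R) = (\<integral>x. 1 \<partial>R)"
        by (intro integral_cong_AE) measurable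
      then have "(\<integral>x. real t * indicat_real A x \<partial>P) \<le> b"
        by (intro le[of _ t]) (auto simp: R.prob_space indicator_def)
      then show ?thesis using A' by simp
    qed
    then have "P.prob A \<le> 0"
    proof (rule_tac ccontr)
      assume le: "\<And>t. real t * P.prob A \<le> b" and "\<not> P.prob A \<le> 0"
      then obtain t :: nat where "b < real t * P.prob A"
        using reals_Archimedean3[of "P.prob A"] by auto
      with le[of t] show False by simp
    qed
    then show "A \<in> null_sets P" using A' by (auto simp: P.emeasure_eq_measure measure_le_0_iff intro!: null_setsI)
  qed
  obtain \<rho> :: "'a \<Rightarrow> real" where \<rho>: "\<rho> \<in> borel_measurable R" "\<And>x. 0 \<le> \<rho> x" "P = density R \<rho>"
    using absolutely_continuous_real_density[OF P R sets ac] by metis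
  note \<rho>(1)[measurable]
  have mass: "integrable R \<rho>" "(\<integral>x. \<rho> x \<partial>R) = 1"
  proof -
    have "integrable P (\<lambda>_. 1 :: real)" "(\<integral>x. 1 \<partial>P) = (1 :: real)" by (simp_all add: P.prob_space)
    moreover have "integrable P (\<lambda>_. 1 :: real) = integrable R \<rho>" "(\<integral>x. 1 \<partial>P) = (\<integral>x. \<rho> x \<partial>R)"
      unfolding \<rho>(3) using \<rho>(2) by (subst integrable_density integral_density; auto)+
    ultimately show "integrable R \<rho>" "(\<integral>x. \<rho> x \<partial>R) = 1" by simp_all
  qed
  \<comment> \<open>Since 3 exceeds e, the logarithm of the upper cut \<open>real n + 3\<close> is
    at least 1 for every \<open>n\<close>; \<open>q_nonneg\<close> needs this where the density lies
    above the cut.\<close>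
  define \<rho>n where "\<rho>n n x = max (1 / (real n + 3)) (min (real n + 3) (\<rho> x))" for n :: nat and x
  have [measurable]: "\<rho>n n \<in> borel_measurable R" for n unfolding \<rho>n_def by measurable
  have b\<rho>n: "1 / (real n + 3) \<le> \<rho>n n x" "\<rho>n n x \<le> real n + 3" "\<rho>n n x \<le> \<rho> x + 1" "0 < \<rho>n n x" for n x
  proof -
    have "1 / (real n + 3) \<le> 1" "1 / (real n + 3) > 0" by simp_all
    then show "1 / (real n + 3) \<le> \<rho>n n x" "\<rho>n n x \<le> real n + 3" "\<rho>n n x \<le> \<rho> x + 1" "0 < \<rho>n n x"
      using \<rho>(2)[of x] unfolding \<rho>n_def by linarith+
  qed
  have null: "(\<lambda>n. 1 / (real n + 3)) \<longlonglongrightarrow> 0"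
    using LIMSEQ_ignore_initial_segment[OF lim_inverse_n', of 3] by (simp add: add.commute)
  have ev: "\<forall>\<^sub>F n in sequentially. \<rho> x > 0 \<longrightarrow> \<rho>n n x = \<rho> x" for x
  proof (cases "\<rho> x > 0")
    case True
    have "\<forall>\<^sub>F n in sequentially. 1 / (real n + 3) < \<rho> x"
      using null True by (rule order_tendstoD)
    moreover have "\<forall>\<^sub>F n in sequentially. \<rho> x \<le> real n + 3"
      by (rule eventually_mono[OF eventually_ge_at_top[of "nat \<lceil>\<rho> x\<rceil>"]]) linarith
    ultimately show ?thesis by eventually_elim (auto simp: \<rho>n_def)
  qed simp
  have lim\<rho>n: "(\<lambda>n. \<rho>n n x) \<longlonglongrightarrow> \<rho> x" for x
  proof (cases "\<rho> x > 0")
    case True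
    then show ?thesis using ev[of x] by (intro tendsto_eventually) auto
  next
    case False
    then have "\<rho> x = 0" using \<rho>(2)[of x] by simp
    then have "\<rho>n n x = 1 / (real n + 3)" for n by (simp add: \<rho>n_def)
    then show ?thesis using null \<open>\<rho> x = 0\<close> by simp
  qed
  define c where "c n = (\<integral>x. \<rho>n n x \<partial>R)" for n
  have lim_c: "c \<longlonglongrightarrow> 1"
    unfolding c_def mass(2)[symmetric]
  proof (rule integral_dominated_convergence[where w = "\<lambda>x. \<rho> x + 1"])
    show "AE x in R. norm (\<rho>n n x) \<le> \<rho> x + 1" for n
      using b\<rho>n[of n] by (intro AE_I2) (simp add: less_imp_le abs_of_pos)
  qed (use mass lim\<rho>n in auto)
  have int\<rho>n: "integrable R (\<rho>n n)" for n
    using b\<rho>n(2,4)[of n] by (intro R.integrable_const_bound[of _ "real n + 3"]) (auto simp: abs_of_pos)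
  have c_pos: "0 < c n" for n
  proof -
    have "1 / (real n + 3) \<le> c n" unfolding c_def
      using b\<rho>n(1) int\<rho>n by (intro R.integral_ge_const) auto
    moreover have "0 < 1 / (real n + 3)" by simp
    ultimately show ?thesis by linarith
  qed
  have ln_b: "\<bar>ln (\<rho>n n x)\<bar> \<le> ln (real n + 3)" for n x
  proof -
    have "ln (\<rho>n n x) \<le> ln (real n + 3)" using b\<rho>n[of n x] by (intro ln_mono) auto
    moreover have "ln (1 / (real n + 3)) \<le> ln (\<rho>n n x)" using b\<rho>n[of n x] by (intro ln_mono) auto
    ultimately show ?thesis by (simp add: ln_div abs_le_iff)
  qed
  have int_ln: "integrable P (\<lambda>x. ln (\<rho>n n x))" for n
    using ln_b by (intro P.integrable_const_bound[of _ "ln (real n + 3)"])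
      (auto simp: measurable_cong_sets[OF sets refl])
  then have int_\<rho>ln: "integrable R (\<lambda>x. \<rho> x * ln (\<rho>n n x))" for n
    unfolding \<rho>(3) by (subst (asm) integrable_density) (auto simp: \<rho>(2))
  \<comment> \<open>Dividing by the mass \<open>c n\<close> makes the exponential integral equal to
    1; the correction \<open>ln (c n)\<close> tends to 0.\<close>
  have main: "(\<integral>x. \<rho> x * ln (\<rho>n n x) \<partial>R) \<le> b + ln (c n)" for n
  proof -
    have "(\<integral>x. exp (ln (\<rho>n n x) - ln (c n)) \<partial>R) = (\<integral>x. \<rho>n n x / c n \<partial>R)"
      using b\<rho>n c_pos by (simp add: exp_diff)
    also have "\<dots> = 1" using c_pos[of n] by (simp add: c_def)
    finally have "(\<integral>x. ln (\<rho>n n x) - ln (c n) \<partial>P) \<le> b"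
    proof (intro le[of _ "ln (real n + 3) + \<bar>ln (c n)\<bar>"])
      show "\<bar>ln (\<rho>n n x) - ln (c n)\<bar> \<le> ln (real n + 3) + \<bar>ln (c n)\<bar>" for x
        using ln_b[of n x] by linarith
    qed auto
    then have "(\<integral>x. ln (\<rho>n n x) \<partial>P) \<le> b + ln (c n)" using int_ln by (simp add: P.prob_space)
    moreover have "(\<integral>x. ln (\<rho>n n x) \<partial>P) = (\<integral>x. \<rho> x * ln (\<rho>n n x) \<partial>R)"
      unfolding \<rho>(3) by (subst integral_density) (auto simp: \<rho>(2))
    ultimately show ?thesis by simp
  qed
  \<comment> \<open>Non-negative integrands converging to \<open>ent_fun (\<rho> x)\<close>, as
    Fatou's lemma requires; the added \<open>1 - \<rho> x\<close> integrates to 0.\<close>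
  define q where "q n x = \<rho> x * ln (\<rho>n n x) - \<rho> x + 1" for n x
  have [measurable]: "q n \<in> borel_measurable R" for n unfolding q_def by measurable
  have q_nonneg: "0 \<le> q n x" for n x
  proof -
    let ?N = "real n + 3"
    have N: "0 < 1 / ?N" "1 / ?N \<le> 1" by simp_all
    consider "\<rho> x < 1 / ?N" | "1 / ?N \<le> \<rho> x" "\<rho> x \<le> ?N" | "?N < \<rho> x" by linarith
    then show ?thesis
    proof cases
      case 1
      then have e: "\<rho>n n x = 1 / ?N" by (simp add: \<rho>n_def)
      have "ln (1 / ?N) - 1 \<le> 0" using ln_le_minus_one[OF N(1)] N(2) by linarith
      then have "1 / ?N * (ln (1 / ?N) - 1) \<le> \<rho> x * (ln (1 / ?N) - 1)"
        using 1 by (intro mult_right_mono_neg) auto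
      moreover have "0 \<le> 1 / ?N * (ln (1 / ?N) - 1) + 1"
        using ent_fun_nonneg[of "1 / ?N"] by (simp add: ent_fun_def algebra_simps)
      ultimately show ?thesis unfolding q_def e by (simp add: algebra_simps)
    next
      case 2
      then have "\<rho>n n x = \<rho> x" by (simp add: \<rho>n_def)
      then show ?thesis using ent_fun_nonneg[OF \<rho>(2)[of x]] by (simp add: q_def ent_fun_def)
    next
      case 3
      moreover have "1 / ?N \<le> ?N" using N by linarith
      ultimately have e: "\<rho>n n x = ?N" by (simp add: \<rho>n_def del: divide_le_eq_1_pos)
      have "exp 1 \<le> ?N" using exp_le by linarith
      then have "1 \<le> ln ?N" by (simp add: ln_ge_iff)
      then have "0 \<le> \<rho> x * (ln ?N - 1)" using \<rho>(2) by simp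
      then show ?thesis unfolding q_def e by (simp add: algebra_simps)
    qed
  qed
  have "(\<integral>\<^sup>+x. ennreal (ent_fun (\<rho> x)) \<partial>R) = (\<integral>\<^sup>+x. liminf (\<lambda>n. ennreal (q n x)) \<partial>R)"
  proof (rule nn_integral_cong)
    fix x
    have "\<forall>\<^sub>F n in sequentially. ennreal (q n x) = ennreal (ent_fun (\<rho> x))"
      using ev[of x] by eventually_elim (use \<rho>(2)[of x] in \<open>auto simp: q_def ent_fun_def\<close>)
    then have "(\<lambda>n. ennreal (q n x)) \<longlonglongrightarrow> ennreal (ent_fun (\<rho> x))" by (rule tendsto_eventually)
    then show "ennreal (ent_fun (\<rho> x)) = liminf (\<lambda>n. ennreal (q n x))"
      by (intro lim_imp_Liminf[symmetric]) auto
  qed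
  also have "\<dots> \<le> liminf (\<lambda>n. \<integral>\<^sup>+x. ennreal (q n x) \<partial>R)"
    by (rule nn_integral_liminf) measurable
  also have "\<dots> \<le> liminf (\<lambda>n. ennreal (b + ln (c n)))"
  proof (intro Liminf_mono always_eventually allI)
    fix n
    have "(\<integral>\<^sup>+x. ennreal (q n x) \<partial>R) = ennreal (\<integral>x. q n x \<partial>R)"
      using q_nonneg int_\<rho>ln mass(1) by (intro nn_integral_eq_integral) (auto simp: q_def[abs_def])
    also have "(\<integral>x. q n x \<partial>R) = (\<integral>x. \<rho> x * ln (\<rho>n n x) \<partial>R)"
      unfolding q_def using int_\<rho>ln mass by (simp add: R.prob_space)
    finally show "(\<integral>\<^sup>+x. ennreal (q n x) \<partial>R) \<le> ennreal (b + ln (c n))" using main by (simp add: ennreal_leI)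
  qed
  also have "\<dots> = ennreal b"
  proof (rule lim_imp_Liminf)
    have "(\<lambda>n. b + ln (c n)) \<longlonglongrightarrow> b + ln 1" by (intro tendsto_intros lim_c) simp
    then show "(\<lambda>n. ennreal (b + ln (c n))) \<longlonglongrightarrow> ennreal b" by (intro tendsto_ennrealI) simp
  qed simp
  finally have "enn2ereal (\<integral>\<^sup>+x. ennreal (ent_fun (\<rho> x)) \<partial>R) \<le> enn2ereal (ennreal b)"
    by (simp only: less_eq_ennreal.rep_eq)
  then show ?thesis unfolding rel_entropy_density[OF P R \<rho>] using b0 by (simp add: enn2ereal_ennreal)
qed

text \<open>Strict convexity in the form that uniqueness needs: the average keeps every constraint
  fixing the measure of a set. If its entropy were not below \<open>h\<close>, the non-negative
  midpoint defect would integrate to 0 and the two densities would agree almost everywhere.\<close>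

lemma rel_entropy_midpoint_less:
  assumes P: "prob_space P" and Q: "prob_space Q" and R: "prob_space R"
    and sets: "sets P = sets R" "sets Q = sets R" and ne: "P \<noteq> Q"
    and le: "rel_entropy P R \<le> ereal h" "rel_entropy Q R \<le> ereal h"
  obtains M where "prob_space M" "sets M = sets R"
    "\<And>A. A \<in> sets R \<Longrightarrow> measure M A = (measure P A + measure Q A) / 2" "rel_entropy M R < ereal h"
proof -
  interpret R: prob_space R by fact
  interpret P: prob_space P by fact
  interpret Q: prob_space Q by fact
  have "absolutely_continuous R P" "absolutely_continuous R Q"
    using le rel_entropy_not_ac by force+
  then obtain \<rho> \<sigma> :: "'a \<Rightarrow> real" where
    \<rho>: "\<rho> \<in> borel_measurable R" "\<And>x. 0 \<le> \<rho> x" "P = density R \<rho>" and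
    \<sigma>: "\<sigma> \<in> borel_measurable R" "\<And>x. 0 \<le> \<sigma> x" "Q = density R \<sigma>"
    using absolutely_continuous_real_density[OF P R sets(1)] absolutely_continuous_real_density[OF Q R sets(2)]
    by metis
  note \<rho>(1)[measurable] \<sigma>(1)[measurable]
  define \<tau> where "\<tau> x = (\<rho> x + \<sigma> x) / 2" for x
  have \<tau>: "\<tau> \<in> borel_measurable R" "\<And>x. 0 \<le> \<tau> x"
    using \<rho>(2) \<sigma>(2) unfolding \<tau>_def by auto
  note \<tau>(1)[measurable]
  define M where "M = density R \<tau>"
  have emM: "2 * emeasure M A = emeasure P A + emeasure Q A" if [measurable]: "A \<in> sets R" for A
  proof -
    have "2 * emeasure M A = (\<integral>\<^sup>+x. 2 * (ennreal (\<tau> x) * indicator A x) \<partial>R)"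
      unfolding M_def by (simp add: emeasure_density nn_integral_cmult)
    also have "\<dots> = (\<integral>\<^sup>+x. ennreal (\<rho> x) * indicator A x + ennreal (\<sigma> x) * indicator A x \<partial>R)"
    proof (rule nn_integral_cong)
      fix x
      have "2 * ennreal (\<tau> x) = ennreal (2 * \<tau> x)" by (simp add: ennreal_mult')
      also have "\<dots> = ennreal (\<rho> x) + ennreal (\<sigma> x)" using \<rho>(2) \<sigma>(2) by (simp add: \<tau>_def add_divide_distrib[symmetric] ennreal_plus[symmetric] del: ennreal_plus)
      finally show "2 * (ennreal (\<tau> x) * indicator A x) = ennreal (\<rho> x) * indicator A x + ennreal (\<sigma> x) * indicator A x"
        by (simp add: indicator_def)
    qed
    also have "\<dots> = emeasure P A + emeasure Q A"
      unfolding \<rho>(3) \<sigma>(3) by (simp add: emeasure_density nn_integral_add)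
    finally show ?thesis .
  qed
  have setsM: "sets M = sets R" by (simp add: M_def)
  have spaces: "space P = space R" "space Q = space R" "space M = space R"
    using sets setsM sets_eq_imp_space_eq by blast+
  have "2 * emeasure M (space M) = 2 * 1"
    using emM[of "space R"] P.emeasure_space_1 Q.emeasure_space_1 by (simp add: spaces)
  then have M: "prob_space M"
    by (intro prob_spaceI) (simp only: ennreal_mult_cancel_left, simp)
  then interpret M: prob_space M .
  have "measure M A = (measure P A + measure Q A) / 2" if "A \<in> sets R" for A
  proof -
    have "ennreal (2 * M.prob A) = ennreal (P.prob A + Q.prob A)"
      using emM[OF that] by (simp add: M.emeasure_eq_measure P.emeasure_eq_measure Q.emeasure_eq_measure ennreal_mult')
    then show ?thesis by (simp del: ennreal_plus)
  qed
  moreover have "rel_entropy M R < ereal h"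
  proof (rule ccontr)
    have h0: "0 \<le> h" using rel_entropy_nonneg[OF P R sets(1)] le(1) by (metis ereal_less_eq(5) order_trans)
    have nn_le: "(\<integral>\<^sup>+x. ennreal (ent_fun (\<rho> x)) \<partial>R) \<le> ennreal h" "(\<integral>\<^sup>+x. ennreal (ent_fun (\<sigma> x)) \<partial>R) \<le> ennreal h"
      using le h0 unfolding rel_entropy_density[OF P R \<rho>] rel_entropy_density[OF Q R \<sigma>]
      by (simp_all add: less_eq_ennreal.rep_eq enn2ereal_ennreal)
    then have int: "integrable R (\<lambda>x. ent_fun (\<rho> x))" "integrable R (\<lambda>x. ent_fun (\<sigma> x))"
      using ennreal_less_top by (auto intro!: integrableI_nonneg simp: ent_fun_nonneg \<rho> \<sigma> intro: le_less_trans)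
    have int_le: "(\<integral>x. ent_fun (\<rho> x) \<partial>R) \<le> h" "(\<integral>x. ent_fun (\<sigma> x) \<partial>R) \<le> h"
      using nn_le h0 int by (simp_all add: nn_integral_eq_integral ent_fun_nonneg \<rho>(2) \<sigma>(2) ennreal_le_iff)
    have mid: "2 * ent_fun (\<tau> x) \<le> ent_fun (\<rho> x) + ent_fun (\<sigma> x)" for x
      unfolding \<tau>_def by (rule ent_fun_midpoint(1)[OF \<rho>(2) \<sigma>(2)])
    have int_mid: "integrable R (\<lambda>x. ent_fun (\<tau> x))"
    proof (rule Bochner_Integration.integrable_bound[OF Bochner_Integration.integrable_add[OF int]])
      show "AE x in R. norm (ent_fun (\<tau> x)) \<le> norm (ent_fun (\<rho> x) + ent_fun (\<sigma> x))"
      proof (intro AE_I2)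
        fix x show "norm (ent_fun (\<tau> x)) \<le> norm (ent_fun (\<rho> x) + ent_fun (\<sigma> x))"
          using mid[of x] ent_fun_nonneg[OF \<tau>(2)[of x]] by simp
      qed
    qed measurable
    assume "\<not> rel_entropy M R < ereal h"
    then have "ennreal h \<le> (\<integral>\<^sup>+x. ennreal (ent_fun (\<tau> x)) \<partial>R)"
      unfolding rel_entropy_density[OF M R \<tau> M_def] using h0
      by (simp add: not_less less_eq_ennreal.rep_eq enn2ereal_ennreal)
    also have "\<dots> = ennreal (\<integral>x. ent_fun (\<tau> x) \<partial>R)"
      by (intro nn_integral_eq_integral int_mid) (simp add: ent_fun_nonneg \<tau>)
    finally have "h \<le> (\<integral>x. ent_fun (\<tau> x) \<partial>R)"
      by (subst (asm) ennreal_le_iff) (auto intro!: integral_nonneg_AE simp: ent_fun_nonneg \<tau>)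
    then have "(\<integral>x. ent_fun (\<rho> x) + ent_fun (\<sigma> x) - 2 * ent_fun (\<tau> x) \<partial>R) \<le> 0"
      using int int_mid int_le by simp
    moreover have "0 \<le> (\<integral>x. ent_fun (\<rho> x) + ent_fun (\<sigma> x) - 2 * ent_fun (\<tau> x) \<partial>R)"
      using mid by (intro integral_nonneg_AE) simp
    ultimately have "(\<integral>x. ent_fun (\<rho> x) + ent_fun (\<sigma> x) - 2 * ent_fun (\<tau> x) \<partial>R) = 0" by simp
    then have "AE x in R. ent_fun (\<rho> x) + ent_fun (\<sigma> x) - 2 * ent_fun (\<tau> x) = 0"
      using mid int int_mid by (subst (asm) integral_nonneg_eq_0_iff_AE) auto
    then have "AE x in R. ennreal (\<rho> x) = ennreal (\<sigma> x)"
    proof eventually_elim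
      case (elim x)
      then show ?case using ent_fun_midpoint(2)[OF \<rho>(2) \<sigma>(2), of x x] unfolding \<tau>_def by fastforce
    qed
    then have "P = Q" unfolding \<rho>(3) \<sigma>(3) by (intro density_cong) auto
    then show False using ne by simp
  qed
  ultimately show thesis by (intro that[OF M setsM])
qed

section \<open>Setwise compactness of entropy sublevels, and entropy minimisers\<close>

lemma frequently_conj_eventually:
  "\<exists>\<^sub>F x in F. P x \<Longrightarrow> \<forall>\<^sub>F x in F. Q x \<Longrightarrow> \<exists>\<^sub>F x in F. P x \<and> Q x"
  unfolding frequently_def by (erule contrapos_nn) (erule eventually_rev_mp, erule eventually_mono, blast)

lemma abs_le_all_imp_eq: "(\<And>e. e > 0 \<Longrightarrow> \<bar>x - y\<bar> < c * e) \<Longrightarrow> x = (y::real)"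
proof (rule ccontr)
  assume le: "\<And>e. e > 0 \<Longrightarrow> \<bar>x - y\<bar> < c * e" and "x \<noteq> y"
  have c: "0 < c" using le[of 1] by (smt (verit) mult_cancel_left1)
  from le[of "\<bar>x - y\<bar> / c"] \<open>x \<noteq> y\<close> c show False by simp
qed

text \<open>Turns setwise closeness of measures into closeness of integrals: \<open>g\<close> is
  replaced by a step function on the level sets of the floor of \<open>N * g x\<close>, finitely
  many because \<open>g\<close> is bounded.\<close>

lemma integral_floor_approx:
  fixes g :: "'a \<Rightarrow> real" and N :: nat and B :: real
  assumes M: "prob_space M" and g: "g \<in> borel_measurable M" "\<And>x. \<bar>g x\<bar> \<le> B" and N: "N > 0"
  shows "\<bar>(\<integral>x. g x \<partial>M) - (\<Sum>j\<in>{\<lfloor>- (N * B)\<rfloor>..\<lfloor>N * B\<rfloor>}. j / N * measure M {x \<in> space M. \<lfloor>N * g x\<rfloor> = j})\<bar> \<le> 1 / N"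
proof -
  interpret prob_space M by fact
  note g(1)[measurable]
  let ?J = "{\<lfloor>- (N * B)\<rfloor>..\<lfloor>N * B\<rfloor>}"
  let ?A = "\<lambda>j. {x \<in> space M. \<lfloor>N * g x\<rfloor> = j}"
  have A[measurable]: "?A j \<in> events" for j by measurable
  define s where "s x = (\<Sum>j\<in>?J. j / N * indicator (?A j) x)" for x
  have ints: "integrable M s" unfolding s_def
    by (intro Bochner_Integration.integrable_sum integrable_mult_right integrable_real_indicator A)
      (simp add: emeasure_eq_measure)
  have intg: "integrable M g" using g(2) by (intro integrable_const_bound[of _ B]) auto
  have s_eq: "s x = \<lfloor>N * g x\<rfloor> / N" if x: "x \<in> space M" for x
  proof -
    have "- (N * B) \<le> N * g x" "N * g x \<le> N * B"
      using g(2)[of x] mult_left_mono[of "- B" "g x" "real N"] mult_left_mono[of "g x" B "real N"]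
      by (auto simp: abs_le_iff)
    then have "\<lfloor>N * g x\<rfloor> \<in> ?J" by (auto intro: floor_mono)
    then have "s x = (\<Sum>j\<in>{\<lfloor>N * g x\<rfloor>}. j / N * indicator (?A j) x)"
      unfolding s_def by (intro sum.mono_neutral_right) auto
    then show ?thesis using x by simp
  qed
  have "(\<integral>x. s x \<partial>M) = (\<Sum>j\<in>?J. j / N * prob (?A j))"
    unfolding s_def using A by (simp add: integral_sum emeasure_eq_measure)
  moreover have "\<bar>\<integral>x. g x - s x \<partial>M\<bar> \<le> (\<integral>x. 1 / N \<partial>M)"
  proof (rule order_trans[OF integral_abs_bound integral_mono])
    show "\<bar>g x - s x\<bar> \<le> 1 / N" if "x \<in> space M" for x
    proof -
      have "\<bar>N * g x - \<lfloor>N * g x\<rfloor>\<bar> \<le> 1" by linarith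
      then have "\<bar>N * g x - \<lfloor>N * g x\<rfloor>\<bar> / N \<le> 1 / N" using N by (intro divide_right_mono) auto
      moreover have "\<bar>N * g x - \<lfloor>N * g x\<rfloor>\<bar> / N = \<bar>g x - \<lfloor>N * g x\<rfloor> / N\<bar>"
      proof -
        have "g x - \<lfloor>N * g x\<rfloor> / N = (N * g x - \<lfloor>N * g x\<rfloor>) / N" using N by (simp add: field_simps)
        then show ?thesis by (simp add: abs_divide)
      qed
      ultimately show ?thesis using s_eq[OF that] by simp
    qed
  qed (use ints intg in auto)
  ultimately show ?thesis using ints intg by (simp add: prob_space)
qed

text \<open>Donsker-Varadhan for a multiple of an indicator, normalised by its exponential integral
  \<open>z\<close> and simplified by \<open>ln z \<le> z - 1\<close>. The bound is uniform over all
  measures of entropy at most \<open>a\<close>, so sets of small \<open>R\<close>-measure have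
  uniformly small \<open>P\<close>-measure.\<close>

lemma measure_le_rel_entropy:
  assumes P: "prob_space P" and R: "prob_space R" and sets: "sets P = sets R"
    and le: "rel_entropy P R \<le> ereal a" and A: "A \<in> sets R" and t: "t > 0"
  shows "t * measure P A \<le> a + (exp t - 1) * measure R A"
proof -
  interpret R: prob_space R by fact
  interpret P: prob_space P by fact
  note A[measurable]
  define z where "z = 1 + (exp t - 1) * R.prob A"
  have z: "z \<ge> 1" using t by (simp add: z_def)
  define g where "g x = t * indicator A x - ln z" for x
  have "exp (g x) = (1 + (exp t - 1) * indicator A x) / z" for x
    using z by (cases "x \<in> A") (simp_all add: g_def exp_diff exp_minus inverse_eq_divide)
  then have "(\<integral>x. exp (g x) \<partial>R) = (\<integral>x. (1 + (exp t - 1) * indicator A x) / z \<partial>R)" by simp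
  also have "\<dots> = (1 + (exp t - 1) * R.prob A) / z"
    using A by (simp add: R.prob_space R.emeasure_eq_measure)
  also have "\<dots> = 1" using z by (simp add: z_def)
  finally have "ereal (\<integral>x. g x \<partial>P) \<le> rel_entropy P R"
    using t by (intro integral_le_rel_entropy[OF P R sets, of _ "t + \<bar>ln z\<bar>"])
      (auto simp: g_def indicator_def)
  then have "(\<integral>x. g x \<partial>P) \<le> a" using le by (metis ereal_less_eq(3) order_trans)
  moreover have "(\<integral>x. g x \<partial>P) = t * P.prob A - ln z"
    unfolding g_def using A sets by (simp add: P.prob_space P.emeasure_eq_measure)
  moreover have "ln z \<le> z - 1" using z by (intro ln_le_minus_one) simp
  ultimately show ?thesis unfolding z_def by simp
qed

text \<open>Setwise cluster points inherit finite additivity. Countable additivity follows because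
  \<open>measure_le_rel_entropy\<close> passes to the limit, and the entropy bound because
  \<open>rel_entropy_leI\<close> tests it by integrals of bounded functions. Working with all
  measurable sets preserves marginal constraints verbatim.\<close>

lemma rel_entropy_sublevel_cluster:
  fixes P :: "'k \<Rightarrow> 'e measure"
  assumes R: "prob_space R" and F: "F \<noteq> bot"
    and good: "\<forall>\<^sub>F k in F. prob_space (P k) \<and> sets (P k) = sets R \<and> rel_entropy (P k) R \<le> ereal a"
  shows "\<exists>Q. prob_space Q \<and> sets Q = sets R \<and>
    (\<forall>A\<in>sets R. \<forall>e>0. \<exists>\<^sub>F k in F. \<bar>measure (P k) A - measure Q A\<bar> < e) \<and>
    (\<forall>b. (\<forall>\<^sub>F k in F. rel_entropy (P k) R \<le> ereal b) \<longrightarrow> rel_entropy Q R \<le> ereal b)"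
proof -
  interpret R: prob_space R by fact
  let ?good = "\<lambda>k. prob_space (P k) \<and> sets (P k) = sets R \<and> rel_entropy (P k) R \<le> ereal a"
  have "\<forall>\<^sub>F k in F. \<forall>A. \<bar>measure (P k) A\<bar> \<le> 1"
    using good by eventually_elim (auto simp: prob_space.prob_le_1)
  from cluster_of_bounded_family[OF F this]
  obtain c where "\<forall>I e. finite I \<longrightarrow> e > 0 \<longrightarrow> (\<exists>\<^sub>F k in F. \<forall>A\<in>I. \<bar>measure (P k) A - c A\<bar> < e)" ..
  then have c0: "\<exists>\<^sub>F k in F. \<forall>A\<in>I. \<bar>measure (P k) A - c A\<bar> < e" if "finite I" "e > 0" for I e
    using that by simp
  have c: "\<exists>k. (\<forall>A\<in>I. \<bar>measure (P k) A - c A\<bar> < e) \<and> ?good k \<and> T k"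
    if "finite I" "e > 0" "eventually T F" for I e T
    using frequently_ex[OF frequently_conj_eventually[OF c0[OF that(1,2)] eventually_conj[OF good that(3)]]] .
  have c_nonneg: "0 \<le> c A" for A
  proof (rule field_le_epsilon)
    fix e :: real assume "e > 0"
    then obtain k where "\<bar>measure (P k) A - c A\<bar> < e" using c[of "{A}" e "\<lambda>_. True"] by auto
    then show "0 \<le> c A + e" using measure_nonneg[of "P k" A] by linarith
  qed
  have c_space: "c (space R) = 1"
  proof (rule abs_le_all_imp_eq[where c = 1])
    fix e :: real assume "e > 0"
    then obtain k where k: "\<bar>measure (P k) (space R) - c (space R)\<bar> < e" "?good k"
      using c[of "{space R}" e "\<lambda>_. True"] by auto
    then have "space (P k) = space R" using sets_eq_imp_space_eq by blast
    then have "measure (P k) (space R) = 1" using k prob_space.prob_space by metis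
    then show "\<bar>c (space R) - 1\<bar> < 1 * e" using k by (simp add: abs_minus_commute)
  qed
  have c_add: "c (A \<union> B) = c A + c B" if AB: "A \<in> sets R" "B \<in> sets R" "A \<inter> B = {}" for A B
  proof (rule abs_le_all_imp_eq[where c = 3])
    fix e :: real assume "e > 0"
    then obtain k where k: "\<bar>measure (P k) (A \<union> B) - c (A \<union> B)\<bar> < e" "\<bar>measure (P k) A - c A\<bar> < e"
      "\<bar>measure (P k) B - c B\<bar> < e" "?good k"
      using c[of "{A \<union> B, A, B}" e "\<lambda>_. True"] by auto
    interpret Pk: prob_space "P k" using k by simp
    have "measure (P k) (A \<union> B) = measure (P k) A + measure (P k) B"
      using AB k by (intro Pk.finite_measure_Union) auto
    then show "\<bar>c (A \<union> B) - (c A + c B)\<bar> < 3 * e" using k by linarith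
  qed
  have c_bound: "t * c A \<le> a + (exp t - 1) * R.prob A" if A: "A \<in> sets R" and t: "t > 0" for A t
  proof (rule field_le_epsilon)
    fix e :: real assume "e > 0"
    then obtain k where k: "\<bar>measure (P k) A - c A\<bar> < e / t" "?good k"
      using c[of "{A}" "e / t" "\<lambda>_. True"] t by auto
    then have "t * c A \<le> t * (measure (P k) A + e / t)" using t by (intro mult_left_mono) auto
    also have "\<dots> = t * measure (P k) A + e" using t by (simp add: field_simps)
    also have "t * measure (P k) A \<le> a + (exp t - 1) * R.prob A"
      using k by (intro measure_le_rel_entropy[OF _ R _ _ A t]) auto
    finally show "t * c A \<le> a + (exp t - 1) * R.prob A + e" by simp
  qed
  define Q where "Q = measure_of (space R) (sets R) (\<lambda>A. ennreal (c A))"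
  have c_empty: "c {} = 0" using c_add[of "{}" "{}"] by simp
  have pos: "positive (sets R) (\<lambda>A. ennreal (c A))"
    by (simp add: positive_def c_empty)
  have ca: "countably_additive (sets R) (\<lambda>A. ennreal (c A))"
  proof (rule sets.empty_continuous_imp_countably_additive[OF pos])
    show "additive (sets R) (\<lambda>A. ennreal (c A))"
      by (auto simp: additive_def c_add c_nonneg)
  next
    fix A :: "nat \<Rightarrow> 'e set" assume A: "range A \<subseteq> sets R" "decseq A" "(\<Inter>i. A i) = {}"
    have limR: "(\<lambda>i. R.prob (A i)) \<longlonglongrightarrow> 0"
      using R.finite_Lim_measure_decseq[OF A(1,2)] A(3) by simp
    have "(\<lambda>i. c (A i)) \<longlonglongrightarrow> 0"
    proof (rule tendstoI)
      fix e :: real assume e: "e > 0"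
      \<comment> \<open>Chosen so that \<open>(\<bar>a\<bar> + 1) / t\<close> equals
        \<open>e\<close>.\<close>
      define t where "t = (\<bar>a\<bar> + 1) / e"
      have t: "t > 0" using e by (simp add: t_def)
      have "(\<lambda>i. (exp t - 1) * R.prob (A i)) \<longlonglongrightarrow> (exp t - 1) * 0" by (intro tendsto_intros limR)
      then have "\<forall>\<^sub>F i in sequentially. (exp t - 1) * R.prob (A i) < 1" by (rule order_tendstoD) simp
      then show "\<forall>\<^sub>F i in sequentially. dist (c (A i)) 0 < e"
      proof eventually_elim
        case (elim i)
        have "t * c (A i) \<le> a + (exp t - 1) * R.prob (A i)" using A t by (intro c_bound) auto
        then have "t * c (A i) < \<bar>a\<bar> + 1" using elim by linarith
        also have "\<bar>a\<bar> + 1 = t * e" using e by (simp add: t_def)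
        finally show ?case using t c_nonneg[of "A i"] by simp
      qed
    qed
    then show "(\<lambda>i. ennreal (c (A i))) \<longlonglongrightarrow> 0" using tendsto_ennrealI by fastforce
  qed auto
  have setsQ: "sets Q = sets R" and spaceQ: "space Q = space R" by (simp_all add: Q_def)
  have emQ: "emeasure Q A = ennreal (c A)" if "A \<in> sets R" for A
    unfolding Q_def using emeasure_measure_of_sigma[OF sets.sigma_algebra_axioms pos ca that] .
  have probQ: "prob_space Q"
    by (rule prob_spaceI) (simp add: spaceQ emQ c_space)
  then interpret Q: prob_space Q .
  have Q_c: "measure Q A = c A" if "A \<in> sets R" for A
    using emQ[OF that] c_nonneg by (simp add: Q.emeasure_eq_measure)
  show ?thesis
  proof (intro exI[of _ Q] conjI ballI allI impI probQ setsQ)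
    show "\<exists>\<^sub>F k in F. \<bar>measure (P k) A - measure Q A\<bar> < e" if "A \<in> sets R" "e > 0" for A e
      using c0[of "{A}" e] that by (simp add: Q_c)
  next
    fix b assume b: "\<forall>\<^sub>F k in F. rel_entropy (P k) R \<le> ereal b"
    show "rel_entropy Q R \<le> ereal b"
    proof (rule rel_entropy_leI[OF probQ R setsQ])
      fix g :: "'e \<Rightarrow> real" and B
      assume g: "g \<in> borel_measurable R" "\<And>x. \<bar>g x\<bar> \<le> B" and exp: "(\<integral>x. exp (g x) \<partial>R) \<le> 1"
      note g(1)[measurable]
      show "(\<integral>x. g x \<partial>Q) \<le> b"
      proof (rule field_le_epsilon)
        fix e :: real assume e: "e > 0"
        then obtain n where "1 / real (Suc n) < e / 3" using nat_approx_posE[of "e / 3"] by auto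
        then obtain N :: nat where N: "N > 0" "1 / N < e / 3" by blast
        define J where "J = {\<lfloor>- (N * B)\<rfloor>..\<lfloor>N * B\<rfloor>}"
        define A where "A j = {x \<in> space R. \<lfloor>N * g x\<rfloor> = j}" for j
        have A: "A j \<in> sets R" for j unfolding A_def by measurable
        \<comment> \<open>The total weight of the level coefficients, plus 1 to permit division by
          it. One third of \<open>e\<close> is spent on the measures of the level sets, the other
          two on the floor approximations under \<open>Q\<close> and under
          \<open>P k\<close>.\<close>
        define w where "w = 1 + (\<Sum>j\<in>J. \<bar>j / N\<bar>)"
        have w1: "(\<Sum>j\<in>J. \<bar>j / N\<bar>) = w - 1" by (simp add: w_def)
        have w: "w > 0" unfolding w_def by (intro add_pos_nonneg sum_nonneg) auto
        have "finite (A ` J)" "e / 3 / w > 0" using e w by (simp_all add: J_def)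
        from c[OF this b] obtain k where k: "\<forall>j\<in>J. \<bar>measure (P k) (A j) - c (A j)\<bar> < e / 3 / w" "?good k"
          "rel_entropy (P k) R \<le> ereal b"
          by blast
        have approx: "\<bar>(\<integral>x. g x \<partial>M) - (\<Sum>j\<in>J. j / N * measure M (A j))\<bar> \<le> 1 / N"
          if "prob_space M" "sets M = sets R" for M
        proof -
          have "space M = space R" using that sets_eq_imp_space_eq by blast
          moreover have "g \<in> borel_measurable M" using g(1) measurable_cong_sets[OF that(2) refl] by blast
          ultimately show ?thesis
            using integral_floor_approx[of M g B N] that(1) g(2) N(1) by (simp add: J_def A_def)
        qed
        have "(\<Sum>j\<in>J. j / N * measure Q (A j)) - (\<Sum>j\<in>J. j / N * measure (P k) (A j))
            = (\<Sum>j\<in>J. j / N * (c (A j) - measure (P k) (A j)))"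
          by (simp add: sum_subtractf Q_c A right_diff_distrib)
        also have "\<dots> \<le> (\<Sum>j\<in>J. \<bar>j / N\<bar> * (e / 3 / w))"
        proof (rule sum_mono)
          fix j assume j: "j \<in> J"
          have "j / N * (c (A j) - measure (P k) (A j)) \<le> \<bar>j / N\<bar> * \<bar>c (A j) - measure (P k) (A j)\<bar>"
            by (metis abs_ge_self abs_mult)
          also have "\<dots> \<le> \<bar>j / N\<bar> * (e / 3 / w)"
            using k(1) j by (intro mult_left_mono) (auto simp: abs_minus_commute)
          finally show "j / N * (c (A j) - measure (P k) (A j)) \<le> \<bar>j / N\<bar> * (e / 3 / w)" .
        qed
        also have "\<dots> = (w - 1) * (e / 3 / w)" by (simp only: sum_distrib_right[symmetric] w1)
        also have "\<dots> \<le> w * (e / 3 / w)" using e w by (intro mult_right_mono) auto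
        also have "\<dots> = e / 3" using w by simp
        finally have d: "(\<Sum>j\<in>J. j / N * measure Q (A j)) - (\<Sum>j\<in>J. j / N * measure (P k) (A j)) \<le> e / 3" .
        have "ereal (\<integral>x. g x \<partial>P k) \<le> rel_entropy (P k) R"
          using k(2) g exp by (intro integral_le_rel_entropy[OF _ R]) auto
        then have "(\<integral>x. g x \<partial>P k) \<le> b" using k(3) by (metis ereal_less_eq(3) order_trans)
        then show "(\<integral>x. g x \<partial>Q) \<le> b + e"
          using approx[OF probQ setsQ] approx[of "P k"] k(2) d N(2) by linarith
      qed
    qed
  qed
qed

text \<open>The direct method. Constraints that fix the measures of given sets are stable under
  setwise limits and under averaging, so a minimising sequence clusters at a minimiser and
  \<open>rel_entropy_midpoint_less\<close> excludes a second one. Prescribed marginals are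
  constraints of this kind.\<close>

lemma entropy_minimizer_ex1:
  fixes R :: "'e measure" and S :: "('e set \<times> real) set"
  defines "K \<equiv> {P. prob_space P \<and> sets P = sets R \<and> (\<forall>(A, v)\<in>S. measure P A = v)}"
  assumes R: "prob_space R" and S: "\<And>A v. (A, v) \<in> S \<Longrightarrow> A \<in> sets R"
    and fin: "P0 \<in> K" "rel_entropy P0 R < \<infinity>"
  shows "\<exists>!P. is_arg_min (\<lambda>P. rel_entropy P R) (\<lambda>P. P \<in> K) P"
proof -
  define m where "m = (INF P\<in>K. rel_entropy P R)"
  have "0 \<le> m" unfolding m_def using R by (intro INF_greatest rel_entropy_nonneg) (auto simp: K_def)
  moreover have "m < \<infinity>" unfolding m_def using INF_lower[OF fin(1)] fin(2) by (rule le_less_trans)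
  ultimately obtain r where r: "m = ereal r" by (cases m) auto
  have "\<exists>P\<in>K. rel_entropy P R < ereal (r + 1 / real (Suc n))" for n
  proof -
    have "m < ereal (r + 1 / real (Suc n))" by (simp add: r)
    then show ?thesis unfolding m_def by (simp add: INF_less_iff)
  qed
  then obtain P where P: "\<And>n. P n \<in> K" "\<And>n. rel_entropy (P n) R < ereal (r + 1 / real (Suc n))" by metis
  have ev: "\<forall>\<^sub>F n in sequentially. rel_entropy (P n) R \<le> ereal (r + e)" if e: "e > 0" for e
  proof -
    have "\<forall>\<^sub>F n in sequentially. 1 / real (Suc n) < e"
      using LIMSEQ_Suc[OF lim_inverse_n'] e by (rule order_tendstoD)
    then show ?thesis
    proof eventually_elim
      case (elim n)
      have "ereal (r + 1 / real (Suc n)) \<le> ereal (r + e)" using elim by simp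
      then show ?case using less_imp_le[OF P(2)[of n]] by (rule order_trans[rotated])
    qed
  qed
  have "\<forall>\<^sub>F n in sequentially. prob_space (P n) \<and> sets (P n) = sets R \<and> rel_entropy (P n) R \<le> ereal (r + 1)"
    using ev[of 1] P(1) by (auto simp: K_def)
  from rel_entropy_sublevel_cluster[OF R sequentially_bot this]
  obtain Q where Q: "prob_space Q" "sets Q = sets R"
    "\<forall>A\<in>sets R. \<forall>e>0. \<exists>\<^sub>F k in sequentially. \<bar>measure (P k) A - measure Q A\<bar> < e"
    "\<forall>b. (\<forall>\<^sub>F k in sequentially. rel_entropy (P k) R \<le> ereal b) \<longrightarrow> rel_entropy Q R \<le> ereal b" by blast
  have QK: "Q \<in> K"
  proof -
    have "measure Q A = v" if Av: "(A, v) \<in> S" for A v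
    proof (rule abs_le_all_imp_eq[where c = 1])
      fix e :: real assume "e > 0"
      then obtain k where "\<bar>measure (P k) A - measure Q A\<bar> < e"
        using Q(3) S[OF Av] frequently_ex by meson
      moreover have "measure (P k) A = v" using P(1)[of k] Av by (auto simp: K_def)
      ultimately show "\<bar>measure Q A - v\<bar> < 1 * e" by (simp add: abs_minus_commute)
    qed
    then show ?thesis using Q(1,2) by (auto simp: K_def)
  qed
  have HQ: "rel_entropy Q R \<le> m" unfolding r
  proof (rule ereal_le_epsilon2)
    fix e :: real assume "0 < e"
    then show "rel_entropy Q R \<le> ereal r + ereal e" using Q(4) ev[of e] by simp
  qed
  have min: "is_arg_min (\<lambda>P. rel_entropy P R) (\<lambda>P. P \<in> K) P \<longleftrightarrow> P \<in> K \<and> rel_entropy P R \<le> m" for P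
  proof
    assume *: "is_arg_min (\<lambda>P. rel_entropy P R) (\<lambda>P. P \<in> K) P"
    then have "rel_entropy P R \<le> rel_entropy Q R" using QK by (auto simp: is_arg_min_def not_less)
    then show "P \<in> K \<and> rel_entropy P R \<le> m" using * HQ by (auto simp: is_arg_min_def)
  next
    assume *: "P \<in> K \<and> rel_entropy P R \<le> m"
    have "m \<le> rel_entropy P' R" if "P' \<in> K" for P' unfolding m_def using that by (rule INF_lower)
    then show "is_arg_min (\<lambda>P. rel_entropy P R) (\<lambda>P. P \<in> K) P"
      using * by (auto simp: is_arg_min_def not_less intro: order_trans)
  qed
  show ?thesis unfolding min
  proof (rule ex1I[of _ Q])
    show "Q \<in> K \<and> rel_entropy Q R \<le> m" using QK HQ by simp
  next
    fix P assume P: "P \<in> K \<and> rel_entropy P R \<le> m"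
    show "P = Q"
    proof (rule ccontr)
      assume "P \<noteq> Q"
      moreover have "prob_space P" "sets P = sets R" "rel_entropy P R \<le> ereal r" "rel_entropy Q R \<le> ereal r"
        using P HQ by (auto simp: K_def r)
      ultimately obtain M where M: "prob_space M" "sets M = sets R"
        "\<And>A. A \<in> sets R \<Longrightarrow> measure M A = (measure P A + measure Q A) / 2" "rel_entropy M R < ereal r"
        using rel_entropy_midpoint_less[OF _ Q(1) R _ Q(2)] by metis
      have "measure M A = v" if "(A, v) \<in> S" for A v
      proof -
        have "measure P A = v" "measure Q A = v" using that P QK by (auto simp: K_def)
        then show ?thesis using M(3)[OF S[OF that]] by simp
      qed
      then have "M \<in> K" using M by (auto simp: K_def)
      then have "m \<le> rel_entropy M R" unfolding m_def by (rule INF_lower)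
      then show False using M(4) by (simp add: r)
    qed
  qed
qed

section \<open>Exponential upper bounds\<close>

lemma LDP_D:
  assumes "LDP \<gamma> I"
  shows "\<And>k. k \<ge> 1 \<Longrightarrow> \<gamma> k \<in> Prob"
    and "\<And>A. A \<in> sets borel \<Longrightarrow>
      - (INF x\<in>interior A. enn2ereal (I x)) \<le> liminf (\<lambda>k. ereal (1 / real k) * log_prob (\<gamma> k) A)"
    and "\<And>A. A \<in> sets borel \<Longrightarrow>
      limsup (\<lambda>k. ereal (1 / real k) * log_prob (\<gamma> k) A) \<le> - (INF x\<in>closure A. enn2ereal (I x))"
  using assms unfolding LDP_def by blast+

lemma LDP_closed_upper:
  assumes ldp: "LDP \<gamma> I" and F: "closed F" and c: "\<And>x. x \<in> F \<Longrightarrow> ereal c \<le> enn2ereal (I x)" and e: "e > 0"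
  shows "\<forall>\<^sub>F k in sequentially. measure (\<gamma> k) F \<le> exp (- (real k * (c - e)))"
proof -
  have "limsup (\<lambda>k. ereal (1 / real k) * log_prob (\<gamma> k) F) \<le> - (INF x\<in>F. enn2ereal (I x))"
    using LDP_D(3)[OF ldp, of F] F by simp
  also have "\<dots> \<le> - ereal c" unfolding ereal_minus_le_minus by (intro INF_greatest c)
  also have "\<dots> < ereal (- (c - e))" using e by simp
  finally have "\<forall>\<^sub>F k in sequentially. ereal (1 / real k) * log_prob (\<gamma> k) F < ereal (- (c - e))"
    by (rule Limsup_lessD)
  then show ?thesis using eventually_ge_at_top[of 1]
  proof eventually_elim
    case (elim k)
    show ?case
    proof (cases "measure (\<gamma> k) F = 0")
      case False
      then have m: "measure (\<gamma> k) F > 0" by (simp add: zero_less_measure_iff)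
      have "ln (measure (\<gamma> k) F) / real k < - (c - e)" using elim False by (simp add: log_prob_def)
      then have "ln (measure (\<gamma> k) F) \<le> - (real k * (c - e))" using elim(2) by (simp add: field_simps)
      then show ?thesis using m by (metis exp_le_cancel_iff exp_ln)
    qed simp
  qed
qed

text \<open>The upper half of Varadhan's lemma. The range of \<open>f\<close> is cut into
  \<open>N\<close> slabs of height \<open>d = e / 3\<close>: one \<open>d\<close> is the height of a
  slab, one is lost in the large deviation estimate of its mass, and one absorbs the factor
  \<open>N\<close> for large k.\<close>

lemma LDP_exp_integral_upper:
  fixes f :: "'e::topological_space \<Rightarrow> real"
  assumes ldp: "LDP \<gamma> I" and f: "f \<in> bcontfun" and le: "\<And>x. ereal (f x - M) \<le> enn2ereal (I x)" and e: "e > 0"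
  shows "\<forall>\<^sub>F k in sequentially. (\<integral>x. exp (real k * f x) \<partial>\<gamma> k) \<le> exp (real k * (M + e))"
proof -
  obtain B where B: "B > 0" "\<And>x. \<bar>f x\<bar> \<le> B" using bcontfun_bound[OF f] by metis
  define d where "d = e / 3"
  have d: "d > 0" using e by (simp add: d_def)
  define N where "N = nat \<lceil>2 * B / d\<rceil> + 1"
  define c where "c i = - B + real i * d" for i :: nat
  define F where "F i = {x. c i \<le> f x \<and> f x \<le> c i + d}" for i
  have cont: "continuous_on UNIV f" using f by (simp add: bcontfun_def)
  have F_closed: "closed (F i)" for i
    unfolding F_def by (intro closed_Collect_conj closed_Collect_le continuous_intros cont)
  have cover: "\<exists>i<N. x \<in> F i" for x
  proof -
    have fx: "- B \<le> f x" "f x \<le> B" using B(2)[of x] by linarith+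
    define i where "i = nat \<lfloor>(f x + B) / d\<rfloor>"
    have "0 \<le> (f x + B) / d" using fx d by simp
    then have i: "real i \<le> (f x + B) / d" "(f x + B) / d \<le> real i + 1" unfolding i_def by linarith+
    have "(f x + B) / d \<le> 2 * B / d" using fx d by (intro divide_right_mono) auto
    then have "i < N" using i(1) unfolding N_def by linarith
    moreover have "x \<in> F i" using i d unfolding F_def c_def by (auto simp: field_simps)
    ultimately show ?thesis by blast
  qed
  have "\<forall>\<^sub>F k in sequentially. \<forall>i\<in>{..<N}. measure (\<gamma> k) (F i) \<le> exp (- (real k * (c i - M - d)))"
  proof (rule eventually_ball_finite, safe)
    fix i
    have "ereal (c i - M) \<le> enn2ereal (I x)" if "x \<in> F i" for x
    proof -
      have "ereal (c i - M) \<le> ereal (f x - M)" using that by (simp add: F_def)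
      then show ?thesis using le by (rule order_trans)
    qed
    then show "\<forall>\<^sub>F k in sequentially. measure (\<gamma> k) (F i) \<le> exp (- (real k * (c i - M - d)))"
      by (rule LDP_closed_upper[OF ldp F_closed _ d])
  qed
  moreover have "\<forall>\<^sub>F k in sequentially. ln (real N) \<le> real k * d"
  proof -
    obtain k0 :: nat where "ln (real N) < real k0 * d" using d reals_Archimedean3 by blast
    moreover have "real k0 * d \<le> real k * d" if "k \<ge> k0" for k using that d by simp
    ultimately show ?thesis by (intro eventually_mono[OF eventually_ge_at_top[of k0]]) (meson less_le_trans less_imp_le)
  qed
  ultimately show ?thesis using eventually_ge_at_top[of 1]
  proof eventually_elim
    case (elim k)
    have P: "\<gamma> k \<in> Prob" using LDP_D(1)[OF ldp elim(3)] .
    interpret prob_space "\<gamma> k" using ProbD[OF P] by simp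
    have F_sets: "F i \<in> events" for i using F_closed ProbD(2)[OF P] by simp
    have "(\<integral>x. exp (real k * f x) \<partial>\<gamma> k) \<le> (\<integral>x. (\<Sum>i<N. exp (real k * (c i + d)) * indicator (F i) x) \<partial>\<gamma> k)"
    proof (rule integral_mono)
      have "real k * f x \<le> real k * B" for x using B(2)[of x] by (intro mult_left_mono) auto
      then show "integrable (\<gamma> k) (\<lambda>x. exp (real k * f x))"
        using bcontfun_measurable[OF f]
        by (intro integrable_const_bound[of _ "exp (real k * B)"]) (auto simp: measurable_Prob[OF P])
      show "integrable (\<gamma> k) (\<lambda>x. \<Sum>i<N. exp (real k * (c i + d)) * indicator (F i) x)"
        using F_sets by (intro Bochner_Integration.integrable_sum integrable_mult_right integrable_real_indicator)
          (auto simp: emeasure_eq_measure)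
      fix x
      obtain i where i: "i < N" "x \<in> F i" using cover by blast
      have "exp (real k * f x) \<le> exp (real k * (c i + d)) * indicator (F i) x"
        using i(2) by (simp add: F_def mult_left_mono)
      also have "\<dots> \<le> (\<Sum>i<N. exp (real k * (c i + d)) * indicator (F i) x)"
        using i(1) by (intro member_le_sum) auto
      finally show "exp (real k * f x) \<le> (\<Sum>i<N. exp (real k * (c i + d)) * indicator (F i) x)" .
    qed
    also have "\<dots> = (\<Sum>i<N. exp (real k * (c i + d)) * prob (F i))"
      using F_sets by (subst Bochner_Integration.integral_sum) (auto simp: emeasure_eq_measure)
    also have "\<dots> \<le> (\<Sum>i<N. exp (real k * (c i + d)) * exp (- (real k * (c i - M - d))))"
      using elim(1) by (intro sum_mono mult_left_mono) auto
    also have "\<dots> = real N * exp (real k * (M + 2 * d))"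
      by (simp add: exp_add[symmetric] algebra_simps)
    also have "\<dots> \<le> exp (real k * d) * exp (real k * (M + 2 * d))"
    proof (rule mult_right_mono)
      have "N > 0" by (simp add: N_def)
      then show "real N \<le> exp (real k * d)" using elim(2) by (metis exp_le_cancel_iff exp_ln of_nat_0_less_iff)
    qed simp
    also have "\<dots> = exp (real k * (M + e))" by (simp add: exp_add[symmetric] d_def algebra_simps)
    finally show ?case .
  qed
qed

section \<open>Marginals at the two end points\<close>

lemma marginal_Prob:
  assumes "t \<in> {0, 1}" "P \<in> Prob"
  shows "marginal t P \<in> Prob"
proof -
  interpret prob_space P using ProbD[OF assms(2)] by simp
  have "(\<lambda>\<omega>. cpath \<omega> t) \<in> P \<rightarrow>\<^sub>M borel" using endpoint_measurable[OF assms(1)] measurable_Prob[OF assms(2)] by blast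
  then show ?thesis unfolding marginal_def by (intro ProbI prob_space_distr) auto
qed

text \<open>Time changes fix 0 and 1, so evaluation there is continuous for the Skorokhod metric; at
  interior times it is not in general, hence the restriction on \<open>t\<close>.\<close>

lemma bcontfun_endpoint:
  fixes h :: "'a::metric_space \<Rightarrow> real"
  assumes "h \<in> bcontfun" "t \<in> {0, 1}"
  shows "(\<lambda>\<omega>. h (cpath \<omega> t)) \<in> bcontfun"
proof -
  obtain B where B: "\<And>x. \<bar>h x\<bar> \<le> B" using bcontfun_bound[OF assms(1)] by metis
  have "continuous_on UNIV (\<lambda>\<omega> :: 'a cadlag. cpath \<omega> t)"
    unfolding continuous_on_iff using dist_endpoint_le[OF assms(2)] by (meson le_less_trans)
  then have "continuous_on UNIV (\<lambda>\<omega>. h (cpath \<omega> t))"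
    using assms(1) continuous_on_compose2[of UNIV h UNIV "\<lambda>\<omega>. cpath \<omega> t"] by (auto simp: bcontfun_def)
  then show ?thesis using B by (rule bcontfunI)
qed

lemma integral_marginal:
  fixes h :: "'a::metric_space \<Rightarrow> real"
  assumes "h \<in> borel_measurable borel" "t \<in> {0, 1}" "P \<in> Prob"
  shows "(\<integral>x. h x \<partial>marginal t P) = (\<integral>\<omega>. h (cpath \<omega> t) \<partial>P)"
  unfolding marginal_def using endpoint_measurable[OF assms(2)] assms
  by (intro integral_distr) (auto simp: measurable_Prob)

text \<open>Division by 0 makes this 0 at \<open>k = 0\<close>, so boundedness and measurability
  hold for every \<open>k\<close> without a side condition.\<close>

definition log_mgf :: "(nat \<Rightarrow> 'a \<Rightarrow> 'e measure) \<Rightarrow> nat \<Rightarrow> ('e \<Rightarrow> real) \<Rightarrow> 'a \<Rightarrow> real" where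
  "log_mgf R k f x = ln (\<integral>\<omega>. exp (real k * f \<omega>) \<partial>R k x) / real k"

section \<open>Kernels with large deviations and their logarithmic moment generating
  functions\<close>

locale ldp_kernel =
  fixes C :: "'a::polish_space cadlag \<Rightarrow> ennreal"
    and R :: "nat \<Rightarrow> 'a \<Rightarrow> 'a cadlag measure"
  assumes C_lsc: "lower_semicont C"
    and kernel: "\<And>k. k \<ge> 1 \<Longrightarrow> R k \<in> borel \<rightarrow>\<^sub>M prob_algebra borel"
    and start: "\<And>k x. k \<ge> 1 \<Longrightarrow> measure (R k x) {\<omega>. cpath \<omega> 0 = x} = 1"
    and coercive: "\<And>x. coercive (\<lambda>\<omega>. C \<omega> + convex_indicator {\<omega>. cpath \<omega> 0 = x} \<omega>)"
    and ldp: "\<And>x. LDP (\<lambda>k. R k x) (\<lambda>\<omega>. C \<omega> + convex_indicator {\<omega>. cpath \<omega> 0 = x} \<omega>)"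
begin

abbreviation rate :: "'a \<Rightarrow> 'a cadlag \<Rightarrow> ennreal" where
  "rate x \<omega> \<equiv> C \<omega> + convex_indicator {\<omega>. cpath \<omega> 0 = x} \<omega>"

lemma R_Prob: "k \<ge> 1 \<Longrightarrow> R k x \<in> Prob"
  using measurable_space[OF kernel, of k x] by simp

lemma R_subprob: "k \<ge> 1 \<Longrightarrow> R k \<in> borel \<rightarrow>\<^sub>M subprob_algebra borel"
  by (rule measurable_prob_algebraD[OF kernel])

lemma AE_start: "k \<ge> 1 \<Longrightarrow> AE \<omega> in R k x. cpath \<omega> 0 = x"
  using prob_space.AE_prob_1[OF ProbD(1)[OF R_Prob] start] by auto

lemma bind_Prob: "k \<ge> 1 \<Longrightarrow> \<mu> \<in> Prob \<Longrightarrow> \<mu> \<bind> R k \<in> Prob"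
  using prob_space_bind'[OF _ kernel] sets_bind'[OF _ kernel] by (intro ProbI) auto

context
  fixes f :: "'a cadlag \<Rightarrow> real" and B :: real
  assumes f: "f \<in> borel_measurable borel" "\<And>\<omega>. \<bar>f \<omega>\<bar> \<le> B"
begin

lemma mgf_integrable:
  assumes "k \<ge> 1" shows "integrable (R k x) (\<lambda>\<omega>. exp (real k * f \<omega>))"
proof (rule integrable_bounded_Prob[OF R_Prob[OF assms]])
  show "\<bar>exp (real k * f \<omega>)\<bar> \<le> exp (real k * B)" for \<omega>
    using f(2)[of \<omega>] by (simp add: mult_left_mono)
qed (use f(1) in measurable)

lemma mgf_bounds:
  assumes "k \<ge> 1"
  shows "exp (- (real k * B)) \<le> (\<integral>\<omega>. exp (real k * f \<omega>) \<partial>R k x)" "(\<integral>\<omega>. exp (real k * f \<omega>) \<partial>R k x) \<le> exp (real k * B)"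
proof -
  have "exp (- (real k * B)) \<le> exp (real k * f \<omega>)" "exp (real k * f \<omega>) \<le> exp (real k * B)" for \<omega>
    using f(2)[of \<omega>] mult_left_mono[of "- B" "f \<omega>" "real k"] by (simp_all add: mult_left_mono abs_le_iff)
  moreover have "(\<lambda>\<omega>. exp (real k * f \<omega>)) \<in> borel_measurable borel" using f(1) by measurable
  ultimately show "exp (- (real k * B)) \<le> (\<integral>\<omega>. exp (real k * f \<omega>) \<partial>R k x)"
    "(\<integral>\<omega>. exp (real k * f \<omega>) \<partial>R k x) \<le> exp (real k * B)"
    using integral_bounds_Prob[OF R_Prob[OF assms]] by blast+
qed

lemma mgf_pos: "k \<ge> 1 \<Longrightarrow> 0 < (\<integral>\<omega>. exp (real k * f \<omega>) \<partial>R k x)"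
  using mgf_bounds(1) exp_gt_zero less_le_trans by blast

lemma log_mgf_bound: "\<bar>log_mgf R k f x\<bar> \<le> B"
proof (cases "k = 0")
  case False
  then have k: "k \<ge> 1" by simp
  let ?Z = "\<integral>\<omega>. exp (real k * f \<omega>) \<partial>R k x"
  have "- (real k * B) \<le> ln ?Z" "ln ?Z \<le> real k * B"
    using ln_mono[OF mgf_bounds(1)[OF k, of x]] ln_mono[OF mgf_bounds(2)[OF k, of x] mgf_pos[OF k]] by simp_all
  then show ?thesis using k by (simp add: log_mgf_def abs_le_iff field_simps)
qed (use f(2) in \<open>auto simp: log_mgf_def intro: order_trans[OF abs_ge_zero]\<close>)

lemma log_mgf_measurable: "log_mgf R k f \<in> borel_measurable borel"
proof (cases "k = 0")
  case True
  then show ?thesis unfolding log_mgf_def[abs_def] by simp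
next
  case False
  then have k: "k \<ge> 1" by simp
  have "(\<lambda>\<omega>. exp (real k * f \<omega>)) \<in> borel_measurable borel" using f(1) by measurable
  then have "(\<lambda>x. \<integral>\<omega>. exp (real k * f \<omega>) \<partial>R k x) \<in> borel_measurable borel"
    by (rule measurable_compose[OF R_subprob[OF k] integral_measurable_subprob_algebra])
  then show ?thesis unfolding log_mgf_def[abs_def] by measurable
qed

text \<open>Since \<open>R k x\<close> starts at \<open>x\<close>, the exponent may be normalised by a function of the initial
  point, which puts the logarithm inside the integral over \<open>\<mu>\<close>; no disintegration of \<open>P\<close> is needed.\<close>

lemma integral_minus_log_mgf_le_S_cost:
  assumes k: "k \<ge> 1" and \<mu>: "\<mu> \<in> Prob" and P: "P \<in> Prob" and P0: "marginal 0 P = \<mu>"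
  shows "ereal ((\<integral>\<omega>. f \<omega> \<partial>P) - (\<integral>x. log_mgf R k f x \<partial>\<mu>)) \<le> S_cost R \<mu> k P"
proof -
  define L where "L = log_mgf R k f"
  define g where "g \<omega> = real k * f \<omega> - real k * L (cpath \<omega> 0)" for \<omega>
  have L[measurable]: "L \<in> borel_measurable borel" unfolding L_def by (rule log_mgf_measurable)
  have X0[measurable]: "(\<lambda>\<omega>. cpath \<omega> 0) \<in> borel \<rightarrow>\<^sub>M (borel :: 'a measure)" by (rule endpoint_measurable) simp
  note f(1)[measurable]
  have g[measurable]: "g \<in> borel_measurable borel" unfolding g_def by measurable
  have LX: "\<bar>L (cpath \<omega> 0)\<bar> \<le> B" for \<omega> unfolding L_def by (rule log_mgf_bound)
  have gB: "\<bar>g \<omega>\<bar> \<le> 2 * real k * B" for \<omega>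
  proof -
    have "\<bar>f \<omega> - L (cpath \<omega> 0)\<bar> \<le> 2 * B" using f(2)[of \<omega>] LX[of \<omega>] by linarith
    then have "real k * \<bar>f \<omega> - L (cpath \<omega> 0)\<bar> \<le> real k * (2 * B)" by (intro mult_left_mono) auto
    then show ?thesis by (simp add: g_def right_diff_distrib[symmetric] abs_mult mult_ac)
  qed
  have inner: "(\<integral>\<^sup>+\<omega>. ennreal (exp (g \<omega>)) \<partial>R k x) = 1" for x
  proof -
    let ?Z = "\<integral>\<omega>. exp (real k * f \<omega>) \<partial>R k x"
    have Z: "0 < ?Z" by (rule mgf_pos[OF k])
    have "real k * L x = ln ?Z" using k by (simp add: L_def log_mgf_def)
    then have e: "exp (real k * f \<omega> - real k * L x) = exp (real k * f \<omega>) / ?Z" for \<omega>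
      using Z by (simp add: exp_diff)
    have "(\<integral>\<^sup>+\<omega>. ennreal (exp (g \<omega>)) \<partial>R k x) = (\<integral>\<^sup>+\<omega>. ennreal (exp (real k * f \<omega>) / ?Z) \<partial>R k x)"
      using AE_start[OF k, of x] by (intro nn_integral_cong_AE, eventually_elim) (simp add: g_def e)
    also have "\<dots> = ennreal (\<integral>\<omega>. exp (real k * f \<omega>) / ?Z \<partial>R k x)"
      using Z mgf_integrable[OF k] by (intro nn_integral_eq_integral) auto
    also have "\<dots> = 1" using Z by simp
    finally show ?thesis .
  qed
  have "(\<integral>\<^sup>+\<omega>. ennreal (exp (g \<omega>)) \<partial>(\<mu> \<bind> R k)) = (\<integral>\<^sup>+x. \<integral>\<^sup>+\<omega>. ennreal (exp (g \<omega>)) \<partial>R k x \<partial>\<mu>)"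
    using R_subprob[OF k] by (intro nn_integral_bind[where B = borel]) (auto simp: measurable_Prob[OF \<mu>])
  also have "\<dots> = 1" using prob_space.emeasure_space_1[OF ProbD(1)[OF \<mu>]] by (simp add: inner)
  finally have exp1: "(\<integral>\<omega>. exp (g \<omega>) \<partial>(\<mu> \<bind> R k)) = 1"
    by (subst integral_eq_nn_integral) (auto simp: measurable_Prob[OF bind_Prob[OF k \<mu>]])
  have "ereal (\<integral>\<omega>. g \<omega> \<partial>P) \<le> rel_entropy P (\<mu> \<bind> R k)"
    using ProbD[OF P] ProbD[OF bind_Prob[OF k \<mu>]] gB exp1
    by (intro integral_le_rel_entropy) (auto simp: measurable_Prob[OF bind_Prob[OF k \<mu>]])
  then have "ereal (1 / real k) * ereal (\<integral>\<omega>. g \<omega> \<partial>P) \<le> S_cost R \<mu> k P"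
    unfolding S_cost_def by (intro ereal_mult_left_mono) auto
  moreover have "(\<integral>\<omega>. g \<omega> \<partial>P) = real k * ((\<integral>\<omega>. f \<omega> \<partial>P) - (\<integral>x. L x \<partial>\<mu>))"
  proof -
    have "integrable P f" "integrable P (\<lambda>\<omega>. L (cpath \<omega> 0))"
      using f(2) LX by (auto intro!: integrable_bounded_Prob[OF P])
    then have "(\<integral>\<omega>. g \<omega> \<partial>P) = real k * (\<integral>\<omega>. f \<omega> \<partial>P) - real k * (\<integral>\<omega>. L (cpath \<omega> 0) \<partial>P)"
      unfolding g_def by simp
    then show ?thesis using integral_marginal[of L 0 P] P P0 by (simp add: right_diff_distrib)
  qed
  ultimately show ?thesis using k by (simp add: L_def)
qed

end

text \<open>The pointwise estimates hold from thresholds that depend on \<open>x\<close>, both in n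
  and in k. The common bound \<open>B\<close> allows passage to the integral: dominated convergence
  in n of the upper limits over k supplies an n, and the reverse Fatou lemma in k handles this
  n.\<close>

lemma log_mgf_integral_eventually_le:
  fixes f :: "nat \<Rightarrow> 'a cadlag \<Rightarrow> real"
  assumes \<mu>: "\<mu> \<in> Prob" and f: "\<And>n. f n \<in> bcontfun" and B: "\<And>n \<omega>. \<bar>f n \<omega>\<bar> \<le> B"
    and le: "\<And>x e. e > 0 \<Longrightarrow> \<forall>\<^sub>F n in sequentially. \<forall>\<omega>. ereal (f n \<omega> - e) \<le> enn2ereal (rate x \<omega>)"
    and e: "e > 0"
  shows "\<exists>n. \<forall>\<^sub>F k in sequentially. (\<integral>x. log_mgf R k (f n) x \<partial>\<mu>) \<le> e"
proof -
  interpret \<mu>: prob_space \<mu> using ProbD[OF \<mu>] by simp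
  have B0: "0 \<le> B" using B[of 0 undefined] by linarith
  note fm = bcontfun_measurable[OF f]
  \<comment> \<open>\<open>ennreal\<close> drops negative values, which is harmless for an upper
    bound and puts the limits in the range of the non-negative integral.\<close>
  define v where "v n x = limsup (\<lambda>k. ennreal (log_mgf R k (f n) x))" for n x
  have u_meas[measurable]: "(\<lambda>x. ennreal (log_mgf R k (f n) x)) \<in> borel_measurable \<mu>" for n k
    using log_mgf_measurable[OF fm B] by (simp add: measurable_Prob[OF \<mu>])
  have v_meas[measurable]: "v n \<in> borel_measurable \<mu>" for n unfolding v_def by measurable
  have u_le: "ennreal (log_mgf R k (f n) x) \<le> ennreal B" for k n x
    using log_mgf_bound[OF fm B, of k n x] by (intro ennreal_leI) linarith
  have v_le: "v n x \<le> ennreal B" for n x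
    unfolding v_def by (intro Limsup_bounded always_eventually allI u_le)
  have v_lim: "(\<lambda>n. v n x) \<longlonglongrightarrow> 0" for x
  proof (rule order_tendstoI)
    fix a :: ennreal assume "0 < a"
    then obtain b where b: "0 < b" "b < a" using dense by blast
    then obtain d where d: "0 < d" "ennreal d < a" by (cases b) auto
    have "0 < d / 2" using d(1) by simp
    from le[OF this, of x] show "\<forall>\<^sub>F n in sequentially. v n x < a"
    proof eventually_elim
      case (elim n)
      have "\<forall>\<^sub>F k in sequentially. (\<integral>\<omega>. exp (real k * f n \<omega>) \<partial>R k x) \<le> exp (real k * (d / 2 + d / 2))"
        using elim d by (intro LDP_exp_integral_upper[OF ldp[of x] f]) auto
      then have "\<forall>\<^sub>F k in sequentially. ennreal (log_mgf R k (f n) x) \<le> ennreal d"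
        using eventually_ge_at_top[of 1]
      proof eventually_elim
        case (elim k)
        have "ln (\<integral>\<omega>. exp (real k * f n \<omega>) \<partial>R k x) \<le> real k * d"
          using elim(1) mgf_pos[OF fm B elim(2)] by (metis field_sum_of_halves ln_exp ln_le_cancel_iff exp_gt_zero)
        then have "log_mgf R k (f n) x \<le> d" using elim(2) by (simp add: log_mgf_def field_simps)
        then show ?case by (rule ennreal_leI)
      qed
      then have "v n x \<le> ennreal d" unfolding v_def by (rule Limsup_bounded)
      then show "v n x < a" using d(2) by (rule le_less_trans)
    qed
  qed simp
  have "(\<lambda>n. \<integral>\<^sup>+x. v n x \<partial>\<mu>) \<longlonglongrightarrow> (\<integral>\<^sup>+x. 0 \<partial>\<mu>)"
    using v_le v_lim by (intro nn_integral_dominated_convergence[where w = "\<lambda>_. ennreal B"])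
      (auto simp: \<mu>.emeasure_space_1)
  then have "\<forall>\<^sub>F n in sequentially. (\<integral>\<^sup>+x. v n x \<partial>\<mu>) < ennreal e"
    using e by (intro order_tendstoD(2)) auto
  then obtain n where n: "(\<integral>\<^sup>+x. v n x \<partial>\<mu>) < ennreal e" using eventually_happens' sequentially_bot by blast
  have "limsup (\<lambda>k. \<integral>\<^sup>+x. ennreal (log_mgf R k (f n) x) \<partial>\<mu>) \<le> (\<integral>\<^sup>+x. v n x \<partial>\<mu>)"
    unfolding v_def using u_le by (intro nn_integral_limsup[where w = "\<lambda>_. ennreal B"]) (auto simp: \<mu>.emeasure_space_1)
  then have "limsup (\<lambda>k. \<integral>\<^sup>+x. ennreal (log_mgf R k (f n) x) \<partial>\<mu>) < ennreal e" using n by (rule le_less_trans)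
  then have "\<forall>\<^sub>F k in sequentially. (\<integral>\<^sup>+x. ennreal (log_mgf R k (f n) x) \<partial>\<mu>) < ennreal e"
    by (rule Limsup_lessD)
  then have "\<forall>\<^sub>F k in sequentially. (\<integral>x. log_mgf R k (f n) x \<partial>\<mu>) \<le> e"
  proof eventually_elim
    case (elim k)
    have "integrable \<mu> (log_mgf R k (f n))"
      by (rule integrable_bounded_Prob[OF \<mu> log_mgf_measurable[OF fm B] log_mgf_bound[OF fm B]])
    then have "(\<integral>x. log_mgf R k (f n) x \<partial>\<mu>) \<le> (\<integral>x. max 0 (log_mgf R k (f n) x) \<partial>\<mu>)"
      by (intro integral_mono) auto
    also have "\<dots> = enn2real (\<integral>\<^sup>+x. ennreal (max 0 (log_mgf R k (f n) x)) \<partial>\<mu>)"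
      using log_mgf_measurable[OF fm B] by (intro integral_eq_nn_integral) (auto simp: measurable_Prob[OF \<mu>])
    also have "(\<integral>\<^sup>+x. ennreal (max 0 (log_mgf R k (f n) x)) \<partial>\<mu>) = (\<integral>\<^sup>+x. ennreal (log_mgf R k (f n) x) \<partial>\<mu>)"
      by (intro nn_integral_cong) (simp add: max_def ennreal_neg)
    also have "enn2real \<dots> \<le> e" using elim e by (simp add: enn2real_leI)
    finally show ?case .
  qed
  then show ?thesis ..
qed

lemma log_mgf_integral_eventually_le_const:
  assumes "\<mu> \<in> Prob" "f \<in> bcontfun" "\<And>\<omega>. ereal (f \<omega>) \<le> enn2ereal (C \<omega>)" "e > 0"
  shows "\<forall>\<^sub>F k in sequentially. (\<integral>x. log_mgf R k f x \<partial>\<mu>) \<le> e"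
proof -
  obtain B where B: "\<And>\<omega>. \<bar>f \<omega>\<bar> \<le> B" using bcontfun_bound[OF assms(2)] by metis
  have "ereal (f \<omega> - d) \<le> enn2ereal (rate x \<omega>)" if "d > 0" for \<omega> d x
  proof -
    have "ereal (f \<omega> - d) \<le> ereal (f \<omega>)" using that by simp
    also have "\<dots> \<le> enn2ereal (C \<omega>)" by (rule assms(3))
    also have "\<dots> \<le> enn2ereal (rate x \<omega>)" by (simp add: less_eq_ennreal.rep_eq[symmetric])
    finally show ?thesis .
  qed
  then show ?thesis
    using log_mgf_integral_eventually_le[of \<mu> "\<lambda>_. f" B e] assms B by simp
qed

text \<open>Coercivity of the rate functions enters here, through Dini's theorem on their sublevel sets.\<close>

lemma log_mgf_integral_eventually_le_decreasing:
  fixes h :: "nat \<Rightarrow> 'a cadlag \<Rightarrow> real"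
  assumes \<mu>: "\<mu> \<in> Prob" and h: "\<And>n. h n \<in> bcontfun" "\<And>n \<omega>. 0 \<le> h n \<omega>" "\<And>n \<omega>. h (Suc n) \<omega> \<le> h n \<omega>"
    and lim: "\<And>\<omega>. (\<lambda>n. h n \<omega>) \<longlonglongrightarrow> 0" and e: "e > 0"
  shows "\<exists>n. \<forall>\<^sub>F k in sequentially. (\<integral>x. log_mgf R k (h n) x \<partial>\<mu>) \<le> e"
proof -
  obtain B where B: "\<And>\<omega>. \<bar>h 0 \<omega>\<bar> \<le> B" using bcontfun_bound[OF h(1)] by metis
  have dec: "h n \<omega> \<le> h m \<omega>" if "m \<le> n" for m n \<omega>
    using that h(3) by (rule lift_Suc_antimono_le[rotated])
  have hB: "\<bar>h n \<omega>\<bar> \<le> B" for n \<omega> using dec[of 0 n \<omega>] B[of \<omega>] h(2)[of n \<omega>] by simp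
  show ?thesis
  proof (rule log_mgf_integral_eventually_le[OF \<mu> h(1) hB _ e])
    fix x and d :: real assume d: "d > 0"
    \<comment> \<open>Outside this sublevel set the rate exceeds \<open>B\<close>, which bounds
      every \<open>h n\<close>, so the inequality is trivial there.\<close>
    let ?K = "{\<omega>. enn2ereal (rate x \<omega>) \<le> ereal B}"
    have K: "compact ?K" using coercive by (simp add: coercive_def)
    obtain N where N: "N \<subseteq> UNIV" "finite N" "?K \<subseteq> (\<Union>n\<in>N. {\<omega>. h n \<omega> < d})"
    proof (rule compactE_image[OF K, of UNIV "\<lambda>n. {\<omega>. h n \<omega> < d}"])
      show "open {\<omega>. h n \<omega> < d}" for n
        using h(1)[of n] by (intro open_Collect_less continuous_intros) (auto simp: bcontfun_def)
      show "?K \<subseteq> (\<Union>n. {\<omega>. h n \<omega> < d})"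
      proof safe
        fix \<omega>
        have "\<forall>\<^sub>F n in sequentially. h n \<omega> < d" using lim d by (rule order_tendstoD)
        then show "\<omega> \<in> (\<Union>n. {\<omega>. h n \<omega> < d})" using eventually_happens' sequentially_bot by blast
      qed
    qed
    show "\<forall>\<^sub>F n in sequentially. \<forall>\<omega>. ereal (h n \<omega> - d) \<le> enn2ereal (rate x \<omega>)"
      using eventually_ge_at_top[of "Max (insert 0 N)"]
    proof (eventually_elim, intro allI)
      fix n \<omega> assume n: "Max (insert 0 N) \<le> n"
      show "ereal (h n \<omega> - d) \<le> enn2ereal (rate x \<omega>)"
      proof (cases "\<omega> \<in> ?K")
        case True
        then obtain m where m: "m \<in> N" "h m \<omega> < d" using N(3) by blast
        then have "m \<le> n" using n N(2) by simp
        then have "h n \<omega> - d \<le> 0" using dec[of m n \<omega>] m by simp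
        then have "ereal (h n \<omega> - d) \<le> 0" by simp
        then show ?thesis using enn2ereal_nonneg by (rule order_trans)
      next
        case False
        have "h n \<omega> - d \<le> B" using hB[of n \<omega>] d by linarith
        then have "ereal (h n \<omega> - d) \<le> ereal B" by simp
        also have "\<dots> \<le> enn2ereal (rate x \<omega>)" using False by simp
        finally show ?thesis .
      qed
    qed
  qed
qed

end

section \<open>Cluster points of measures of bounded cost\<close>

context ldp_kernel
begin

text \<open>The limit is taken among functionals: the integrals cluster at a positive linear
  \<open>L\<close>, which \<open>daniell_representation\<close> turns into a measure. The continuity
  \<open>smooth\<close> of \<open>L\<close> plays the part of tightness and follows from the cost
  bound applied to a large multiple of the decreasing functions. A general filter \<open>F\<close>
  allows the lemma to run along any infinite set of indices.\<close>

lemma S_cost_sublevel_cluster: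
  fixes P :: "nat \<Rightarrow> 'a cadlag measure"
  assumes \<mu>: "\<mu> \<in> Prob" and F: "F \<noteq> bot" "F \<le> sequentially"
    and good: "\<forall>\<^sub>F k in F. P k \<in> Prob \<and> marginal 0 (P k) = \<mu> \<and> S_cost R \<mu> k (P k) \<le> ereal a"
  shows "\<exists>Q\<in>Prob. \<forall>(I :: ('a cadlag \<Rightarrow> real) set) e. finite I \<longrightarrow> I \<subseteq> bcontfun \<longrightarrow> e > 0 \<longrightarrow>
    (\<exists>\<^sub>F k in F. \<forall>f\<in>I. \<bar>(\<integral>\<omega>. f \<omega> \<partial>P k) - (\<integral>\<omega>. f \<omega> \<partial>Q)\<bar> < e)"
proof -
  let ?good = "\<lambda>k. k \<ge> 1 \<and> P k \<in> Prob \<and> marginal 0 (P k) = \<mu> \<and> S_cost R \<mu> k (P k) \<le> ereal a"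
  have "\<forall>\<^sub>F k in F. k \<ge> 1" using F(2) eventually_ge_at_top[of 1] by (rule filter_leD)
  with good have good': "\<forall>\<^sub>F k in F. ?good k" by eventually_elim simp
  have "\<exists>b. \<forall>f::'a cadlag \<Rightarrow> real. f \<in> bcontfun \<longrightarrow> (\<forall>\<omega>. \<bar>f \<omega>\<bar> \<le> b f)"
    using bcontfun_bound by metis
  then obtain b where b: "\<And>f::'a cadlag \<Rightarrow> real. f \<in> bcontfun \<Longrightarrow> \<bar>f \<omega>\<bar> \<le> b f" for \<omega> by blast
  \<comment> \<open>Extended by 0 beyond \<open>bcontfun\<close>, since the clustering lemma indexes
    over a whole type.\<close>
  let ?a = "\<lambda>k f. if f \<in> bcontfun then (\<integral>\<omega>. f \<omega> \<partial>P k) else (0::real)"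
  have "\<forall>\<^sub>F k in F. \<forall>f. \<bar>?a k f\<bar> \<le> \<bar>b f\<bar>"
    using good'
  proof (eventually_elim, intro allI)
    fix k and f :: "'a cadlag \<Rightarrow> real" assume k: "?good k"
    show "\<bar>?a k f\<bar> \<le> \<bar>b f\<bar>"
    proof (cases "f \<in> bcontfun")
      case True
      have "\<bar>f \<omega>\<bar> \<le> \<bar>b f\<bar>" for \<omega> using b[OF True, of \<omega>] by linarith
      then show ?thesis using integral_bcontfun_abs_le[of "P k" f] k True by simp
    qed simp
  qed
  from cluster_of_bounded_family[OF F(1) this]
  obtain L where "\<forall>I e. finite I \<longrightarrow> e > 0 \<longrightarrow> (\<exists>\<^sub>F k in F. \<forall>f\<in>I. \<bar>?a k f - L f\<bar> < e)" ..
  then have L: "\<exists>\<^sub>F k in F. \<forall>f\<in>I. \<bar>(\<integral>\<omega>. f \<omega> \<partial>P k) - L f\<bar> < e"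
    if "finite I" "e > 0" "I \<subseteq> bcontfun" for I e
  proof -
    have "(\<exists>\<^sub>F k in F. \<forall>f\<in>I. \<bar>?a k f - L f\<bar> < e)"
      using \<open>\<forall>I e. finite I \<longrightarrow> e > 0 \<longrightarrow> (\<exists>\<^sub>F k in F. \<forall>f\<in>I. \<bar>?a k f - L f\<bar> < e)\<close> that(1,2) by simp
    moreover have "?a k f = (\<integral>\<omega>. f \<omega> \<partial>P k)" if "f \<in> I" for f k
      using that \<open>I \<subseteq> bcontfun\<close> by auto
    ultimately show ?thesis by simp
  qed
  have L1: "\<exists>k. (\<forall>f\<in>I. \<bar>(\<integral>\<omega>. f \<omega> \<partial>P k) - L f\<bar> < e) \<and> ?good k \<and> T k"
    if "finite I" "e > 0" "I \<subseteq> bcontfun" "eventually T sequentially" for I e T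
    using frequently_ex[OF frequently_conj_eventually[OF L[OF that(1-3)]
        eventually_conj[OF good' filter_leD[OF F(2) that(4)]]]] .
  have add: "L (\<lambda>x. f x + g x) = L f + L g" if fg: "f \<in> bcontfun" "g \<in> bcontfun" for f g
  proof (rule abs_le_all_imp_eq[where c = 3])
    fix e :: real assume "e > 0"
    then obtain k where k: "\<bar>(\<integral>\<omega>. f \<omega> + g \<omega> \<partial>P k) - L (\<lambda>x. f x + g x)\<bar> < e"
      "\<bar>(\<integral>\<omega>. f \<omega> \<partial>P k) - L f\<bar> < e" "\<bar>(\<integral>\<omega>. g \<omega> \<partial>P k) - L g\<bar> < e" "P k \<in> Prob"
      using L1[of "{\<lambda>x. f x + g x, f, g}" e "\<lambda>_. True"] fg bcontfun_add[OF fg] by auto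
    then show "\<bar>L (\<lambda>x. f x + g x) - (L f + L g)\<bar> < 3 * e"
      using bcontfun_integrable[OF k(4)] fg by simp
  qed
  have scale: "L (\<lambda>x. c * f x) = c * L f" if f: "f \<in> bcontfun" for f c
  proof (rule abs_le_all_imp_eq[where c = "2 + \<bar>c\<bar>"])
    fix e :: real assume e: "e > 0"
    then obtain k where k: "\<bar>(\<integral>\<omega>. c * f \<omega> \<partial>P k) - L (\<lambda>x. c * f x)\<bar> < e"
      "\<bar>(\<integral>\<omega>. f \<omega> \<partial>P k) - L f\<bar> < e"
      using L1[of "{\<lambda>x. c * f x, f}" e "\<lambda>_. True"] f bcontfun_scale[OF f] by auto
    have "\<bar>c * ((\<integral>\<omega>. f \<omega> \<partial>P k) - L f)\<bar> \<le> \<bar>c\<bar> * e"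
      unfolding abs_mult using k(2) by (intro mult_left_mono) auto
    then have "\<bar>L (\<lambda>x. c * f x) - c * L f\<bar> < e + \<bar>c\<bar> * e" using k(1) by (simp add: algebra_simps)
    then show "\<bar>L (\<lambda>x. c * f x) - c * L f\<bar> < (2 + \<bar>c\<bar>) * e" using e by (simp add: distrib_right)
  qed
  have pos: "0 \<le> L f" if f: "f \<in> bcontfun" "\<And>x. 0 \<le> f x" for f
  proof (rule field_le_epsilon)
    fix e :: real assume "e > 0"
    then obtain k where "\<bar>(\<integral>\<omega>. f \<omega> \<partial>P k) - L f\<bar> < e" using L1[of "{f}" e "\<lambda>_. True"] f by auto
    moreover have "0 \<le> (\<integral>\<omega>. f \<omega> \<partial>P k)" using f by (simp add: integral_nonneg_AE)
    ultimately show "0 \<le> L f + e" by linarith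
  qed
  have one: "L (\<lambda>_. 1) = 1"
  proof (rule abs_le_all_imp_eq[where c = 1])
    fix e :: real assume "e > 0"
    then obtain k where k: "\<bar>(\<integral>\<omega>. 1 \<partial>P k) - L (\<lambda>_. 1)\<bar> < e" "P k \<in> Prob"
      using L1[of "{\<lambda>_. 1}" e "\<lambda>_. True"] const_bcontfun[of "1::real"] by auto
    then show "\<bar>L (\<lambda>_. 1) - 1\<bar> < 1 * e"
      using prob_space.prob_space[OF ProbD(1)[OF k(2)]] by (simp add: abs_minus_commute)
  qed
  have smooth: "(\<lambda>n. L (h n)) \<longlonglongrightarrow> 0"
    if h: "\<And>n. h n \<in> bcontfun" "\<And>n x. 0 \<le> h n x" "\<And>n x. h (Suc n) x \<le> h n x"
      and lim: "\<And>x. (\<lambda>n. h n x) \<longlonglongrightarrow> 0" for h :: "nat \<Rightarrow> 'a cadlag \<Rightarrow> real"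
  proof (rule tendstoI)
    fix e :: real assume e: "e > 0"
    \<comment> \<open>The value of \<open>L\<close> at \<open>t * h n0\<close> is below
      \<open>\<bar>a\<bar> + 3\<close>: it is at most the cost bound \<open>a\<close>, plus 1 for
      the logarithmic term, plus 1 for the distance to the cluster point. Division by
      \<open>t\<close> leaves less than \<open>e\<close>.\<close>
    define t where "t = (\<bar>a\<bar> + 3) / e"
    have t: "t > 0" using e by (simp add: t_def)
    have th: "(\<lambda>x. t * h n x) \<in> bcontfun" for n by (rule bcontfun_scale[OF h(1)])
    have "(\<lambda>n. t * h n x) \<longlonglongrightarrow> t * 0" for x by (intro tendsto_intros lim)
    then have "\<exists>n. \<forall>\<^sub>F k in sequentially. (\<integral>x. log_mgf R k (\<lambda>x. t * h n x) x \<partial>\<mu>) \<le> 1"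
      using h(2,3) t by (intro log_mgf_integral_eventually_le_decreasing[OF \<mu> th]) auto
    then obtain n0 where n0: "\<forall>\<^sub>F k in sequentially. (\<integral>x. log_mgf R k (\<lambda>x. t * h n0 x) x \<partial>\<mu>) \<le> 1" ..
    obtain k where k: "\<bar>(\<integral>\<omega>. t * h n0 \<omega> \<partial>P k) - L (\<lambda>x. t * h n0 x)\<bar> < 1" "?good k"
      "(\<integral>x. log_mgf R k (\<lambda>x. t * h n0 x) x \<partial>\<mu>) \<le> 1"
      using L1[of "{\<lambda>x. t * h n0 x}" 1, OF _ _ _ n0] th by auto
    have "ereal ((\<integral>\<omega>. t * h n0 \<omega> \<partial>P k) - (\<integral>x. log_mgf R k (\<lambda>x. t * h n0 x) x \<partial>\<mu>)) \<le> S_cost R \<mu> k (P k)"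
      using k(2) by (intro integral_minus_log_mgf_le_S_cost[OF bcontfun_measurable[OF th] b[OF th]] \<mu>) auto
    then have "(\<integral>\<omega>. t * h n0 \<omega> \<partial>P k) - (\<integral>x. log_mgf R k (\<lambda>x. t * h n0 x) x \<partial>\<mu>) \<le> a"
      using k(2) by (metis ereal_less_eq(3) order_trans)
    then have "L (\<lambda>x. t * h n0 x) < \<bar>a\<bar> + 3" using k(1,3) by linarith
    moreover have "t * e = \<bar>a\<bar> + 3" using e by (simp add: t_def)
    ultimately have "t * L (h n0) < t * e" using scale[OF h(1), of t n0] by simp
    then have n0e: "L (h n0) < e" using t by simp
    show "\<forall>\<^sub>F n in sequentially. dist (L (h n)) 0 < e"
      using eventually_ge_at_top[of n0]
    proof eventually_elim
      case (elim n)
      have "h n x \<le> h n0 x" for x using elim h(3) by (rule lift_Suc_antimono_le[rotated])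
      then have "0 \<le> L (\<lambda>x. h n0 x + - 1 * h n x)"
        by (intro pos bcontfun_add bcontfun_scale h) simp
      also have "\<dots> = L (h n0) - L (h n)"
        using add[OF h(1) bcontfun_scale[OF h(1), of "-1"], of n0 n] scale[OF h(1), of "-1" n] by simp
      finally have "L (h n) \<le> L (h n0)" by simp
      then show ?case using n0e pos[OF h(1,2), of n] by simp
    qed
  qed
  obtain Q where Q: "Q \<in> Prob" "\<And>f. f \<in> bcontfun \<Longrightarrow> L f = (\<integral>x. f x \<partial>Q)"
    using daniell_representation[of L, OF add scale pos one smooth] by blast
  show ?thesis
  proof (intro bexI[of _ Q] Q(1) allI impI)
    fix I :: "('a cadlag \<Rightarrow> real) set" and e :: real assume I: "finite I" "I \<subseteq> bcontfun" "e > 0"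
    have "(\<integral>\<omega>. f \<omega> \<partial>Q) = L f" if "f \<in> I" for f using Q(2) I(2) that by auto
    then show "\<exists>\<^sub>F k in F. \<forall>f\<in>I. \<bar>(\<integral>\<omega>. f \<omega> \<partial>P k) - (\<integral>\<omega>. f \<omega> \<partial>Q)\<bar> < e"
      using L[OF I(1,3,2)] by simp
  qed
qed

text \<open>The lower bound of a Gamma-convergence statement. End points depend continuously on the
  path, so both marginals pass to the limit. The cost is tested by Lipschitz minorants of
  \<open>C\<close>; lying below every rate function, they have logarithmic terms that are
  asymptotically at most 0.\<close>

lemma cluster_point_in_couplings:
  fixes P :: "nat \<Rightarrow> 'a cadlag measure"
  assumes \<mu>\<^sub>0: "\<mu>\<^sub>0 \<in> Prob" and \<mu>\<^sub>1: "\<mu>\<^sub>1 \<in> Prob" and F: "F \<le> sequentially"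
    and \<nu>: "\<forall>\<^sub>F k in sequentially. \<nu> k \<in> Prob" "limitin narrow \<nu> \<mu>\<^sub>1 sequentially"
    and good: "\<forall>\<^sub>F k in F. P k \<in> couplings_dyn \<mu>\<^sub>0 (\<nu> k) \<and> S_cost R \<mu>\<^sub>0 k (P k) \<le> ereal a"
    and Q: "Q \<in> Prob"
    and cluster: "\<And>(f :: 'a cadlag \<Rightarrow> real) e. f \<in> bcontfun \<Longrightarrow> e > 0 \<Longrightarrow>
      \<exists>\<^sub>F k in F. \<bar>(\<integral>\<omega>. f \<omega> \<partial>P k) - (\<integral>\<omega>. f \<omega> \<partial>Q)\<bar> < e"
  shows "Q \<in> couplings_dyn \<mu>\<^sub>0 \<mu>\<^sub>1 \<and> MK_cost C Q \<le> ennreal a"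
proof -
  let ?good = "\<lambda>k. k \<ge> 1 \<and> P k \<in> couplings_dyn \<mu>\<^sub>0 (\<nu> k) \<and> S_cost R \<mu>\<^sub>0 k (P k) \<le> ereal a"
  have "\<forall>\<^sub>F k in F. k \<ge> 1" using F eventually_ge_at_top[of 1] by (rule filter_leD)
  with good have good': "\<forall>\<^sub>F k in F. ?good k" by eventually_elim simp
  have ex: "\<exists>k. \<bar>(\<integral>\<omega>. f \<omega> \<partial>P k) - (\<integral>\<omega>. f \<omega> \<partial>Q)\<bar> < e \<and> ?good k \<and> T k"
    if "f \<in> bcontfun" "e > 0" "eventually T sequentially" for f :: "'a cadlag \<Rightarrow> real" and e T
    using frequently_ex[OF frequently_conj_eventually[OF cluster[OF that(1,2)]
        eventually_conj[OF good' filter_leD[OF F that(3)]]]] .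
  have m0: "marginal 0 Q = \<mu>\<^sub>0"
  proof (rule Prob_eqI_bcontfun[OF marginal_Prob[OF _ Q] \<mu>\<^sub>0])
    fix h :: "'a \<Rightarrow> real" assume h: "h \<in> bcontfun"
    have eq: "(\<integral>x. h x \<partial>marginal 0 M) = (\<integral>\<omega>. h (cpath \<omega> 0) \<partial>M)" if "M \<in> Prob" for M :: "'a cadlag measure"
      using that by (intro integral_marginal bcontfun_measurable h) auto
    show "(\<integral>x. h x \<partial>marginal 0 Q) = (\<integral>x. h x \<partial>\<mu>\<^sub>0)"
    proof (rule abs_le_all_imp_eq[where c = 1])
      fix e :: real assume "e > 0"
      then obtain k where k: "\<bar>(\<integral>\<omega>. h (cpath \<omega> 0) \<partial>P k) - (\<integral>\<omega>. h (cpath \<omega> 0) \<partial>Q)\<bar> < e" "?good k"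
        using ex[OF bcontfun_endpoint[OF h, of 0], of e "\<lambda>_. True"] by auto
      then show "\<bar>(\<integral>x. h x \<partial>marginal 0 Q) - (\<integral>x. h x \<partial>\<mu>\<^sub>0)\<bar> < 1 * e"
        using eq[OF Q] eq[of "P k"] by (auto simp: couplings_dyn_def)
    qed
  qed simp
  have m1: "marginal 1 Q = \<mu>\<^sub>1"
  proof (rule Prob_eqI_bcontfun[OF marginal_Prob[OF _ Q] \<mu>\<^sub>1])
    fix h :: "'a \<Rightarrow> real" assume h: "h \<in> bcontfun"
    have eq: "(\<integral>x. h x \<partial>marginal 1 M) = (\<integral>\<omega>. h (cpath \<omega> 1) \<partial>M)" if "M \<in> Prob" for M :: "'a cadlag measure"
      using that by (intro integral_marginal bcontfun_measurable h) auto
    show "(\<integral>x. h x \<partial>marginal 1 Q) = (\<integral>x. h x \<partial>\<mu>\<^sub>1)"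
    proof (rule abs_le_all_imp_eq[where c = 2])
      fix e :: real assume e: "e > 0"
      have "(\<lambda>k. \<integral>x. h x \<partial>\<nu> k) \<longlonglongrightarrow> (\<integral>x. h x \<partial>\<mu>\<^sub>1)"
        using \<nu>(2) h unfolding limitin_narrow_iff[OF \<nu>(1) \<mu>\<^sub>1] by blast
      from tendstoD[OF this e] have "\<forall>\<^sub>F k in sequentially. \<bar>(\<integral>x. h x \<partial>\<nu> k) - (\<integral>x. h x \<partial>\<mu>\<^sub>1)\<bar> < e"
        by (simp add: dist_real_def)
      from ex[OF bcontfun_endpoint[OF h, of 1] e this]
      obtain k where k: "\<bar>(\<integral>\<omega>. h (cpath \<omega> 1) \<partial>P k) - (\<integral>\<omega>. h (cpath \<omega> 1) \<partial>Q)\<bar> < e" "?good k"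
        "\<bar>(\<integral>x. h x \<partial>\<nu> k) - (\<integral>x. h x \<partial>\<mu>\<^sub>1)\<bar> < e" by auto
      have "marginal 1 (P k) = \<nu> k" "P k \<in> Prob" using k(2) by (auto simp: couplings_dyn_def)
      then have "(\<integral>\<omega>. h (cpath \<omega> 1) \<partial>P k) = (\<integral>x. h x \<partial>\<nu> k)" using eq[of "P k"] by simp
      then show "\<bar>(\<integral>x. h x \<partial>marginal 1 Q) - (\<integral>x. h x \<partial>\<mu>\<^sub>1)\<bar> < 2 * e"
        using k(1,3) eq[OF Q] by linarith
    qed
  qed simp
  have "(\<integral>\<^sup>+\<omega>. C \<omega> \<partial>Q) \<le> ennreal a"
  proof (rule nn_integral_le_via_lip_minorants[OF C_lsc Q])
    fix m
    let ?f = "lip_minorant C m"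
    have f: "?f \<in> bcontfun" by (rule lip_minorant_bcontfun)
    obtain B where B: "\<And>\<omega>. \<bar>?f \<omega>\<bar> \<le> B" using bcontfun_bound[OF f] by metis
    have fC: "ereal (?f \<omega>) \<le> enn2ereal (C \<omega>)" for \<omega>
      using lip_minorant_bounds(1,3)[of C m \<omega>] by (simp add: less_eq_ennreal.rep_eq enn2ereal_ennreal)
    show "(\<integral>\<omega>. ?f \<omega> \<partial>Q) \<le> a"
    proof (rule field_le_epsilon)
      fix e :: real assume e: "e > 0"
      have "\<forall>\<^sub>F k in sequentially. (\<integral>x. log_mgf R k ?f x \<partial>\<mu>\<^sub>0) \<le> e / 2"
        using e by (intro log_mgf_integral_eventually_le_const[OF \<mu>\<^sub>0 f fC]) auto
      from ex[OF f _ this, of "e / 2"] e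
      obtain k where k: "\<bar>(\<integral>\<omega>. ?f \<omega> \<partial>P k) - (\<integral>\<omega>. ?f \<omega> \<partial>Q)\<bar> < e / 2" "?good k"
        "(\<integral>x. log_mgf R k ?f x \<partial>\<mu>\<^sub>0) \<le> e / 2" by auto
      have "ereal ((\<integral>\<omega>. ?f \<omega> \<partial>P k) - (\<integral>x. log_mgf R k ?f x \<partial>\<mu>\<^sub>0)) \<le> S_cost R \<mu>\<^sub>0 k (P k)"
        using k(2) by (intro integral_minus_log_mgf_le_S_cost[OF bcontfun_measurable[OF f] B] \<mu>\<^sub>0)
          (auto simp: couplings_dyn_def)
      then have "(\<integral>\<omega>. ?f \<omega> \<partial>P k) - (\<integral>x. log_mgf R k ?f x \<partial>\<mu>\<^sub>0) \<le> a"
        using k(2) by (metis ereal_less_eq(3) order_trans)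
      then show "(\<integral>\<omega>. ?f \<omega> \<partial>Q) \<le> a + e" using k(1,3) by linarith
    qed
  qed
  then show ?thesis using Q m0 m1 by (simp add: couplings_dyn_def MK_cost_def)
qed

end

section \<open>Recovery sequences\<close>

context ldp_kernel
begin

context
  fixes P :: "'a cadlag measure" and \<delta> \<epsilon> :: real
  assumes P: "P \<in> Prob" and fin: "MK_cost C P < \<infinity>" and \<delta>: "\<delta> > 0" and \<epsilon>: "\<epsilon> > 0"
begin

private abbreviation "c \<omega> \<equiv> enn2real (C \<omega>)"

text \<open>Only the end point is constrained, and only up to an open ball, so the set is open and
  the large deviation lower bound applies to it.\<close>

private definition "nbhd \<omega> = {\<omega>' :: 'a cadlag. dist (cpath \<omega>' 1) (cpath \<omega> 1) < \<delta>}"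

private definition "hit k \<omega> = measure (R k (cpath \<omega> 0)) (nbhd \<omega>)"

private definition "good k = {\<omega>. C \<omega> < \<infinity> \<and> 0 < hit k \<omega> \<and> - ln (hit k \<omega>) \<le> real k * (c \<omega> + \<epsilon>)}"

text \<open>On \<open>good k\<close> the kernel is conditioned to end within \<open>\<delta>\<close> of the endpoint of \<open>\<omega>\<close>, at an
  entropic price of at most \<open>k (C \<omega> + \<epsilon>)\<close>; elsewhere it is left unchanged, at no price.\<close>

private definition "weight k \<omega> \<omega>' = (if \<omega> \<in> good k then indicator (nbhd \<omega>) \<omega>' / hit k \<omega> else (1::real))"

private definition "cond_kernel k \<omega> = density (R k (cpath \<omega> 0)) (\<lambda>\<omega>'. ennreal (weight k \<omega> \<omega>'))"

private definition "rec k = P \<bind> cond_kernel k"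

section \<open>Measurability and normalisation of the conditioned kernel\<close>

private lemma X_meas [measurable]:
  "(\<lambda>\<omega>. cpath \<omega> 0) \<in> borel \<rightarrow>\<^sub>M (borel :: 'a measure)" "(\<lambda>\<omega>. cpath \<omega> 1) \<in> borel \<rightarrow>\<^sub>M (borel :: 'a measure)"
  by (rule endpoint_measurable, simp)+

private lemma C_meas [measurable]: "C \<in> borel_measurable borel"
  by (rule lower_semicont_measurable[OF C_lsc])

private lemma nbhd_open: "open (nbhd \<omega>)"
proof -
  have "continuous_on UNIV (\<lambda>\<omega> :: 'a cadlag. cpath \<omega> 1)"
    unfolding continuous_on_iff using dist_endpoint_le[of 1] by (meson insertI1 insertI2 le_less_trans)
  then show ?thesis unfolding nbhd_def by (intro open_Collect_less continuous_intros)
qed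

private lemma nbhd_pair_meas [measurable]:
  "Measurable.pred (borel \<Otimes>\<^sub>M borel) (\<lambda>p :: 'a cadlag \<times> 'a cadlag. snd p \<in> nbhd (fst p))"
  unfolding nbhd_def by simp measurable

private lemma kernel_X0: "k \<ge> 1 \<Longrightarrow> (\<lambda>\<omega>. R k (cpath \<omega> 0)) \<in> borel \<rightarrow>\<^sub>M subprob_algebra borel"
  by (rule measurable_compose[OF X_meas(1) R_subprob])

private lemma hit_meas [measurable]: "k \<ge> 1 \<Longrightarrow> hit k \<in> borel_measurable borel"
proof -
  assume k: "k \<ge> 1"
  have "{p \<in> space (borel \<Otimes>\<^sub>M borel). snd p \<in> nbhd (fst p)} \<in> sets (borel \<Otimes>\<^sub>M borel)" by measurable
  also have "{p \<in> space (borel \<Otimes>\<^sub>M borel). snd p \<in> nbhd (fst p)} = (SIGMA \<omega>:space borel. nbhd \<omega>)"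
    by (auto simp: space_pair_measure)
  finally show ?thesis unfolding hit_def[abs_def]
    by (rule measure_measurable_subprob_algebra2[OF _ kernel_X0[OF k]])
qed

private lemma good_meas [measurable]: "k \<ge> 1 \<Longrightarrow> good k \<in> sets borel"
proof -
  assume k[measurable]: "k \<ge> 1"
  have "{\<omega> \<in> space borel. C \<omega> < \<infinity> \<and> 0 < hit k \<omega> \<and> - ln (hit k \<omega>) \<le> real k * (c \<omega> + \<epsilon>)} \<in> sets borel"
    using hit_meas[OF k] by measurable
  then show ?thesis by (simp add: good_def)
qed

private lemma weight_meas: "k \<ge> 1 \<Longrightarrow> (\<lambda>(\<omega>, \<omega>'). weight k \<omega> \<omega>') \<in> borel_measurable (borel \<Otimes>\<^sub>M borel)"
proof -
  assume k: "k \<ge> 1"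
  note [measurable] = good_meas[OF k] hit_meas[OF k]
  have "(\<lambda>p. if fst p \<in> good k then (if snd p \<in> nbhd (fst p) then 1 else 0) / hit k (fst p) else (1::real))
      \<in> borel_measurable (borel \<Otimes>\<^sub>M borel)" by measurable
  then show ?thesis by (rule measurable_cong[THEN iffD1, rotated]) (auto simp: weight_def indicator_def)
qed

private lemma weight_meas1: "k \<ge> 1 \<Longrightarrow> weight k \<omega> \<in> borel_measurable borel"
  using measurable_Pair2[OF weight_meas, of k \<omega>] by simp

private lemma weight_nonneg: "0 \<le> weight k \<omega> \<omega>'"
  by (auto simp: weight_def good_def)

private lemma weight_integral:
  assumes k: "k \<ge> 1"
  shows "(\<integral>\<^sup>+\<omega>'. ennreal (weight k \<omega> \<omega>') \<partial>R k (cpath \<omega> 0)) = 1"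
proof -
  interpret prob_space "R k (cpath \<omega> 0)" using ProbD[OF R_Prob[OF k]] by simp
  have n: "nbhd \<omega> \<in> events" using nbhd_open ProbD(2)[OF R_Prob[OF k]] by simp
  show ?thesis
  proof (cases "\<omega> \<in> good k")
    case True
    then have p: "0 < hit k \<omega>" by (simp add: good_def)
    have "(\<integral>\<^sup>+\<omega>'. ennreal (weight k \<omega> \<omega>') \<partial>R k (cpath \<omega> 0))
        = (\<integral>\<^sup>+\<omega>'. ennreal (1 / hit k \<omega>) * indicator (nbhd \<omega>) \<omega>' \<partial>R k (cpath \<omega> 0))"
      using True by (intro nn_integral_cong) (simp add: weight_def indicator_def)
    also have "\<dots> = ennreal (1 / hit k \<omega>) * ennreal (hit k \<omega>)"
      using n by (simp add: nn_integral_cmult_indicator emeasure_eq_measure hit_def)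
    also have "\<dots> = 1" using p by (simp add: ennreal_mult'[symmetric])
    finally show ?thesis .
  qed (simp add: weight_def emeasure_space_1)
qed

private lemma cond_kernel_meas: "k \<ge> 1 \<Longrightarrow> cond_kernel k \<in> borel \<rightarrow>\<^sub>M prob_algebra borel"
proof -
  assume k: "k \<ge> 1"
  have prob: "prob_space (cond_kernel k \<omega>)" for \<omega>
  proof (rule prob_spaceI)
    have "emeasure (cond_kernel k \<omega>) (space (cond_kernel k \<omega>))
        = (\<integral>\<^sup>+\<omega>'. ennreal (weight k \<omega> \<omega>') * indicator (space (R k (cpath \<omega> 0))) \<omega>' \<partial>R k (cpath \<omega> 0))"
      unfolding cond_kernel_def using weight_meas1[OF k]
      by (simp add: emeasure_density measurable_Prob[OF R_Prob[OF k]])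
    also have "\<dots> = (\<integral>\<^sup>+\<omega>'. ennreal (weight k \<omega> \<omega>') \<partial>R k (cpath \<omega> 0))"
      by (intro nn_integral_cong) simp
    also have "\<dots> = 1" by (rule weight_integral[OF k])
    finally show "emeasure (cond_kernel k \<omega>) (space (cond_kernel k \<omega>)) = 1" .
  qed
  show ?thesis
  proof (rule measurable_prob_algebraI[OF prob], rule measurable_subprob_algebra)
    show "subprob_space (cond_kernel k \<omega>)" for \<omega> by (rule prob_space_imp_subprob_space[OF prob])
    show "sets (cond_kernel k \<omega>) = sets borel" for \<omega>
      unfolding cond_kernel_def using ProbD(2)[OF R_Prob[OF k]] by simp
    fix S :: "'a cadlag set" assume S[measurable]: "S \<in> sets borel"
    have "(\<lambda>\<omega>. \<integral>\<^sup>+\<omega>'. ennreal (weight k \<omega> \<omega>') * indicator S \<omega>' \<partial>R k (cpath \<omega> 0)) \<in> borel_measurable borel"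
    proof (rule nn_integral_measurable_subprob_algebra2[OF _ kernel_X0[OF k]])
      show "(\<lambda>(\<omega>, \<omega>'). ennreal (weight k \<omega> \<omega>') * indicator S \<omega>') \<in> borel_measurable (borel \<Otimes>\<^sub>M borel)"
        using weight_meas[OF k] unfolding split_beta' by measurable
    qed
    also have "(\<lambda>\<omega>. \<integral>\<^sup>+\<omega>'. ennreal (weight k \<omega> \<omega>') * indicator S \<omega>' \<partial>R k (cpath \<omega> 0)) = (\<lambda>\<omega>. emeasure (cond_kernel k \<omega>) S)"
      unfolding cond_kernel_def using weight_meas1[OF k] ProbD(2)[OF R_Prob[OF k]]
      by (intro ext, subst emeasure_density) (auto simp: measurable_Prob[OF R_Prob[OF k]])
    finally show "(\<lambda>\<omega>. emeasure (cond_kernel k \<omega>) S) \<in> borel_measurable borel" .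
  qed
qed

private lemma rec_Prob: "k \<ge> 1 \<Longrightarrow> rec k \<in> Prob"
proof -
  assume k: "k \<ge> 1"
  have "cond_kernel k \<in> P \<rightarrow>\<^sub>M prob_algebra borel" using cond_kernel_meas[OF k] by (simp add: measurable_Prob[OF P])
  then show ?thesis unfolding rec_def
    using prob_space_bind'[OF P cond_kernel_meas[OF k]] sets_bind'[OF P cond_kernel_meas[OF k]] by (intro ProbI)
qed

private lemma nn_integral_rec:
  assumes k: "k \<ge> 1" and F[measurable]: "F \<in> borel_measurable borel"
  shows "(\<integral>\<^sup>+\<omega>. F \<omega> \<partial>rec k) = (\<integral>\<^sup>+\<omega>. \<integral>\<^sup>+\<omega>'. ennreal (weight k \<omega> \<omega>') * F \<omega>' \<partial>R k (cpath \<omega> 0) \<partial>P)"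
proof -
  have "(\<integral>\<^sup>+\<omega>. F \<omega> \<partial>rec k) = (\<integral>\<^sup>+\<omega>. \<integral>\<^sup>+\<omega>'. F \<omega>' \<partial>cond_kernel k \<omega> \<partial>P)" unfolding rec_def
    using measurable_prob_algebraD[OF cond_kernel_meas[OF k]] F
    by (intro nn_integral_bind[where B = borel]) (auto simp: measurable_Prob[OF P])
  also have "\<dots> = (\<integral>\<^sup>+\<omega>. \<integral>\<^sup>+\<omega>'. ennreal (weight k \<omega> \<omega>') * F \<omega>' \<partial>R k (cpath \<omega> 0) \<partial>P)"
    unfolding cond_kernel_def using weight_meas1[OF k]
    by (intro nn_integral_cong nn_integral_density) (auto simp: measurable_Prob[OF R_Prob[OF k]])
  finally show ?thesis .
qed

text \<open>Reweighting cannot move the initial point, since \<open>R k (cpath \<omega> 0)\<close>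
  is concentrated on paths that start at \<open>cpath \<omega> 0\<close> and the weights have total
  mass 1.\<close>

private lemma marginal_0_rec:
  assumes k: "k \<ge> 1"
  shows "marginal 0 (rec k) = marginal 0 P"
proof (rule measure_eqI)
  show "sets (marginal 0 (rec k)) = sets (marginal 0 P)" by (simp add: marginal_def)
  fix B assume "B \<in> sets (marginal 0 (rec k))"
  then have B[measurable]: "B \<in> sets borel" by (simp add: marginal_def)
  have em: "emeasure (marginal 0 Q) B = (\<integral>\<^sup>+\<omega>. indicator B (cpath \<omega> 0) \<partial>Q)" if Q: "Q \<in> Prob" for Q :: "'a cadlag measure"
  proof -
    have "emeasure (marginal 0 Q) B = (\<integral>\<^sup>+x. indicator B x \<partial>marginal 0 Q)"
      using B by (subst nn_integral_indicator) (auto simp: marginal_def)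
    then show ?thesis unfolding marginal_def
      by (subst (asm) nn_integral_distr) (auto simp: measurable_Prob[OF Q])
  qed
  have "emeasure (marginal 0 (rec k)) B
      = (\<integral>\<^sup>+\<omega>. \<integral>\<^sup>+\<omega>'. ennreal (weight k \<omega> \<omega>') * indicator B (cpath \<omega>' 0) \<partial>R k (cpath \<omega> 0) \<partial>P)"
    unfolding em[OF rec_Prob[OF k]] by (intro nn_integral_rec[OF k]) measurable
  also have "\<dots> = (\<integral>\<^sup>+\<omega>. indicator B (cpath \<omega> 0) \<partial>P)"
  proof (rule nn_integral_cong)
    fix \<omega>
    have "(\<integral>\<^sup>+\<omega>'. ennreal (weight k \<omega> \<omega>') * indicator B (cpath \<omega>' 0) \<partial>R k (cpath \<omega> 0))
        = (\<integral>\<^sup>+\<omega>'. ennreal (weight k \<omega> \<omega>') * indicator B (cpath \<omega> 0) \<partial>R k (cpath \<omega> 0))"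
      using AE_start[OF k, of "cpath \<omega> 0"] by (intro nn_integral_cong_AE, eventually_elim) simp
    also have "\<dots> = indicator B (cpath \<omega> 0)"
      using weight_meas1[OF k, of \<omega>] weight_integral[OF k, of \<omega>]
      by (subst nn_integral_multc) (auto simp: measurable_Prob[OF R_Prob[OF k]])
    finally show "(\<integral>\<^sup>+\<omega>'. ennreal (weight k \<omega> \<omega>') * indicator B (cpath \<omega>' 0) \<partial>R k (cpath \<omega> 0)) = indicator B (cpath \<omega> 0)" .
  qed
  also have "\<dots> = emeasure (marginal 0 P) B" using em[OF P] by simp
  finally show "emeasure (marginal 0 (rec k)) B = emeasure (marginal 0 P) B" .
qed

section \<open>Cost and final marginal of the mixture\<close>

private lemma c_integral: "integrable P c" "ereal (\<integral>\<omega>. c \<omega> \<partial>P) = enn2ereal (MK_cost C P)" "AE \<omega> in P. C \<omega> < \<infinity>"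
proof -
  have Cm: "C \<in> borel_measurable P" by (simp add: measurable_Prob[OF P])
  have "(\<integral>\<^sup>+\<omega>. C \<omega> \<partial>P) \<noteq> \<infinity>" using fin by (simp add: MK_cost_def less_top)
  then have "AE \<omega> in P. C \<omega> \<noteq> \<infinity>" using Cm by (rule nn_integral_noteq_infinite[rotated])
  then show ae: "AE \<omega> in P. C \<omega> < \<infinity>" by (simp add: less_top)
  have eq: "(\<integral>\<^sup>+\<omega>. ennreal (c \<omega>) \<partial>P) = MK_cost C P"
    unfolding MK_cost_def using ae by (intro nn_integral_cong_AE, eventually_elim) simp
  then show int: "integrable P c" using fin Cm by (intro integrableI_nonneg) auto
  have "MK_cost C P = ennreal (\<integral>\<omega>. c \<omega> \<partial>P)" unfolding eq[symmetric]
    using int by (intro nn_integral_eq_integral) auto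
  then show "ereal (\<integral>\<omega>. c \<omega> \<partial>P) = enn2ereal (MK_cost C P)" by (simp add: enn2ereal_ennreal integral_nonneg_AE)
qed

text \<open>The density of the mixture is never computed. Young's inequality is applied to the
  weight of each pair of paths against a common test function and then integrated; this is the joint
  convexity of entropy in dual form, and \<open>rel_entropy_leI\<close> converts it back.\<close>

private lemma S_cost_rec:
  assumes k: "k \<ge> 1"
  shows "S_cost R (marginal 0 P) k (rec k) \<le> enn2ereal (MK_cost C P) + ereal \<epsilon>"
proof -
  interpret P: prob_space P using ProbD[OF P] by simp
  let ?\<mu> = "marginal 0 P"
  define m where "m = (\<integral>\<omega>. c \<omega> \<partial>P)"
  have \<mu>: "?\<mu> \<in> Prob" by (intro marginal_Prob P) simp
  have b\<mu>: "?\<mu> \<bind> R k \<in> Prob" by (rule bind_Prob[OF k \<mu>])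
  have "rel_entropy (rec k) (?\<mu> \<bind> R k) \<le> ereal (real k * (m + \<epsilon>))"
  proof (rule rel_entropy_leI)
    show "prob_space (rec k)" "prob_space (?\<mu> \<bind> R k)" "sets (rec k) = sets (?\<mu> \<bind> R k)"
      using ProbD[OF rec_Prob[OF k]] ProbD[OF b\<mu>] by auto
    fix g :: "'a cadlag \<Rightarrow> real" and B
    assume "g \<in> borel_measurable (?\<mu> \<bind> R k)" and gB: "\<And>\<omega>. \<bar>g \<omega>\<bar> \<le> B" and ge: "(\<integral>\<omega>. exp (g \<omega>) \<partial>(?\<mu> \<bind> R k)) \<le> 1"
    then have g[measurable]: "g \<in> borel_measurable borel" by (simp add: measurable_Prob[OF b\<mu>])
    have B0: "0 \<le> B" using gB[of undefined] by linarith
    have gB': "0 \<le> g \<omega> + B + 1" for \<omega> using gB[of \<omega>] by linarith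
    have exp_int: "(\<integral>\<^sup>+\<omega>. \<integral>\<^sup>+\<omega>'. ennreal (exp (g \<omega>')) \<partial>R k (cpath \<omega> 0) \<partial>P) \<le> 1"
    proof -
      have "(\<integral>\<^sup>+x. \<integral>\<^sup>+\<omega>'. ennreal (exp (g \<omega>')) \<partial>R k x \<partial>?\<mu>) = (\<integral>\<^sup>+\<omega>. \<integral>\<^sup>+\<omega>'. ennreal (exp (g \<omega>')) \<partial>R k (cpath \<omega> 0) \<partial>P)"
      proof -
        have "(\<lambda>x. \<integral>\<^sup>+\<omega>'. ennreal (exp (g \<omega>')) \<partial>R k x) \<in> borel_measurable borel"
          by (rule measurable_compose[OF R_subprob[OF k] nn_integral_measurable_subprob_algebra]) measurable
        then show ?thesis unfolding marginal_def by (intro nn_integral_distr) (auto simp: measurable_Prob[OF P])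
      qed
      moreover have "(\<integral>\<^sup>+x. \<integral>\<^sup>+\<omega>'. ennreal (exp (g \<omega>')) \<partial>R k x \<partial>?\<mu>) = (\<integral>\<^sup>+\<omega>. ennreal (exp (g \<omega>)) \<partial>(?\<mu> \<bind> R k))"
        using R_subprob[OF k] by (intro nn_integral_bind[where B = borel, symmetric]) (auto simp: measurable_Prob[OF \<mu>])
      moreover have "(\<integral>\<^sup>+\<omega>. ennreal (exp (g \<omega>)) \<partial>(?\<mu> \<bind> R k)) = ennreal (\<integral>\<omega>. exp (g \<omega>) \<partial>(?\<mu> \<bind> R k))"
        using gB by (intro nn_integral_eq_integral integrable_bounded_Prob[OF b\<mu>, of _ "exp B"]) (auto simp: abs_le_iff)
      ultimately show ?thesis using ennreal_leI[OF ge] by simp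
    qed
    \<comment> \<open>Adding \<open>B\<close> makes the test function non-negative, and the further
      1 absorbs the term minus weight from Young's inequality; both cancel after
      integration.\<close>
    have pointwise: "ennreal (weight k \<omega> \<omega>') * ennreal (g \<omega>' + B + 1)
        \<le> ennreal (exp (g \<omega>')) + ennreal (real k * (c \<omega> + \<epsilon>) + B) * ennreal (weight k \<omega> \<omega>')" for \<omega> \<omega>'
    proof -
      let ?w = "weight k \<omega> \<omega>'"
      have ce: "0 \<le> real k * (c \<omega> + \<epsilon>)" using \<epsilon> by simp
      have "?w * ln ?w \<le> ?w * (real k * (c \<omega> + \<epsilon>))"
      proof (cases "\<omega> \<in> good k \<and> \<omega>' \<in> nbhd \<omega>")
        case True
        then have "ln ?w \<le> real k * (c \<omega> + \<epsilon>)" by (simp add: weight_def good_def ln_div)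
        then show ?thesis using weight_nonneg by (rule mult_left_mono)
      next
        case False
        then show ?thesis using ce by (auto simp: weight_def)
      qed
      moreover have "g \<omega>' * ?w \<le> ?w * ln ?w - ?w + exp (g \<omega>')"
        using ent_fun_young[OF weight_nonneg, of "g \<omega>'" k \<omega> \<omega>'] by (simp add: ent_fun_def)
      ultimately have "?w * (g \<omega>' + B + 1) \<le> exp (g \<omega>') + (real k * (c \<omega> + \<epsilon>) + B) * ?w"
        by (simp add: algebra_simps)
      then have "ennreal (?w * (g \<omega>' + B + 1)) \<le> ennreal (exp (g \<omega>') + (real k * (c \<omega> + \<epsilon>) + B) * ?w)"
        by (rule ennreal_leI)
      then show ?thesis using weight_nonneg[of k \<omega> \<omega>'] ce B0 gB'[of \<omega>']
        by (simp add: ennreal_mult)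
    qed
    have "(\<integral>\<^sup>+\<omega>. ennreal (g \<omega> + B + 1) \<partial>rec k)
        = (\<integral>\<^sup>+\<omega>. \<integral>\<^sup>+\<omega>'. ennreal (weight k \<omega> \<omega>') * ennreal (g \<omega>' + B + 1) \<partial>R k (cpath \<omega> 0) \<partial>P)"
      by (rule nn_integral_rec[OF k]) measurable
    also have "\<dots> \<le> (\<integral>\<^sup>+\<omega>. (\<integral>\<^sup>+\<omega>'. ennreal (exp (g \<omega>')) \<partial>R k (cpath \<omega> 0)) + ennreal (real k * (c \<omega> + \<epsilon>) + B) \<partial>P)"
    proof (rule nn_integral_mono)
      fix \<omega>
      have "(\<integral>\<^sup>+\<omega>'. ennreal (weight k \<omega> \<omega>') * ennreal (g \<omega>' + B + 1) \<partial>R k (cpath \<omega> 0))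
          \<le> (\<integral>\<^sup>+\<omega>'. ennreal (exp (g \<omega>')) + ennreal (real k * (c \<omega> + \<epsilon>) + B) * ennreal (weight k \<omega> \<omega>') \<partial>R k (cpath \<omega> 0))"
        by (intro nn_integral_mono pointwise)
      also have "\<dots> = (\<integral>\<^sup>+\<omega>'. ennreal (exp (g \<omega>')) \<partial>R k (cpath \<omega> 0))
          + ennreal (real k * (c \<omega> + \<epsilon>) + B) * (\<integral>\<^sup>+\<omega>'. ennreal (weight k \<omega> \<omega>') \<partial>R k (cpath \<omega> 0))"
        using weight_meas1[OF k, of \<omega>]
        by (subst nn_integral_add) (auto simp: measurable_Prob[OF R_Prob[OF k]] nn_integral_cmult)
      finally show "(\<integral>\<^sup>+\<omega>'. ennreal (weight k \<omega> \<omega>') * ennreal (g \<omega>' + B + 1) \<partial>R k (cpath \<omega> 0))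
          \<le> (\<integral>\<^sup>+\<omega>'. ennreal (exp (g \<omega>')) \<partial>R k (cpath \<omega> 0)) + ennreal (real k * (c \<omega> + \<epsilon>) + B)"
        by (simp add: weight_integral[OF k])
    qed
    also have "\<dots> = (\<integral>\<^sup>+\<omega>. \<integral>\<^sup>+\<omega>'. ennreal (exp (g \<omega>')) \<partial>R k (cpath \<omega> 0) \<partial>P) + (\<integral>\<^sup>+\<omega>. ennreal (real k * (c \<omega> + \<epsilon>) + B) \<partial>P)"
    proof (rule nn_integral_add)
      show "(\<lambda>\<omega>. \<integral>\<^sup>+\<omega>'. ennreal (exp (g \<omega>')) \<partial>R k (cpath \<omega> 0)) \<in> borel_measurable P"
        unfolding measurable_Prob[OF P]
        by (rule measurable_compose[OF kernel_X0[OF k] nn_integral_measurable_subprob_algebra]) measurable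
    qed (simp add: measurable_Prob[OF P])
    also have "(\<integral>\<^sup>+\<omega>. ennreal (real k * (c \<omega> + \<epsilon>) + B) \<partial>P) = ennreal (\<integral>\<omega>. real k * (c \<omega> + \<epsilon>) + B \<partial>P)"
      using c_integral(1) \<epsilon> B0 by (intro nn_integral_eq_integral) auto
    also have "(\<integral>\<omega>. real k * (c \<omega> + \<epsilon>) + B \<partial>P) = real k * (m + \<epsilon>) + B"
      using c_integral(1) by (simp add: P.prob_space m_def)
    also have "(\<integral>\<^sup>+\<omega>. \<integral>\<^sup>+\<omega>'. ennreal (exp (g \<omega>')) \<partial>R k (cpath \<omega> 0) \<partial>P) + ennreal (real k * (m + \<epsilon>) + B)
        \<le> 1 + ennreal (real k * (m + \<epsilon>) + B)" using exp_int by (rule add_right_mono)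
    finally have le: "(\<integral>\<^sup>+\<omega>. ennreal (g \<omega> + B + 1) \<partial>rec k) \<le> 1 + ennreal (real k * (m + \<epsilon>) + B)" .
    have m0: "0 \<le> m" unfolding m_def by (simp add: integral_nonneg_AE)
    interpret rec: prob_space "rec k" using ProbD[OF rec_Prob[OF k]] by simp
    have int_g: "integrable (rec k) g" by (rule integrable_bounded_Prob[OF rec_Prob[OF k] g gB])
    have "(\<integral>\<^sup>+\<omega>. ennreal (g \<omega> + B + 1) \<partial>rec k) = ennreal (\<integral>\<omega>. g \<omega> + B + 1 \<partial>rec k)"
      using gB' int_g by (intro nn_integral_eq_integral) auto
    with le have "ennreal (\<integral>\<omega>. g \<omega> + B + 1 \<partial>rec k) \<le> ennreal (1 + (real k * (m + \<epsilon>) + B))"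
      using m0 \<epsilon> B0 by simp
    then have "(\<integral>\<omega>. g \<omega> + B + 1 \<partial>rec k) \<le> 1 + (real k * (m + \<epsilon>) + B)"
      using m0 \<epsilon> B0 by (subst (asm) ennreal_le_iff) auto
    then show "(\<integral>\<omega>. g \<omega> \<partial>rec k) \<le> real k * (m + \<epsilon>)" using int_g by (simp add: rec.prob_space)
  qed
  then have "S_cost R ?\<mu> k (rec k) \<le> ereal (1 / real k) * ereal (real k * (m + \<epsilon>))"
    unfolding S_cost_def by (intro ereal_mult_left_mono) auto
  also have "\<dots> = ereal m + ereal \<epsilon>" using k by simp
  finally show ?thesis unfolding m_def c_integral(2) .
qed

text \<open>Two errors of size \<open>m * \<delta>\<close> add up: the end point moves by less than
  \<open>\<delta>\<close> under a function of Lipschitz constant \<open>m\<close>, and paths outside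
  \<open>good k\<close>, of mass at most \<open>\<delta>\<close>, lose at most \<open>m\<close>.
  Since \<open>h\<close> is non-negative, those paths may simply be dropped in a lower
  bound.\<close>

private lemma integral_marginal_1_rec:
  fixes h :: "'a \<Rightarrow> real"
  assumes k: "k \<ge> 1" and h: "h \<in> borel_measurable borel" "\<And>x. 0 \<le> h x" "\<And>x. h x \<le> m" and m: "0 \<le> m"
    and lip: "\<And>x y. \<bar>h x - h y\<bar> \<le> m * dist x y" and bad: "1 - \<delta> \<le> measure P (good k)"
  shows "(\<integral>x. h x \<partial>marginal 1 P) - 2 * m * \<delta> \<le> (\<integral>x. h x \<partial>marginal 1 (rec k))"
proof -
  interpret P: prob_space P using ProbD[OF P] by simp
  note h(1)[measurable] good_meas[OF k, measurable]
  have goodP: "good k \<in> P.events" using good_meas[OF k] ProbD(2)[OF P] by simp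
  define q where "q \<omega> = (h (cpath \<omega> 1) - m * \<delta>) * indicator (good k) \<omega>" for \<omega>
  have q_meas: "q \<in> borel_measurable borel" unfolding q_def by measurable
  have "m * \<delta> \<ge> 0" using m \<delta> by simp
  then have q_b: "\<bar>q \<omega>\<bar> \<le> m + m * \<delta>" for \<omega>
  proof -
    have "\<bar>h (cpath \<omega> 1) - m * \<delta>\<bar> \<le> m + m * \<delta>" "0 \<le> m + m * \<delta>"
      using h(2)[of "cpath \<omega> 1"] h(3)[of "cpath \<omega> 1"] m \<open>m * \<delta> \<ge> 0\<close> by linarith+
    then show ?thesis by (cases "\<omega> \<in> good k") (simp_all add: q_def)
  qed
  have int_q: "integrable P q" by (rule integrable_bounded_Prob[OF P q_meas q_b])
  have int_h: "integrable P (\<lambda>\<omega>. h (cpath \<omega> 1))"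
    by (rule integrable_bounded_Prob[OF P, of _ m]) (use h in auto)
  have "(\<integral>\<omega>. h (cpath \<omega> 1) - m * \<delta> - m * indicator (- good k) \<omega> \<partial>P) \<le> (\<integral>\<omega>. q \<omega> \<partial>P)"
  proof (rule integral_mono[OF _ int_q])
    have "integrable P (indicat_real (- good k))"
      using sets.compl_sets[OF goodP] ProbD(3)[OF P] by (intro integrable_real_indicator) (auto simp: Compl_eq_Diff_UNIV P.emeasure_eq_measure)
    then show "integrable P (\<lambda>\<omega>. h (cpath \<omega> 1) - m * \<delta> - m * indicator (- good k) \<omega>)"
      using int_h by auto
    show "h (cpath \<omega> 1) - m * \<delta> - m * indicator (- good k) \<omega> \<le> q \<omega>" for \<omega>
      using h(3)[of "cpath \<omega> 1"] \<open>m * \<delta> \<ge> 0\<close> by (auto simp: q_def indicator_def)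
  qed
  moreover have "(\<integral>\<omega>. h (cpath \<omega> 1) - m * \<delta> - m * indicator (- good k) \<omega> \<partial>P)
      = (\<integral>\<omega>. h (cpath \<omega> 1) \<partial>P) - m * \<delta> - m * P.prob (- good k)"
  proof -
    have "- good k \<in> P.events" using goodP ProbD(3)[OF P] sets.compl_sets[OF goodP] by (simp add: Compl_eq_Diff_UNIV)
    then show ?thesis using int_h by (simp add: P.prob_space P.emeasure_eq_measure)
  qed
  moreover have "m * P.prob (- good k) \<le> m * \<delta>"
    using bad P.prob_compl[OF goodP] m ProbD(3)[OF P] by (intro mult_left_mono) (auto simp: Compl_eq_Diff_UNIV)
  moreover have "(\<integral>\<omega>. q \<omega> \<partial>P) \<le> (\<integral>\<omega>. h (cpath \<omega> 1) \<partial>rec k)"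
  proof -
    have "(\<integral>\<^sup>+\<omega>. ennreal (q \<omega>) \<partial>P) \<le> (\<integral>\<^sup>+\<omega>. \<integral>\<^sup>+\<omega>'. ennreal (weight k \<omega> \<omega>') * ennreal (h (cpath \<omega>' 1)) \<partial>R k (cpath \<omega> 0) \<partial>P)"
    proof (rule nn_integral_mono)
      fix \<omega>
      show "ennreal (q \<omega>) \<le> (\<integral>\<^sup>+\<omega>'. ennreal (weight k \<omega> \<omega>') * ennreal (h (cpath \<omega>' 1)) \<partial>R k (cpath \<omega> 0))"
      proof (cases "\<omega> \<in> good k")
        case True
        have "ennreal (q \<omega>) = (\<integral>\<^sup>+\<omega>'. ennreal (weight k \<omega> \<omega>') * ennreal (q \<omega>) \<partial>R k (cpath \<omega> 0))"
          using weight_meas1[OF k, of \<omega>] weight_integral[OF k, of \<omega>]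
          by (subst nn_integral_multc) (auto simp: measurable_Prob[OF R_Prob[OF k]])
        also have "\<dots> \<le> (\<integral>\<^sup>+\<omega>'. ennreal (weight k \<omega> \<omega>') * ennreal (h (cpath \<omega>' 1)) \<partial>R k (cpath \<omega> 0))"
        proof (rule nn_integral_mono)
          fix \<omega>'
          show "ennreal (weight k \<omega> \<omega>') * ennreal (q \<omega>) \<le> ennreal (weight k \<omega> \<omega>') * ennreal (h (cpath \<omega>' 1))"
          proof (cases "\<omega>' \<in> nbhd \<omega>")
            case nb: True
            have "\<bar>h (cpath \<omega>' 1) - h (cpath \<omega> 1)\<bar> \<le> m * dist (cpath \<omega>' 1) (cpath \<omega> 1)" by (rule lip)
            also have "\<dots> \<le> m * \<delta>" using nb m by (intro mult_left_mono) (auto simp: nbhd_def)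
            finally have "q \<omega> \<le> h (cpath \<omega>' 1)" using True by (simp add: q_def)
            then show ?thesis by (intro mult_left_mono ennreal_leI) auto
          qed (use True in \<open>simp add: weight_def\<close>)
        qed
        finally show ?thesis .
      qed (simp add: q_def)
    qed
    also have "\<dots> = (\<integral>\<^sup>+\<omega>. ennreal (h (cpath \<omega> 1)) \<partial>rec k)"
      by (rule nn_integral_rec[OF k, symmetric]) measurable
    also have "\<dots> = ennreal (\<integral>\<omega>. h (cpath \<omega> 1) \<partial>rec k)"
      using h by (intro nn_integral_eq_integral integrable_bounded_Prob[OF rec_Prob[OF k], of _ m]) auto
    finally have "(\<integral>\<^sup>+\<omega>. ennreal (q \<omega>) \<partial>P) \<le> ennreal (\<integral>\<omega>. h (cpath \<omega> 1) \<partial>rec k)" .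
    then have "enn2real (\<integral>\<^sup>+\<omega>. ennreal (q \<omega>) \<partial>P) \<le> (\<integral>\<omega>. h (cpath \<omega> 1) \<partial>rec k)"
      by (rule enn2real_leI[rotated]) (simp add: h integral_nonneg_AE)
    \<comment> \<open>The function \<open>q\<close> may be negative; \<open>ennreal\<close> keeps
      its positive part, whose integral is the larger one.\<close>
    moreover have "(\<integral>\<omega>. q \<omega> \<partial>P) \<le> enn2real (\<integral>\<^sup>+\<omega>. ennreal (q \<omega>) \<partial>P)"
      using int_q by (subst real_lebesgue_integral_def) auto
    ultimately show ?thesis by simp
  qed
  ultimately show ?thesis
    using integral_marginal[OF h(1), of 1 P] integral_marginal[OF h(1), of 1 "rec k"] P rec_Prob[OF k] by simp
qed

text \<open>The path \<omega> lies in its own neighbourhood and starts at its own initial point, so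
  the infimum of the rate there is at most \<open>C \<omega>\<close>; the lower bound with slack
  \<open>\<epsilon>\<close> is the defining inequality of \<open>good k\<close>.\<close>

private lemma eventually_in_good:
  assumes "C \<omega> < \<infinity>"
  shows "\<forall>\<^sub>F k in sequentially. \<omega> \<in> good k"
proof -
  let ?x = "cpath \<omega> 0"
  have cC: "enn2ereal (C \<omega>) = ereal (c \<omega>)" using assms by (cases "C \<omega>") (auto simp: enn2ereal_ennreal)
  have "\<omega> \<in> nbhd \<omega>" using \<delta> by (simp add: nbhd_def)
  then have "(INF \<omega>'\<in>nbhd \<omega>. enn2ereal (rate ?x \<omega>')) \<le> enn2ereal (rate ?x \<omega>)" by (rule INF_lower)
  also have "\<dots> = ereal (c \<omega>)" using cC by (simp add: convex_indicator_def)
  finally have "- ereal (c \<omega>) \<le> - (INF \<omega>'\<in>nbhd \<omega>. enn2ereal (rate ?x \<omega>'))"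
    unfolding ereal_minus_le_minus .
  also have "\<dots> \<le> liminf (\<lambda>k. ereal (1 / real k) * log_prob (R k ?x) (nbhd \<omega>))"
    using LDP_D(2)[OF ldp[of ?x], of "nbhd \<omega>"] nbhd_open interior_open[OF nbhd_open] by simp
  finally have "ereal (- (c \<omega> + \<epsilon>)) < liminf (\<lambda>k. ereal (1 / real k) * log_prob (R k ?x) (nbhd \<omega>))"
    by (rule less_le_trans[rotated]) (use \<epsilon> in simp)
  then have "\<forall>\<^sub>F k in sequentially. ereal (- (c \<omega> + \<epsilon>)) < ereal (1 / real k) * log_prob (R k ?x) (nbhd \<omega>)"
    by (rule less_LiminfD)
  then show ?thesis using eventually_ge_at_top[of 1]
  proof eventually_elim
    case (elim k)
    have "hit k \<omega> \<noteq> 0" using elim by (auto simp: log_prob_def hit_def)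
    then have pos: "0 < hit k \<omega>" by (simp add: hit_def zero_less_measure_iff)
    then have "- (c \<omega> + \<epsilon>) < ln (hit k \<omega>) / real k" using elim by (simp add: log_prob_def hit_def)
    then have "- ln (hit k \<omega>) \<le> real k * (c \<omega> + \<epsilon>)" using elim(2) by (simp add: field_simps)
    then show ?case using pos assms by (simp add: good_def)
  qed
qed

private lemma good_measure: "\<forall>\<^sub>F k in sequentially. 1 - \<delta> \<le> measure P (good k)"
proof -
  interpret P: prob_space P using ProbD[OF P] by simp
  \<comment> \<open>The sets \<open>good k\<close> are known to be measurable for
    \<open>k \<ge> 1\<close>, hence the shift to \<open>Suc k\<close>.\<close>
  have ev: "good (Suc k) \<in> P.events" for k using good_meas[of "Suc k"] ProbD(2)[OF P] by simp
  have "(\<lambda>k. \<integral>\<omega>. indicat_real (good (Suc k)) \<omega> \<partial>P) \<longlonglongrightarrow> (\<integral>\<omega>. 1 \<partial>P)"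
  proof (rule integral_dominated_convergence[where w = "\<lambda>_. 1"])
    show "AE \<omega> in P. (\<lambda>k. indicat_real (good (Suc k)) \<omega>) \<longlonglongrightarrow> 1"
      using c_integral(3)
    proof eventually_elim
      case (elim \<omega>)
      from eventually_in_good[OF elim] have "\<forall>\<^sub>F k in sequentially. \<omega> \<in> good (Suc k)"
        by (subst eventually_sequentially_Suc)
      then show ?case by (intro tendsto_eventually, eventually_elim) simp
    qed
  qed (use ev in \<open>auto simp: indicator_def\<close>)
  then have "(\<lambda>k. P.prob (good (Suc k))) \<longlonglongrightarrow> 1" using ev by (simp add: P.prob_space)
  then have "(\<lambda>k. P.prob (good k)) \<longlonglongrightarrow> 1" by (rule LIMSEQ_imp_Suc)
  then have "\<forall>\<^sub>F k in sequentially. 1 - \<delta> < P.prob (good k)" using \<delta> by (intro order_tendstoD(1)) auto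
  then show ?thesis by eventually_elim simp
qed

text \<open>For given tolerances one k serves all test functions \<open>h\<close> at once; the later
  diagonal choice of tolerances depends on this uniformity.\<close>

lemma eventually_recovery:
  "\<forall>\<^sub>F k in sequentially. \<exists>Q\<in>Prob. marginal 0 Q = marginal 0 P \<and>
     S_cost R (marginal 0 P) k Q \<le> enn2ereal (MK_cost C P) + ereal \<epsilon> \<and>
     (\<forall>h m. h \<in> borel_measurable borel \<longrightarrow> (\<forall>x. 0 \<le> h x \<and> h x \<le> m) \<longrightarrow> 0 \<le> m \<longrightarrow>
        (\<forall>x y. \<bar>h x - h y\<bar> \<le> m * dist x y) \<longrightarrow>
        (\<integral>x. h x \<partial>marginal 1 P) - 2 * m * \<delta> \<le> (\<integral>x. h x \<partial>marginal 1 Q))"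
  using good_measure eventually_ge_at_top[of 1]
proof eventually_elim
  case (elim k)
  show ?case
    by (intro bexI[of _ "rec k"] conjI allI impI rec_Prob marginal_0_rec S_cost_rec integral_marginal_1_rec elim) auto
qed

end

end

section \<open>The Schroedinger and Monge-Kantorovich problems\<close>

text \<open>\<open>idx k\<close> is the largest \<open>n\<close> up to \<open>k\<close> whose
  threshold \<open>N n\<close> has been passed; the cap by \<open>k\<close> keeps the set
  finite.\<close>

lemma diagonal_index:
  fixes \<Phi> :: "nat \<Rightarrow> nat \<Rightarrow> bool"
  assumes "\<And>n. \<forall>\<^sub>F k in sequentially. \<Phi> n k"
  shows "\<exists>idx. filterlim idx at_top sequentially \<and> (\<forall>\<^sub>F k in sequentially. \<Phi> (idx k) k)"
proof -
  obtain N where N: "\<And>n k. k \<ge> N n \<Longrightarrow> \<Phi> n k"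
    using assms unfolding eventually_sequentially by metis
  define idx where "idx k = Max {n. n \<le> k \<and> N n \<le> k}" for k
  have fin: "finite {n. n \<le> k \<and> N n \<le> k}" for k by simp
  have ge: "n \<le> idx k" if "n \<le> k" "N n \<le> k" for n k
    unfolding idx_def using that fin by (intro Max_ge) auto
  have "\<forall>\<^sub>F k in sequentially. n \<le> idx k" for n
    using eventually_ge_at_top[of "max n (N n)"] by eventually_elim (simp add: ge)
  moreover have "\<forall>\<^sub>F k in sequentially. \<Phi> (idx k) k"
    using eventually_ge_at_top[of "N 0"]
  proof eventually_elim
    case (elim k)
    then have "idx k \<in> {n. n \<le> k \<and> N n \<le> k}" unfolding idx_def by (intro Max_in fin) auto
    then show ?case using N by simp
  qed
  ultimately show ?thesis unfolding filterlim_at_top by blast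
qed

text \<open>Rewrites a marginal condition as constraints on measures of sets, the form in which
  \<open>entropy_minimizer_ex1\<close> accepts it.\<close>

lemma marginal_eq_iff:
  assumes P: "P \<in> Prob" and \<mu>: "\<mu> \<in> Prob" and t: "t \<in> {0, 1}"
  shows "marginal t P = \<mu> \<longleftrightarrow> (\<forall>B\<in>sets borel. measure P ((\<lambda>\<omega>. cpath \<omega> t) -` B) = measure \<mu> B)"
proof -
  have X: "(\<lambda>\<omega>. cpath \<omega> t) \<in> P \<rightarrow>\<^sub>M borel" using endpoint_measurable[OF t] by (simp add: measurable_Prob[OF P])
  interpret M: prob_space "marginal t P" using ProbD[OF marginal_Prob[OF t P]] by simp
  interpret \<mu>: prob_space \<mu> using ProbD[OF \<mu>] by simp
  have eq: "measure (marginal t P) B = measure P ((\<lambda>\<omega>. cpath \<omega> t) -` B)" if "B \<in> sets borel" for B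
    unfolding marginal_def using X that ProbD(3)[OF P] by (simp add: measure_distr)
  show ?thesis
  proof
    assume "\<forall>B\<in>sets borel. measure P ((\<lambda>\<omega>. cpath \<omega> t) -` B) = measure \<mu> B"
    then show "marginal t P = \<mu>"
      using eq ProbD(2)[OF marginal_Prob[OF t P]] ProbD(2)[OF \<mu>]
      by (intro measure_eqI) (auto simp: M.emeasure_eq_measure \<mu>.emeasure_eq_measure)
  qed (use eq in auto)
qed

lemma couplings_dynD:
  assumes "P \<in> couplings_dyn \<mu> \<nu>"
  shows "P \<in> Prob" "marginal 0 P = \<mu>" "marginal 1 P = \<nu>"
  using assms by (auto simp: couplings_dyn_def)

section \<open>Solutions of the Schroedinger problems at fixed k\<close>

context ldp_kernel
begin

lemma S_cost_nonneg:
  assumes "k \<ge> 1" "\<mu> \<in> Prob" "P \<in> Prob"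
  shows "0 \<le> S_cost R \<mu> k P"
  using rel_entropy_nonneg[of P "\<mu> \<bind> R k"] ProbD[OF assms(3)] ProbD[OF bind_Prob[OF assms(1,2)]]
  by (simp add: S_cost_def)

lemma S_solution_ex1:
  assumes k: "k \<ge> 1" and \<mu>: "\<mu> \<in> Prob" and \<nu>: "\<nu> \<in> Prob" and fin: "S_inf R \<mu> k \<nu> < \<infinity>"
  shows "\<exists>!P. S_solution R \<mu> k \<nu> P"
proof -
  let ?B = "\<mu> \<bind> R k"
  have b: "?B \<in> Prob" by (rule bind_Prob[OF k \<mu>])
  define S where "S = (\<lambda>B. ((\<lambda>\<omega> :: 'a cadlag. cpath \<omega> 0) -` B, measure \<mu> B)) ` sets borel
    \<union> (\<lambda>B. ((\<lambda>\<omega>. cpath \<omega> 1) -` B, measure \<nu> B)) ` sets borel"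
  have K: "couplings_dyn \<mu> \<nu> = {P. prob_space P \<and> sets P = sets ?B \<and> (\<forall>(A, v)\<in>S. measure P A = v)}"
  proof (rule set_eqI)
    fix P
    have "P \<in> Prob \<longleftrightarrow> prob_space P \<and> sets P = sets ?B"
      using ProbD[of P] ProbI[of P] ProbD(2)[OF b] by auto
    moreover have "(\<forall>(A, v)\<in>S. measure P A = v) \<longleftrightarrow>
        (\<forall>B\<in>sets borel. measure P ((\<lambda>\<omega>. cpath \<omega> 0) -` B) = measure \<mu> B) \<and>
        (\<forall>B\<in>sets borel. measure P ((\<lambda>\<omega>. cpath \<omega> 1) -` B) = measure \<nu> B)"
      by (simp add: S_def ball_Un)
    ultimately show "P \<in> couplings_dyn \<mu> \<nu> \<longleftrightarrow>
        P \<in> {P. prob_space P \<and> sets P = sets ?B \<and> (\<forall>(A, v)\<in>S. measure P A = v)}"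
      using marginal_eq_iff[OF _ \<mu>, of P 0] marginal_eq_iff[OF _ \<nu>, of P 1]
      by (auto simp: couplings_dyn_def)
  qed
  have S: "A \<in> sets ?B" if "(A, v) \<in> S" for A v
    using that measurable_sets[OF endpoint_measurable[of 0]] measurable_sets[OF endpoint_measurable[of 1]]
      ProbD(2)[OF b] by (auto simp: S_def)
  obtain P0 where P0: "P0 \<in> couplings_dyn \<mu> \<nu>" "S_cost R \<mu> k P0 < \<infinity>"
    using fin unfolding S_inf_def INF_less_iff by blast
  have "rel_entropy P0 ?B < \<infinity>"
  proof (rule ccontr)
    assume "\<not> ?thesis"
    then have "rel_entropy P0 ?B = \<infinity>" by simp
    then show False using P0(2) k by (simp add: S_cost_def)
  qed
  with P0(1) have "\<exists>!P. is_arg_min (\<lambda>P. rel_entropy P ?B) (\<lambda>P. P \<in> couplings_dyn \<mu> \<nu>) P"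
    unfolding K using S ProbD(1)[OF b] by (intro entropy_minimizer_ex1) auto
  moreover have "S_cost R \<mu> k P < S_cost R \<mu> k Q \<longleftrightarrow> rel_entropy P ?B < rel_entropy Q ?B" for P Q
    unfolding S_cost_def using k by (simp add: ereal_mult_le_mult_iff flip: not_le)
  ultimately show ?thesis by (simp add: S_solution_def is_arg_min_def)
qed

lemma S_solutionD:
  assumes "S_solution R \<mu> k \<nu> P"
  shows "P \<in> couplings_dyn \<mu> \<nu>" "S_cost R \<mu> k P \<le> S_inf R \<mu> k \<nu>"
  using assms by (auto simp: S_solution_def is_arg_min_def S_inf_def not_less intro: INF_greatest)

section \<open>Convergence of the infima\<close>

context
  fixes \<mu>\<^sub>0 \<mu>\<^sub>1 :: "'a measure"
  assumes \<mu>\<^sub>0: "\<mu>\<^sub>0 \<in> Prob" and \<mu>\<^sub>1: "\<mu>\<^sub>1 \<in> Prob"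
begin

text \<open>A bound valid infinitely often already bounds the limit problem: along those indices
  admissible measures of bounded cost have a cluster point, which is admissible in the limit with
  cost at most \<open>a\<close>.\<close>

lemma MK_inf_le_of_frequently:
  assumes \<nu>: "\<forall>\<^sub>F k in sequentially. \<nu> k \<in> Prob" "limitin narrow \<nu> \<mu>\<^sub>1 sequentially"
    and freq: "\<exists>\<^sub>F k in sequentially. S_inf R \<mu>\<^sub>0 k (\<nu> k) < ereal a"
  shows "MK_inf C \<mu>\<^sub>0 \<mu>\<^sub>1 \<le> ennreal a"
proof -
  define A where "A = {k. S_inf R \<mu>\<^sub>0 k (\<nu> k) < ereal a}"
  \<comment> \<open>The trace of \<open>sequentially\<close> on \<open>A\<close>, in place of a
    subsequence.\<close>
  define F where "F = inf sequentially (principal A)"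
  have F: "F \<noteq> bot" "F \<le> sequentially"
    using freq by (auto simp: F_def A_def frequently_def trivial_limit_def eventually_inf_principal)
  have "\<forall>k\<in>A. \<exists>P. P \<in> couplings_dyn \<mu>\<^sub>0 (\<nu> k) \<and> S_cost R \<mu>\<^sub>0 k P < ereal a"
    unfolding A_def S_inf_def INF_less_iff by blast
  then obtain P where P: "\<forall>k\<in>A. P k \<in> couplings_dyn \<mu>\<^sub>0 (\<nu> k) \<and> S_cost R \<mu>\<^sub>0 k (P k) < ereal a"
    by (rule bchoice[THEN exE])
  then have good: "\<forall>\<^sub>F k in F. P k \<in> couplings_dyn \<mu>\<^sub>0 (\<nu> k) \<and> S_cost R \<mu>\<^sub>0 k (P k) \<le> ereal a"
    unfolding F_def eventually_inf_principal by (intro always_eventually) (auto intro: less_imp_le)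
  then have "\<forall>\<^sub>F k in F. P k \<in> Prob \<and> marginal 0 (P k) = \<mu>\<^sub>0 \<and> S_cost R \<mu>\<^sub>0 k (P k) \<le> ereal a"
    by eventually_elim (auto simp: couplings_dyn_def)
  from S_cost_sublevel_cluster[OF \<mu>\<^sub>0 F this]
  obtain Q where Q: "Q \<in> Prob" "\<forall>(I :: ('a cadlag \<Rightarrow> real) set) e. finite I \<longrightarrow> I \<subseteq> bcontfun \<longrightarrow> e > 0 \<longrightarrow>
    (\<exists>\<^sub>F k in F. \<forall>f\<in>I. \<bar>(\<integral>\<omega>. f \<omega> \<partial>P k) - (\<integral>\<omega>. f \<omega> \<partial>Q)\<bar> < e)" ..
  have "\<exists>\<^sub>F k in F. \<bar>(\<integral>\<omega>. f \<omega> \<partial>P k) - (\<integral>\<omega>. f \<omega> \<partial>Q)\<bar> < e" if "f \<in> bcontfun" "e > 0"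
    for f :: "'a cadlag \<Rightarrow> real" and e using Q(2)[rule_format, of "{f}" e] that by simp
  from cluster_point_in_couplings[OF \<mu>\<^sub>0 \<mu>\<^sub>1 F(2) \<nu> good Q(1) this]
  have "Q \<in> couplings_dyn \<mu>\<^sub>0 \<mu>\<^sub>1" "MK_cost C Q \<le> ennreal a" by auto
  then show ?thesis unfolding MK_inf_def by (rule INF_lower2)
qed

lemma S_inf_eventually_greater:
  assumes \<nu>: "\<forall>\<^sub>F k in sequentially. \<nu> k \<in> Prob" "limitin narrow \<nu> \<mu>\<^sub>1 sequentially"
    and y: "y < enn2ereal (MK_inf C \<mu>\<^sub>0 \<mu>\<^sub>1)"
  shows "\<forall>\<^sub>F k in sequentially. y < S_inf R \<mu>\<^sub>0 k (\<nu> k)"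
proof (cases "y < 0")
  \<comment> \<open>Negative \<open>y\<close> are treated apart: the comparison below needs a
    positive threshold \<open>a\<close>, as \<open>ennreal a\<close> would collapse to 0
    otherwise.\<close>
  case True
  show ?thesis
    using eventually_ge_at_top[of 1]
  proof eventually_elim
    case (elim k)
    have "0 \<le> S_inf R \<mu>\<^sub>0 k (\<nu> k)"
      unfolding S_inf_def using elim by (intro INF_greatest S_cost_nonneg \<mu>\<^sub>0 couplings_dynD(1))
    then show ?case using True by simp
  qed
next
  case False
  obtain a where a: "y < ereal a" "ereal a < enn2ereal (MK_inf C \<mu>\<^sub>0 \<mu>\<^sub>1)"
    using ereal_dense2[OF y] by blast
  have "0 < ereal a" using False a(1) by (metis not_less le_less_trans)
  then have a0: "a > 0" by simp
  show ?thesis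
  proof (rule ccontr)
    assume "\<not> ?thesis"
    then have "\<exists>\<^sub>F k in sequentially. S_inf R \<mu>\<^sub>0 k (\<nu> k) \<le> y" by (simp add: frequently_def not_le)
    then have "\<exists>\<^sub>F k in sequentially. S_inf R \<mu>\<^sub>0 k (\<nu> k) < ereal a"
      by (rule frequently_elim1) (erule le_less_trans, rule a(1))
    from MK_inf_le_of_frequently[OF \<nu> this] have "enn2ereal (MK_inf C \<mu>\<^sub>0 \<mu>\<^sub>1) \<le> enn2ereal (ennreal a)"
      by (simp only: less_eq_ennreal.rep_eq)
    then show False using a(2) a0 by (simp add: enn2ereal_ennreal)
  qed
qed

text \<open>Each tolerance 1/(n+1) is met for all large k by \<open>eventually_recovery\<close>, and
  \<open>diagonal_index\<close> lets it shrink with k. Only the upper bound on the infima is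
  constructed; the lower bound holds along every narrowly convergent sequence.\<close>

lemma ex_recovery_seq_finite:
  assumes fin: "MK_inf C \<mu>\<^sub>0 \<mu>\<^sub>1 < \<infinity>"
  shows "\<exists>\<nu>. recovery_seq R C \<mu>\<^sub>0 \<mu>\<^sub>1 \<nu>"
proof -
  obtain r where r: "MK_inf C \<mu>\<^sub>0 \<mu>\<^sub>1 = ennreal r" "0 \<le> r" using fin by (cases "MK_inf C \<mu>\<^sub>0 \<mu>\<^sub>1") auto
  let ?d = "\<lambda>n :: nat. 1 / (real n + 1)"
  define close where "close n \<nu> \<longleftrightarrow> (\<forall>h m. h \<in> borel_measurable borel \<longrightarrow> (\<forall>x. 0 \<le> h x \<and> h x \<le> m) \<longrightarrow> 0 \<le> m \<longrightarrow>
        (\<forall>x y. \<bar>h x - h y\<bar> \<le> m * dist x y) \<longrightarrow>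
        (\<integral>x. h x \<partial>\<mu>\<^sub>1) - 2 * m * ?d n \<le> (\<integral>x. h x \<partial>\<nu>))" for n :: nat and \<nu> :: "'a measure"
  \<comment> \<open>One \<open>?d n\<close> pays for the near-optimality of the chosen
    \<open>P\<close>, the other for the slack in the cost of the mixture.\<close>
  define \<Phi> where "\<Phi> n k \<longleftrightarrow> (\<exists>\<nu>\<in>Prob. S_inf R \<mu>\<^sub>0 k \<nu> \<le> ereal (r + 2 * ?d n) \<and> close n \<nu>)" for n k
  have "\<forall>\<^sub>F k in sequentially. \<Phi> n k" for n
  proof -
    have d: "?d n > 0" by simp
    have "MK_inf C \<mu>\<^sub>0 \<mu>\<^sub>1 < ennreal (r + ?d n)" unfolding r(1) using r(2) d by (intro ennreal_lessI) linarith+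
    then obtain P where P: "P \<in> couplings_dyn \<mu>\<^sub>0 \<mu>\<^sub>1" "MK_cost C P < ennreal (r + ?d n)"
      unfolding MK_inf_def INF_less_iff by blast
    have finP: "MK_cost C P < \<infinity>" using P(2) by (rule less_trans) simp
    have cost: "enn2ereal (MK_cost C P) \<le> ereal (r + ?d n)"
    proof -
      have "enn2ereal (MK_cost C P) \<le> enn2ereal (ennreal (r + ?d n))"
        using P(2) by (simp only: less_eq_ennreal.rep_eq[symmetric] less_imp_le)
      then show ?thesis using r(2) by (simp add: enn2ereal_ennreal del: ennreal_plus)
    qed
    show ?thesis
      using eventually_recovery[OF couplings_dynD(1)[OF P(1)] finP d d]
    proof eventually_elim
      case (elim k)
      then obtain Q where Q: "Q \<in> Prob" "marginal 0 Q = \<mu>\<^sub>0"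
        "S_cost R \<mu>\<^sub>0 k Q \<le> enn2ereal (MK_cost C P) + ereal (?d n)" "close n (marginal 1 Q)"
        unfolding couplings_dynD(2)[OF P(1)] couplings_dynD(3)[OF P(1)] close_def by blast
      have "S_inf R \<mu>\<^sub>0 k (marginal 1 Q) \<le> S_cost R \<mu>\<^sub>0 k Q"
        unfolding S_inf_def using Q by (intro INF_lower) (auto simp: couplings_dyn_def)
      also have "\<dots> \<le> ereal (r + ?d n) + ereal (?d n)"
        using Q(3) add_right_mono[OF cost] by (rule order_trans)
      finally have "S_inf R \<mu>\<^sub>0 k (marginal 1 Q) \<le> ereal (r + 2 * ?d n)" by (simp add: add.commute)
      moreover have "marginal 1 Q \<in> Prob" using Q(1) by (intro marginal_Prob) auto
      ultimately show ?case unfolding \<Phi>_def using Q(4) by blast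
    qed
  qed
  from diagonal_index[of \<Phi>, OF this] obtain idx where idx: "filterlim idx at_top sequentially"
    "\<forall>\<^sub>F k in sequentially. \<Phi> (idx k) k" by blast
  \<comment> \<open>Where \<open>\<Phi>\<close> fails, \<open>\<mu>\<^sub>1\<close> serves as a
    default, so every term is a probability measure.\<close>
  have "\<exists>\<nu>. \<nu> \<in> Prob \<and> (\<Phi> (idx k) k \<longrightarrow> S_inf R \<mu>\<^sub>0 k \<nu> \<le> ereal (r + 2 * ?d (idx k)) \<and> close (idx k) \<nu>)" for k
  proof (cases "\<Phi> (idx k) k")
    case True
    then obtain \<nu> where "\<nu> \<in> Prob" "S_inf R \<mu>\<^sub>0 k \<nu> \<le> ereal (r + 2 * ?d (idx k))" "close (idx k) \<nu>"
      unfolding \<Phi>_def by (elim bexE conjE)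
    then show ?thesis by (intro exI[of _ \<nu>] conjI impI)
  qed (use \<mu>\<^sub>1 in \<open>intro exI[of _ \<mu>\<^sub>1], simp\<close>)
  then obtain \<nu> where \<nu>: "\<And>k. \<nu> k \<in> Prob"
    and \<nu>\<Phi>: "\<And>k. \<Phi> (idx k) k \<Longrightarrow> S_inf R \<mu>\<^sub>0 k (\<nu> k) \<le> ereal (r + 2 * ?d (idx k)) \<and> close (idx k) (\<nu> k)"
    by metis
  have ev: "\<forall>\<^sub>F k in sequentially. S_inf R \<mu>\<^sub>0 k (\<nu> k) \<le> ereal (r + 2 * ?d (idx k)) \<and> close (idx k) (\<nu> k)"
    using idx(2) by eventually_elim (rule \<nu>\<Phi>)
  have small: "\<forall>\<^sub>F k in sequentially. b * ?d (idx k) < e" if "e > 0" for b e :: real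
  proof -
    have "(\<lambda>n. b * (1 / real (Suc n))) \<longlonglongrightarrow> b * 0" by (intro tendsto_intros LIMSEQ_Suc lim_inverse_n')
    then have "\<forall>\<^sub>F n in sequentially. b * (1 / real (Suc n)) < e" using that by (intro order_tendstoD(2)) auto
    then show ?thesis using idx(1) by (auto dest: eventually_compose_filterlim simp: add.commute)
  qed
  have \<nu>ev: "\<forall>\<^sub>F k in sequentially. \<nu> k \<in> Prob" using \<nu> by simp
  have lim: "limitin narrow \<nu> \<mu>\<^sub>1 sequentially"
  proof (rule limitin_narrowI_lipschitz[OF \<nu>ev \<mu>\<^sub>1])
    fix h :: "'a \<Rightarrow> real" and m :: nat and e :: real
    assume h: "\<And>x. 0 \<le> h x" "\<And>x. h x \<le> real m" "\<And>x y. \<bar>h x - h y\<bar> \<le> real m * dist x y" "h \<in> bcontfun"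
      and e: "e > 0"
    from ev small[OF e, of "2 * real m"]
    show "\<forall>\<^sub>F k in sequentially. (\<integral>x. h x \<partial>\<mu>\<^sub>1) - e \<le> (\<integral>x. h x \<partial>\<nu> k)"
    proof eventually_elim
      case (elim k)
      have "(\<integral>x. h x \<partial>\<mu>\<^sub>1) - 2 * real m * ?d (idx k) \<le> (\<integral>x. h x \<partial>\<nu> k)"
        using elim(1) h bcontfun_measurable[OF h(4)] unfolding close_def by simp
      then show ?case using elim(2) by simp
    qed
  qed
  have "(\<lambda>k. S_inf R \<mu>\<^sub>0 k (\<nu> k)) \<longlonglongrightarrow> enn2ereal (MK_inf C \<mu>\<^sub>0 \<mu>\<^sub>1)"
  proof (rule order_tendstoI)
    show "\<forall>\<^sub>F k in sequentially. y < S_inf R \<mu>\<^sub>0 k (\<nu> k)" if "y < enn2ereal (MK_inf C \<mu>\<^sub>0 \<mu>\<^sub>1)" for y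
      by (rule S_inf_eventually_greater[OF \<nu>ev lim that])
    fix y assume "enn2ereal (MK_inf C \<mu>\<^sub>0 \<mu>\<^sub>1) < y"
    then obtain b where b: "r < b" "ereal b < y"
      using ereal_dense2 r by (fastforce simp: enn2ereal_ennreal)
    have "\<forall>\<^sub>F k in sequentially. 2 * ?d (idx k) < b - r" using b(1) by (intro small) simp
    with ev show "\<forall>\<^sub>F k in sequentially. S_inf R \<mu>\<^sub>0 k (\<nu> k) < y"
    proof eventually_elim
      case (elim k)
      have "S_inf R \<mu>\<^sub>0 k (\<nu> k) \<le> ereal (r + 2 * ?d (idx k))" using elim by blast
      also have "\<dots> \<le> ereal b" using elim by simp
      finally show ?case using b(2) by (rule le_less_trans)
    qed
  qed
  then show ?thesis using \<nu> lim unfolding recovery_seq_def by blast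
qed

text \<open>If the infimum is infinite, the lower bound alone forces divergence along every narrowly
  convergent sequence, so the constant one will do.\<close>

lemma ex_recovery_seq: "\<exists>\<nu>. recovery_seq R C \<mu>\<^sub>0 \<mu>\<^sub>1 \<nu>"
proof (cases "MK_inf C \<mu>\<^sub>0 \<mu>\<^sub>1 < \<infinity>")
  case False
  then have inf: "MK_inf C \<mu>\<^sub>0 \<mu>\<^sub>1 = \<infinity>" by (simp add: less_top[symmetric])
  have ev: "\<forall>\<^sub>F k in sequentially. \<mu>\<^sub>1 \<in> Prob" using \<mu>\<^sub>1 by simp
  have lim: "limitin narrow (\<lambda>_. \<mu>\<^sub>1) \<mu>\<^sub>1 sequentially"
    unfolding limitin_narrow_iff[OF ev \<mu>\<^sub>1] by simp
  have "(\<lambda>k. S_inf R \<mu>\<^sub>0 k \<mu>\<^sub>1) \<longlonglongrightarrow> enn2ereal (MK_inf C \<mu>\<^sub>0 \<mu>\<^sub>1)"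
    by (rule order_tendstoI) (simp_all add: S_inf_eventually_greater[OF ev lim] inf)
  then have "recovery_seq R C \<mu>\<^sub>0 \<mu>\<^sub>1 (\<lambda>_. \<mu>\<^sub>1)" using lim \<mu>\<^sub>1 by (simp add: recovery_seq_def)
  then show ?thesis by (rule exI[of _ "\<lambda>_. \<mu>\<^sub>1"])
qed (rule ex_recovery_seq_finite)

section \<open>Convergence of the solutions\<close>

context
  fixes \<nu> :: "nat \<Rightarrow> 'a measure"
  assumes \<nu>: "recovery_seq R C \<mu>\<^sub>0 \<mu>\<^sub>1 \<nu>" and fin: "MK_inf C \<mu>\<^sub>0 \<mu>\<^sub>1 < \<infinity>"
begin

lemma recovery_seqD:
  "\<forall>\<^sub>F k in sequentially. \<nu> k \<in> Prob" "limitin narrow \<nu> \<mu>\<^sub>1 sequentially"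
  "(\<lambda>k. S_inf R \<mu>\<^sub>0 k (\<nu> k)) \<longlonglongrightarrow> enn2ereal (MK_inf C \<mu>\<^sub>0 \<mu>\<^sub>1)"
  using \<nu> eventually_mono[OF eventually_ge_at_top[of "1::nat"], of "\<lambda>k. \<nu> k \<in> Prob"]
  by (auto simp: recovery_seq_def)

lemma eventually_S_solution_ex1: "\<forall>\<^sub>F k in sequentially. \<exists>!P. S_solution R \<mu>\<^sub>0 k (\<nu> k) P"
proof -
  have "enn2ereal (MK_inf C \<mu>\<^sub>0 \<mu>\<^sub>1) < \<infinity>" using fin by (simp add: less_ennreal.rep_eq)
  with recovery_seqD(3) have "\<forall>\<^sub>F k in sequentially. S_inf R \<mu>\<^sub>0 k (\<nu> k) < \<infinity>" by (rule order_tendstoD)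
  then show ?thesis using recovery_seqD(1) eventually_ge_at_top[of 1]
    by eventually_elim (intro S_solution_ex1 \<mu>\<^sub>0)
qed

context
  fixes Phat :: "nat \<Rightarrow> 'a cadlag measure"
  assumes Phat: "\<forall>\<^sub>F k in sequentially. S_solution R \<mu>\<^sub>0 k (\<nu> k) (Phat k)"
begin

lemma Phat_couplings: "\<forall>\<^sub>F k in sequentially. Phat k \<in> couplings_dyn \<mu>\<^sub>0 (\<nu> k)"
  using Phat by eventually_elim (rule S_solutionD)

lemma Phat_cost:
  assumes "MK_inf C \<mu>\<^sub>0 \<mu>\<^sub>1 < ennreal a"
  shows "\<forall>\<^sub>F k in sequentially. S_cost R \<mu>\<^sub>0 k (Phat k) \<le> ereal a"
proof -
  have "0 \<le> a"
  proof (rule ccontr)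
    assume "\<not> 0 \<le> a"
    then have "ennreal a = 0" by (simp add: ennreal_neg)
    then show False using assms by simp
  qed
  then have "enn2ereal (MK_inf C \<mu>\<^sub>0 \<mu>\<^sub>1) < ereal a"
    using assms by (simp add: less_ennreal.rep_eq enn2ereal_ennreal)
  with recovery_seqD(3) have "\<forall>\<^sub>F k in sequentially. S_inf R \<mu>\<^sub>0 k (\<nu> k) < ereal a" by (rule order_tendstoD)
  then show ?thesis using Phat
  proof eventually_elim
    case (elim k)
    then show ?case using S_solutionD(2)[OF elim(2)] by (meson le_less_trans less_imp_le)
  qed
qed

text \<open>Stated for an arbitrary filter because it has two uses: \<open>sequentially\<close> for
  limit points, and a filter avoiding a neighbourhood for convergence. Optimality holds since the
  cost at \<open>Q\<close> is at most every real above the infimum.\<close>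

lemma cluster_point_MK_solution:
  assumes F: "F \<noteq> bot" "F \<le> sequentially" and Q: "Q \<in> Prob"
    and cluster: "\<And>(f :: 'a cadlag \<Rightarrow> real) e. f \<in> bcontfun \<Longrightarrow> e > 0 \<Longrightarrow>
      \<exists>\<^sub>F k in F. \<bar>(\<integral>\<omega>. f \<omega> \<partial>Phat k) - (\<integral>\<omega>. f \<omega> \<partial>Q)\<bar> < e"
  shows "MK_solution C \<mu>\<^sub>0 \<mu>\<^sub>1 Q"
proof -
  have main: "Q \<in> couplings_dyn \<mu>\<^sub>0 \<mu>\<^sub>1 \<and> MK_cost C Q \<le> ennreal a" if "MK_inf C \<mu>\<^sub>0 \<mu>\<^sub>1 < ennreal a" for a
    using filter_leD[OF F(2) eventually_conj[OF Phat_couplings Phat_cost[OF that]]]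
    by (rule cluster_point_in_couplings[OF \<mu>\<^sub>0 \<mu>\<^sub>1 F(2) recovery_seqD(1,2) _ Q cluster])
  obtain r where r: "MK_inf C \<mu>\<^sub>0 \<mu>\<^sub>1 = ennreal r" "0 \<le> r" using fin by (cases "MK_inf C \<mu>\<^sub>0 \<mu>\<^sub>1") auto
  have "Q \<in> couplings_dyn \<mu>\<^sub>0 \<mu>\<^sub>1" using main[of "r + 1"] r by (simp add: ennreal_lessI)
  moreover have le: "MK_cost C Q \<le> MK_inf C \<mu>\<^sub>0 \<mu>\<^sub>1"
  proof (rule ennreal_le_epsilon)
    fix e :: real assume "0 < e"
    then show "MK_cost C Q \<le> MK_inf C \<mu>\<^sub>0 \<mu>\<^sub>1 + ennreal e" using main[of "r + e"] r by (simp add: ennreal_lessI)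
  qed
  moreover have "MK_inf C \<mu>\<^sub>0 \<mu>\<^sub>1 \<le> MK_cost C Q'" if "Q' \<in> couplings_dyn \<mu>\<^sub>0 \<mu>\<^sub>1" for Q'
    unfolding MK_inf_def using that by (rule INF_lower)
  ultimately show ?thesis
    by (auto simp: MK_solution_def is_arg_min_def not_less intro: order_trans)
qed

lemma limit_point_MK_solution:
  assumes "limit_point_of_seq narrow Phat P"
  shows "MK_solution C \<mu>\<^sub>0 \<mu>\<^sub>1 P"
proof (rule cluster_point_MK_solution[OF sequentially_bot order_refl])
  show P: "P \<in> Prob" using assms by (simp add: limit_point_of_seq_def topspace_narrow)
  fix f :: "'a cadlag \<Rightarrow> real" and e :: real assume f: "f \<in> bcontfun" and "e > 0"
  then have "P \<in> {M \<in> Prob. \<bar>(\<integral>\<omega>. f \<omega> \<partial>M) - (\<integral>\<omega>. f \<omega> \<partial>P)\<bar> < e}" using P by simp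
  then have "\<exists>\<^sub>F k in sequentially. Phat k \<in> {M \<in> Prob. \<bar>(\<integral>\<omega>. f \<omega> \<partial>M) - (\<integral>\<omega>. f \<omega> \<partial>P)\<bar> < e}"
    using assms openin_narrow_integral[OF f] unfolding limit_point_of_seq_def by blast
  then show "\<exists>\<^sub>F k in sequentially. \<bar>(\<integral>\<omega>. f \<omega> \<partial>Phat k) - (\<integral>\<omega>. f \<omega> \<partial>P)\<bar> < e"
    by (rule frequently_elim1) simp
qed

text \<open>A neighbourhood missed infinitely often would carry a filter along which bounded costs
  produce a cluster point. That point is a solution, hence \<open>P\<close>, so the filter would
  have to meet the neighbourhood after all.\<close>

lemma limitin_unique_MK_solution:
  assumes P: "MK_solution C \<mu>\<^sub>0 \<mu>\<^sub>1 P" and unique: "\<And>Q. MK_solution C \<mu>\<^sub>0 \<mu>\<^sub>1 Q \<Longrightarrow> Q = P"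
  shows "limitin narrow Phat P sequentially"
  unfolding limitin_def topspace_narrow
proof (intro conjI allI impI)
  show "P \<in> Prob" using P by (auto simp: MK_solution_def is_arg_min_def couplings_dyn_def)
  fix U assume U: "openin narrow U \<and> P \<in> U"
  show "\<forall>\<^sub>F k in sequentially. Phat k \<in> U"
  proof (rule ccontr)
    assume neg: "\<not> ?thesis"
    define F where "F = inf sequentially (principal {k. Phat k \<notin> U})"
    have F: "F \<noteq> bot" "F \<le> sequentially"
      using neg by (auto simp: F_def trivial_limit_def eventually_inf_principal)
    have out: "\<forall>\<^sub>F k in F. Phat k \<notin> U" by (simp add: F_def eventually_inf_principal)
    obtain r where r: "MK_inf C \<mu>\<^sub>0 \<mu>\<^sub>1 = ennreal r" "0 \<le> r" using fin by (cases "MK_inf C \<mu>\<^sub>0 \<mu>\<^sub>1") auto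
    have "MK_inf C \<mu>\<^sub>0 \<mu>\<^sub>1 < ennreal (r + 1)" using r by (simp add: ennreal_lessI)
    from eventually_conj[OF Phat_couplings Phat_cost[OF this]]
    have "\<forall>\<^sub>F k in sequentially. Phat k \<in> Prob \<and> marginal 0 (Phat k) = \<mu>\<^sub>0 \<and> S_cost R \<mu>\<^sub>0 k (Phat k) \<le> ereal (r + 1)"
      by eventually_elim (auto simp: couplings_dyn_def)
    from filter_leD[OF F(2) this] have good: "\<forall>\<^sub>F k in F. Phat k \<in> Prob \<and> marginal 0 (Phat k) = \<mu>\<^sub>0 \<and> S_cost R \<mu>\<^sub>0 k (Phat k) \<le> ereal (r + 1)" .
    from S_cost_sublevel_cluster[OF \<mu>\<^sub>0 F good]
    obtain Q where Q: "Q \<in> Prob" "\<forall>(I :: ('a cadlag \<Rightarrow> real) set) e. finite I \<longrightarrow> I \<subseteq> bcontfun \<longrightarrow> e > 0 \<longrightarrow>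
      (\<exists>\<^sub>F k in F. \<forall>f\<in>I. \<bar>(\<integral>\<omega>. f \<omega> \<partial>Phat k) - (\<integral>\<omega>. f \<omega> \<partial>Q)\<bar> < e)" ..
    have "\<exists>\<^sub>F k in F. \<bar>(\<integral>\<omega>. f \<omega> \<partial>Phat k) - (\<integral>\<omega>. f \<omega> \<partial>Q)\<bar> < e" if "f \<in> bcontfun" "e > 0"
      for f :: "'a cadlag \<Rightarrow> real" and e using Q(2)[rule_format, of "{f}" e] that by simp
    from cluster_point_MK_solution[OF F Q(1) this] have "Q = P" by (rule unique)
    from U have "openin narrow U" "P \<in> U" by simp_all
    from narrow_nbhd[OF this] obtain I and e :: real where I: "finite I" "I \<subseteq> bcontfun" "e > 0"
      "\<forall>M\<in>Prob. (\<forall>f\<in>I. \<bar>(\<integral>x. f x \<partial>M) - (\<integral>x. f x \<partial>P)\<bar> < e) \<longrightarrow> M \<in> U"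
      by (elim exE conjE) (rule that)
    have "\<exists>\<^sub>F k in F. \<forall>f\<in>I. \<bar>(\<integral>\<omega>. f \<omega> \<partial>Phat k) - (\<integral>\<omega>. f \<omega> \<partial>P)\<bar> < e"
      using Q(2)[rule_format, OF I(1,2,3)] \<open>Q = P\<close> by simp
    from frequently_ex[OF frequently_conj_eventually[OF this eventually_conj[OF out good]]]
    show False using I(4) by blast
  qed
qed

end

end

end

end

theorem theorem3p6:
  fixes C :: "'a::polish_space cadlag \<Rightarrow> ennreal"
    and R :: "nat \<Rightarrow> 'a \<Rightarrow> 'a cadlag measure"
    and \<mu>\<^sub>0 \<mu>\<^sub>1 :: "'a measure"
  assumes C_lsc: "lower_semicont C"
    and kernel: "\<And>k. k \<ge> 1 \<Longrightarrow> R k \<in> borel \<rightarrow>\<^sub>M prob_algebra borel"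
    and start: "\<And>k x. k \<ge> 1 \<Longrightarrow> measure (R k x) {\<omega>. cpath \<omega> 0 = x} = 1"
    and coercive: "\<And>x. coercive (\<lambda>\<omega>. C \<omega> + convex_indicator {\<omega>. cpath \<omega> 0 = x} \<omega>)"
    and ldp: "\<And>x. LDP (\<lambda>k. R k x) (\<lambda>\<omega>. C \<omega> + convex_indicator {\<omega>. cpath \<omega> 0 = x} \<omega>)"
    and \<mu>\<^sub>0: "\<mu>\<^sub>0 \<in> Prob" and \<mu>\<^sub>1: "\<mu>\<^sub>1 \<in> Prob"
  shows "(\<exists>\<nu>. recovery_seq R C \<mu>\<^sub>0 \<mu>\<^sub>1 \<nu>) \<and>
    (\<forall>\<nu>. recovery_seq R C \<mu>\<^sub>0 \<mu>\<^sub>1 \<nu> \<and> MK_inf C \<mu>\<^sub>0 \<mu>\<^sub>1 < \<infinity> \<longrightarrow>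
      (\<forall>\<^sub>F k in sequentially. \<exists>!P. S_solution R \<mu>\<^sub>0 k (\<nu> k) P) \<and>
      (\<forall>Phat. (\<forall>\<^sub>F k in sequentially. S_solution R \<mu>\<^sub>0 k (\<nu> k) (Phat k)) \<longrightarrow>
        (\<forall>P. limit_point_of_seq narrow Phat P \<longrightarrow> MK_solution C \<mu>\<^sub>0 \<mu>\<^sub>1 P) \<and>
        (\<forall>P. MK_solution C \<mu>\<^sub>0 \<mu>\<^sub>1 P \<and> (\<forall>Q. MK_solution C \<mu>\<^sub>0 \<mu>\<^sub>1 Q \<longrightarrow> Q = P) \<longrightarrow>
          limitin narrow Phat P sequentially)))"
proof -
  interpret ldp_kernel C R by standard (fact C_lsc kernel start coercive ldp)+
  show ?thesis
    using ex_recovery_seq[OF \<mu>\<^sub>0 \<mu>\<^sub>1] eventually_S_solution_ex1[OF \<mu>\<^sub>0 \<mu>\<^sub>1]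
      limit_point_MK_solution[OF \<mu>\<^sub>0 \<mu>\<^sub>1] limitin_unique_MK_solution[OF \<mu>\<^sub>0 \<mu>\<^sub>1]
    by blast
qed

end
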